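(* Let $\xi$ be a Lévy process with $\psi(u)=\log\mathbb E e^{u\xi(1)}<\infty$ for all $u\in\mathbb R$, $\xi(1)$ not a.s. constant, and let $\xi_i$, $i\in\mathbb N$, be independent copies of $\xi$. Let $(s_N)$ be a non-negative sequence with \[ \lim_{N\to\infty}s_N=\infty,\qquad \liminf_{N\to\infty}\frac{\log N}{s_N}>\lambda_2:=2\psi'(2)-\psi(2). \] Let $Z_N(t)=\sum_{i=1}^N e^{\xi_i(s_N+t)}$, $t\ge -s_N$. Then for every $T>0$, weakly on the Skorokhod space $D[-T,T]$, \[ \frac{Z_N(\cdot)-\mathbb E Z_N(\cdot)}{\sqrt{\operatorname{Var} Z_N(\cdot)}}\Longrightarrow \mathcal X(\cdot),\qquad N\to\infty, \] where $\{\mathcal X(t),t\in\mathbb R\}$ is a zero-mean Gaussian process with covariance $\operatorname{Cov}(\mathcal X(t_1),\mathcal X(t_2))=e^{(\psi(1)-\psi(2)/2)|t_2-t_1|}$, $t_1,t_2\in\mathbb R$.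
   Context: A Lévy process is a process with stationary independent increments and càdlàg sample paths, started at $0$. The left-hand side is well defined on $[-T,T]$ for $N$ large enough (once $s_N\ge T$). *)

theory Defs
  imports "HOL-Probability.Probability"
begin

definition cadlag_halfline :: "(real \<Rightarrow> real) \<Rightarrow> bool" where
  "cadlag_halfline x \<longleftrightarrow>
     (\<forall>t\<ge>0. (x \<longlongrightarrow> x t) (at_right t)) \<and>
     (\<forall>t>0. \<exists>l. (x \<longlongrightarrow> l) (at_left t))"

definition cadlag_on :: "real \<Rightarrow> real \<Rightarrow> (real \<Rightarrow> real) \<Rightarrow> bool" where
  "cadlag_on a b x \<longleftrightarrow>
     (\<forall>t\<in>{a..<b}. (x \<longlongrightarrow> x t) (at_right t)) \<and>
     (\<forall>t\<in>{a<..b}. \<exists>l. (x \<longlongrightarrow> l) (at_left t))"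

definition levy_process :: "'a measure \<Rightarrow> (real \<Rightarrow> 'a \<Rightarrow> real) \<Rightarrow> bool" where
  "levy_process M \<xi> \<longleftrightarrow>
     prob_space M \<and>
     (\<forall>t\<ge>0. \<xi> t \<in> borel_measurable M) \<and>
     (\<forall>\<omega>\<in>space M. \<xi> 0 \<omega> = 0) \<and>
     (\<forall>\<omega>\<in>space M. cadlag_halfline (\<lambda>t. \<xi> t \<omega>)) \<and>
     (\<forall>s t. 0 \<le> s \<longrightarrow> 0 \<le> t \<longrightarrow>
        distr M borel (\<lambda>\<omega>. \<xi> (s + t) \<omega> - \<xi> s \<omega>) = distr M borel (\<xi> t)) \<and>
     (\<forall>ts::real list. sorted_wrt (<) ts \<longrightarrow> (\<forall>t\<in>set ts. 0 \<le> t) \<longrightarrow>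
        prob_space.indep_vars M (\<lambda>_. borel)
          (\<lambda>i \<omega>. \<xi> (ts ! Suc i) \<omega> - \<xi> (ts ! i) \<omega>) {..<length ts - 1})"

definition path_law :: "'a measure \<Rightarrow> (real \<Rightarrow> 'a \<Rightarrow> real) \<Rightarrow> (real \<Rightarrow> real) measure" where
  "path_law M \<xi> = distr M (Pi\<^sub>M {0..} (\<lambda>_. borel)) (\<lambda>\<omega>. restrict (\<lambda>t. \<xi> t \<omega>) {0..})"

definition cumulant :: "'a measure \<Rightarrow> (real \<Rightarrow> 'a \<Rightarrow> real) \<Rightarrow> real \<Rightarrow> real" where
  "cumulant M \<xi> u = ln (integral\<^sup>L M (\<lambda>\<omega>. exp (u * \<xi> 1 \<omega>)))"

definition Zsum :: "(nat \<Rightarrow> real \<Rightarrow> 'a \<Rightarrow> real) \<Rightarrow> (nat \<Rightarrow> real) \<Rightarrow> nat \<Rightarrow> real \<Rightarrow> 'a \<Rightarrow> real" where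
  "Zsum \<xi>s s N t \<omega> = (\<Sum>i\<in>{1..N}. exp (\<xi>s i (s N + t) \<omega>))"

definition Znorm :: "'a measure \<Rightarrow> (nat \<Rightarrow> real \<Rightarrow> 'a \<Rightarrow> real) \<Rightarrow> (nat \<Rightarrow> real) \<Rightarrow> nat \<Rightarrow> real \<Rightarrow> 'a \<Rightarrow> real" where
  "Znorm M \<xi>s s N t \<omega> =
     (let m = integral\<^sup>L M (Zsum \<xi>s s N t);
          v = integral\<^sup>L M (\<lambda>\<omega>'. (Zsum \<xi>s s N t \<omega>' - m)\<^sup>2)
      in (Zsum \<xi>s s N t \<omega> - m) / sqrt v)"

definition skorokhod_dist :: "real \<Rightarrow> real \<Rightarrow> (real \<Rightarrow> real) \<Rightarrow> (real \<Rightarrow> real) \<Rightarrow> real" where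
  "skorokhod_dist a b x y =
     Inf {max (SUP t\<in>{a..b}. \<bar>r t - t\<bar>) (SUP t\<in>{a..b}. \<bar>x t - y (r t)\<bar>) | r.
            strict_mono_on {a..b} r \<and> continuous_on {a..b} r \<and> r ` {a..b} = {a..b}}"

definition skorokhod_bcont :: "real \<Rightarrow> real \<Rightarrow> ((real \<Rightarrow> real) \<Rightarrow> real) \<Rightarrow> bool" where
  "skorokhod_bcont a b f \<longleftrightarrow>
     (\<exists>B. \<forall>x. cadlag_on a b x \<longrightarrow> \<bar>f x\<bar> \<le> B) \<and>
     (\<forall>x. cadlag_on a b x \<longrightarrow> (\<forall>e>0. \<exists>d>0. \<forall>y. cadlag_on a b y \<longrightarrow>
          skorokhod_dist a b x y < d \<longrightarrow> \<bar>f y - f x\<bar> < e))"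

definition gaussian_rv :: "'a measure \<Rightarrow> ('a \<Rightarrow> real) \<Rightarrow> real \<Rightarrow> real \<Rightarrow> bool" where
  "gaussian_rv M Y m v \<longleftrightarrow>
     (v = 0 \<and> Y \<in> borel_measurable M \<and> (AE \<omega> in M. Y \<omega> = m)) \<or>
     (v > 0 \<and> distributed M lborel Y (normal_density m (sqrt v)))"

definition centred_gaussian_process_on ::
  "(real \<Rightarrow> real) measure \<Rightarrow> real set \<Rightarrow> (real \<Rightarrow> real \<Rightarrow> real) \<Rightarrow> bool" where
  "centred_gaussian_process_on Q I C \<longleftrightarrow>
     (\<forall>ts a::real list. length a = length ts \<longrightarrow> set ts \<subseteq> I \<longrightarrow>
        gaussian_rv Q (\<lambda>\<omega>. \<Sum>i<length ts. a ! i * \<omega> (ts ! i)) 0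
          (\<Sum>i<length ts. \<Sum>j<length ts. a ! i * a ! j * C (ts ! i) (ts ! j)))"

end

theory Submission
  imports Defs
begin

text \<open>Put \<open>\<kappa> = \<psi> 2 / 2 - \<psi> 1 > 0\<close>. The sums
\<open>W t = N\<^sup>-\<^sup>1\<^sup>/\<^sup>2 e\<^sup>-\<^sup>\<kappa>\<^sup>s (\<Sum>i. e\<^bsup>\<xi>\<^sub>i(s + t) - \<psi>(1)(s + t)\<^esup> - 1)\<close> are martingales in \<open>t\<close> with covariance
\<open>e\<^bsup>2\<kappa> min(t, t')\<^esup> - e\<^bsup>-2\<kappa>s\<^esup>\<close>, and the normalised process is \<open>W t / sqrt (e\<^bsup>2\<kappa>t\<^esup> - e\<^bsup>-2\<kappa>s\<^esup>)\<close>.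

The growth condition on \<open>ln N / s\<close> yields the Lyapunov condition with some exponent \<open>p > 2\<close>, so the finite-dimensional laws of
\<open>W\<close> converge to those of \<open>B (e\<^bsup>2\<kappa>t\<^esup>)\<close> for a Brownian motion \<open>B\<close>. Higher moments of \<open>W\<close> need not be bounded, so tightness cannot
be read off from moments of increments. Instead, Doob's argument for the convex function \<open>max 0 (\<bar>x\<bar> - \<epsilon>)\<close> bounds the probability of an
oscillation on an interval of length \<open>h\<close> by an expectation of the increment over that interval, whose limit, by the central limit theorem,
is of order \<open>h\<^sup>2\<close>.

Because the limit is continuous, no compactness theorem is needed: a functional continuous for the uniform distance is the increasing limit
of its Lipschitz inf-convolutions, these are evaluated on step approximations up to a small error, and there they are functions of finitely
many coordinates, for which convergence follows from characteristic functions by trigonometric approximation. Skorokhod continuity itself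
is only used for measurability. Brownian motion is obtained as a Schauder series, and the limit is \<open>e\<^bsup>\<kappa>(T - t)\<^esup> B (e\<^bsup>2\<kappa>(t - T)\<^esup>)\<close>.\<close>

section \<open>Step approximations in the Skorokhod metric\<close>

text \<open>The growth condition enters through one product: up to constants and a vanishing term,
  the Lyapunov ratio is \<open>N powr (1 - p / 2) * exp (s * (\<psi> p - p / 2 * \<psi> 2))\<close>.
  So \<open>(\<psi> p - p / 2 * \<psi> 2) / (p / 2 - 1)\<close> has to stay below
  \<open>ln N / s\<close>, and this fixes how close to 2 the exponent \<open>p\<close> is taken.
  Measurability shapes the functional part. The cadlag paths are not separable for the uniform
  distance, so an inf-convolution \<open>g\<close> of \<open>f\<close> along the particle process is
  not known to be a random variable. Hence \<open>g\<close> is integrated only at step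
  approximations and at the continuous limit, and on the particle side the passage from
  \<open>g\<close> to \<open>f\<close> is a pointwise inequality. This gives a lower bound for the
  expectations; the upper bound is the same statement for \<open>- f\<close>. In the tightness
  estimate the number \<open>k\<close> of cells is fixed before \<open>N\<close> grows. A Gaussian
  fourth moment makes each cell contribute a probability of order \<open>1 / k\<^sup>2\<close>,
  hence \<open>1 / k\<close> in total; a second moment alone would only give a total of order
  1.\<close>

definition grid_floor :: "real \<Rightarrow> real \<Rightarrow> nat \<Rightarrow> real \<Rightarrow> real" where
  "grid_floor a b k t = a + (b - a) / real k * of_int \<lfloor>(t - a) * real k / (b - a)\<rfloor>"

definition grid_pt :: "real \<Rightarrow> real \<Rightarrow> nat \<Rightarrow> nat \<Rightarrow> real" where
  "grid_pt a b k j = a + (b - a) / real k * real j"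

text \<open>The values are passed as a sequence so that a functional of step paths becomes a
  function on \<open>nat \<Rightarrow> real\<close>, where continuity refers to the product
  topology. Times before \<open>a\<close> get index 0 through \<open>nat\<close>; on
  \<open>{a..b}\<close> only the indices up to \<open>k\<close> occur.\<close>

definition step_fn :: "real \<Rightarrow> real \<Rightarrow> nat \<Rightarrow> (nat \<Rightarrow> real) \<Rightarrow> real \<Rightarrow> real" where
  "step_fn a b k v t = v (nat \<lfloor>(t - a) * real k / (b - a)\<rfloor>)"

definition step_approx :: "real \<Rightarrow> real \<Rightarrow> nat \<Rightarrow> (real \<Rightarrow> real) \<Rightarrow> real \<Rightarrow> real" where
  "step_approx a b k x = step_fn a b k (\<lambda>j. x (grid_pt a b k j))"

lemma step_approx_eq:
  assumes "a < b" "k > 0" "a \<le> t"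
  shows "step_approx a b k x t = x (grid_floor a b k t)"
  using assms by (simp add: step_approx_def step_fn_def grid_pt_def grid_floor_def)

lemma floor_at_right:
  fixes t :: real
  shows "eventually (\<lambda>u. \<lfloor>u\<rfloor> = \<lfloor>t\<rfloor>) (at_right t)"
proof -
  have "eventually (\<lambda>u. u \<in> {t<..<of_int \<lfloor>t\<rfloor> + 1}) (at_right t)"
    by (rule eventually_at_right_real) linarith
  then show ?thesis
    by eventually_elim (auto simp: floor_eq_iff, linarith)
qed

lemma floor_at_left:
  fixes t :: real
  shows "eventually (\<lambda>u. \<lfloor>u\<rfloor> = \<lceil>t\<rceil> - 1) (at_left t)"
proof -
  have "eventually (\<lambda>u. u \<in> {of_int \<lceil>t\<rceil> - 1<..<t}) (at_left t)"
    by (rule eventually_at_left_real) linarith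
  then show ?thesis
    by eventually_elim (auto simp: floor_eq_iff, linarith)
qed

lemma affine_at_right:
  fixes a c t :: real assumes "c > 0"
  shows "filterlim (\<lambda>u. (u - a) * c) (at_right ((t - a) * c)) (at_right t)"
  unfolding filterlim_at
  using assms by (auto intro!: tendsto_eq_intros eventually_at_rightI[of t "t+1"])

lemma affine_at_left:
  fixes a c t :: real assumes "c > 0"
  shows "filterlim (\<lambda>u. (u - a) * c) (at_left ((t - a) * c)) (at_left t)"
  unfolding filterlim_at
  using assms by (auto intro!: tendsto_eq_intros eventually_at_leftI[of "t-1" t])

lemma cadlag_on_step_fn:
  assumes "a < b" "k > 0"
  shows "cadlag_on a b (step_fn a b k v)"
proof -
  define c where "c = real k / (b - a)"
  have c: "c > 0" using assms by (simp add: c_def)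
  have e: "step_fn a b k v t = v (nat \<lfloor>(t - a) * c\<rfloor>)" for t
    by (simp add: step_fn_def c_def)
  have "(step_fn a b k v \<longlongrightarrow> step_fn a b k v t) (at_right t)" for t
  proof (rule tendsto_eventually)
    show "\<forall>\<^sub>F u in at_right t. step_fn a b k v u = step_fn a b k v t"
      using eventually_compose_filterlim[OF floor_at_right affine_at_right[OF c, of a]]
      by eventually_elim (simp add: e)
  qed
  moreover have "(step_fn a b k v \<longlongrightarrow> v (nat (\<lceil>(t - a) * c\<rceil> - 1))) (at_left t)" for t
  proof (rule tendsto_eventually)
    show "\<forall>\<^sub>F u in at_left t. step_fn a b k v u = v (nat (\<lceil>(t - a) * c\<rceil> - 1))"
      using eventually_compose_filterlim[OF floor_at_left affine_at_left[OF c, of a]]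
      by eventually_elim (simp add: e)
  qed
  ultimately show ?thesis unfolding cadlag_on_def by blast
qed

lemma grid_floor_bounds:
  assumes "a < b" "k > 0"
  shows "grid_floor a b k t \<le> t" "t < grid_floor a b k t + (b - a) / real k"
proof -
  define c where "c = real k / (b - a)"
  have c: "c > 0" using assms by (simp add: c_def)
  have g: "grid_floor a b k t = a + of_int \<lfloor>(t - a) * c\<rfloor> / c"
    using assms by (simp add: grid_floor_def c_def)
  have h: "(b - a) / real k = 1 / c" by (simp add: c_def)
  have "of_int \<lfloor>(t - a) * c\<rfloor> \<le> (t - a) * c" "(t - a) * c < of_int \<lfloor>(t - a) * c\<rfloor> + 1" by linarith+
  then show "grid_floor a b k t \<le> t" "t < grid_floor a b k t + (b - a) / real k"
    unfolding g h using c by (auto simp: field_simps)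
qed

lemma grid_floor_mem:
  assumes "a < b" "k > 0" "t \<in> {a..b}"
  shows "grid_floor a b k t \<in> {a..b}"
proof -
  have "0 \<le> \<lfloor>(t - a) * real k / (b - a)\<rfloor>" using assms by simp
  then have "a \<le> grid_floor a b k t" unfolding grid_floor_def using assms by simp
  moreover have "grid_floor a b k t \<le> t" using grid_floor_bounds assms by blast
  ultimately show ?thesis using assms by auto
qed

lemma grid_floor_index:
  assumes "a < b" "k > 0" "t \<in> {a..b}"
  shows "nat \<lfloor>(t - a) * real k / (b - a)\<rfloor> \<le> k"
proof -
  have "(t - a) * real k / (b - a) \<le> k" using assms by (simp add: field_simps mult_right_mono)
  then show ?thesis by linarith
qed

lemma grid_pt_mem:
  assumes "a < b" "k > 0" "j \<le> k"
  shows "grid_pt a b k j \<in> {a..b}"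
proof -
  have "(b - a) / real k * real j \<le> (b - a) / real k * real k"
    using assms by (intro mult_left_mono) auto
  then show ?thesis using assms by (auto simp: grid_pt_def)
qed

text \<open>A finite partition into half-open cells on which \<open>x\<close> oscillates by at most
  \<open>e\<close>, built from the left so that boundedness and the time changes follow by rule
  induction. The right endpoint of a cell is left out because \<open>x\<close> may jump
  there.\<close>

inductive osc_chain :: "(real \<Rightarrow> real) \<Rightarrow> real \<Rightarrow> real \<Rightarrow> real \<Rightarrow> bool" for x e a where
  base: "osc_chain x e a a"
| step: "osc_chain x e a c \<Longrightarrow> c < d \<Longrightarrow> (\<And>u v. u \<in> {c..<d} \<Longrightarrow> v \<in> {c..<d} \<Longrightarrow> \<bar>x u - x v\<bar> \<le> e)
    \<Longrightarrow> osc_chain x e a d"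

lemma osc_chain_le: "osc_chain x e a c \<Longrightarrow> a \<le> c"
  by (induction rule: osc_chain.induct) auto

lemma cadlag_on_osc_chain:
  assumes x: "cadlag_on a b x" and ab: "a < b" and e: "e > 0"
  shows "osc_chain x e a b"
proof -
  define S where "S = {c. c \<le> b \<and> osc_chain x e a c}"
  have aS: "a \<in> S" using ab by (auto simp: S_def intro: base)
  have bdd: "bdd_above S" by (auto simp: S_def bdd_above_def)
  define m where "m = Sup S"
  have am: "a \<le> m" unfolding m_def using aS bdd by (rule cSup_upper)
  have mb: "m \<le> b" unfolding m_def using aS by (intro cSup_least) (auto simp: S_def)
  \<comment> \<open>The left limit at the supremum closes the chain: a last cell from some
    \<open>c\<close> in \<open>S\<close> close to \<open>m\<close> up to \<open>m\<close> has small
    oscillation.\<close>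
  have mS: "m \<in> S"
  proof (cases "m = a")
    case True then show ?thesis using aS by simp
  next
    case False
    then have "m \<in> {a<..b}" using am mb by auto
    then obtain l where l: "(x \<longlongrightarrow> l) (at_left m)" using x unfolding cadlag_on_def by blast
    have "eventually (\<lambda>u. dist (x u) l < e/2) (at_left m)"
      using tendstoD[OF l, of "e/2"] e by simp
    then obtain q where q: "q < m" "\<And>u. u > q \<Longrightarrow> u < m \<Longrightarrow> dist (x u) l < e/2"
      unfolding eventually_at_left_field by auto
    obtain c where c: "c \<in> S" "q < c"
      using q(1) less_cSup_iff[OF _ bdd, of q] aS unfolding m_def by auto
    have cm: "c \<le> m" unfolding m_def using c bdd by (intro cSup_upper)
    show ?thesis
    proof (cases "c = m")
      case True then show ?thesis using c by simp
    next
      case False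
      have "osc_chain x e a m"
      proof (rule osc_chain.step)
        show "osc_chain x e a c" using c by (simp add: S_def)
        show "c < m" using cm False by simp
        fix u v assume "u \<in> {c..<m}" "v \<in> {c..<m}"
        then have "dist (x u) l < e/2" "dist (x v) l < e/2" using q(2) c(2) by auto
        then show "\<bar>x u - x v\<bar> \<le> e" unfolding dist_real_def by linarith
      qed
      then show ?thesis using mb by (simp add: S_def)
    qed
  qed
  \<comment> \<open>Otherwise right-continuity at \<open>m\<close> would extend the chain beyond its
    supremum.\<close>
  have "m = b"
  proof (rule ccontr)
    assume "m \<noteq> b"
    then have m: "m \<in> {a..<b}" using am mb by auto
    then have l: "(x \<longlongrightarrow> x m) (at_right m)" using x unfolding cadlag_on_def by blast
    have "eventually (\<lambda>u. dist (x u) (x m) < e/2) (at_right m)"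
      using tendstoD[OF l, of "e/2"] e by simp
    then obtain q where q: "q > m" "\<And>u. u > m \<Longrightarrow> u < q \<Longrightarrow> dist (x u) (x m) < e/2"
      unfolding eventually_at_right_field by auto
    define d where "d = min q b"
    have d: "m < d" "d \<le> q" "d \<le> b" using q m by (auto simp: d_def)
    have "osc_chain x e a d"
    proof (rule osc_chain.step)
      show "osc_chain x e a m" using mS by (simp add: S_def)
      show "m < d" by fact
      fix u v assume "u \<in> {m..<d}" "v \<in> {m..<d}"
      then have "dist (x u) (x m) < e/2" "dist (x v) (x m) < e/2"
        using q(2)[of u] q(2)[of v] d e by (cases "u = m"; cases "v = m"; force)+
      then show "\<bar>x u - x v\<bar> \<le> e" unfolding dist_real_def by linarith
    qed
    then have "d \<in> S" using d by (simp add: S_def)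
    then have "d \<le> m" unfolding m_def using bdd by (rule cSup_upper)
    then show False using d by simp
  qed
  then show ?thesis using mS by (simp add: S_def)
qed

lemma osc_chain_bounded: "osc_chain x e a c \<Longrightarrow> \<exists>C. \<forall>t\<in>{a..c}. \<bar>x t\<bar> \<le> C"
proof (induction rule: osc_chain.induct)
  case base
  then show ?case by (intro exI[of _ "\<bar>x a\<bar>"]) auto
next
  case (step c d)
  then obtain C where C: "\<forall>t\<in>{a..c}. \<bar>x t\<bar> \<le> C" by blast
  show ?case
  proof (intro exI[of _ "max C (max (\<bar>x c\<bar> + e) \<bar>x d\<bar>)"] ballI)
    fix t assume "t \<in> {a..d}"
    then consider "t \<in> {a..c}" | "t \<in> {c..<d}" | "t = d" by force
    then show "\<bar>x t\<bar> \<le> max C (max (\<bar>x c\<bar> + e) \<bar>x d\<bar>)"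
    proof cases
      case 1
      then have "\<bar>x t\<bar> \<le> C" using C by blast
      then show ?thesis by linarith
    next
      case 2
      then have "\<bar>x t - x c\<bar> \<le> e" using step by auto
      then show ?thesis by linarith
    qed auto
  qed
qed

lemma cadlag_on_bounded:
  assumes "cadlag_on a b x" "a < b"
  obtains C where "\<And>t. t \<in> {a..b} \<Longrightarrow> \<bar>x t\<bar> \<le> C"
  using osc_chain_bounded[OF cadlag_on_osc_chain[OF assms, of 1]] that by (meson zero_less_one)

section \<open>Skorokhod distance and explicit time changes\<close>

lemma skorokhod_dist_le:
  assumes ab: "a < b" and e: "e \<ge> 0"
    and r: "strict_mono_on {a..b} r" "continuous_on {a..b} r" "r ` {a..b} = {a..b}"
    and rt: "\<And>t. t \<in> {a..b} \<Longrightarrow> \<bar>r t - t\<bar> \<le> e"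
    and xy: "\<And>t. t \<in> {a..b} \<Longrightarrow> \<bar>x t - y (r t)\<bar> \<le> e"
  shows "skorokhod_dist a b x y \<le> e"
proof -
  let ?D = "{max (SUP t\<in>{a..b}. \<bar>r t - t\<bar>) (SUP t\<in>{a..b}. \<bar>x t - y (r t)\<bar>) | r.
            strict_mono_on {a..b} r \<and> continuous_on {a..b} r \<and> r ` {a..b} = {a..b}}"
  \<comment> \<open>The paths are arbitrary here, so the second supremum may be a meaningless real
    number. The lower bound 0 comes from the first one alone, which is over a bounded set because
    \<open>q\<close> is continuous on a compact interval.\<close>
  have "bdd_below ?D"
  proof (rule bdd_belowI)
    fix z assume "z \<in> ?D"
    then obtain q where q: "continuous_on {a..b} q"
      and z: "z = max (SUP t\<in>{a..b}. \<bar>q t - t\<bar>) (SUP t\<in>{a..b}. \<bar>x t - y (q t)\<bar>)" by blast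
    have "compact ((\<lambda>t. \<bar>q t - t\<bar>) ` {a..b})"
      using q by (intro compact_continuous_image continuous_intros) auto
    then have "bdd_above ((\<lambda>t. \<bar>q t - t\<bar>) ` {a..b})"
      by (intro bounded_imp_bdd_above compact_imp_bounded)
    then have "\<bar>q a - a\<bar> \<le> (SUP t\<in>{a..b}. \<bar>q t - t\<bar>)"
      using ab by (intro cSUP_upper) auto
    then show "0 \<le> z" unfolding z by linarith
  qed
  then have "skorokhod_dist a b x y \<le> max (SUP t\<in>{a..b}. \<bar>r t - t\<bar>) (SUP t\<in>{a..b}. \<bar>x t - y (r t)\<bar>)"
    unfolding skorokhod_dist_def using r by (intro cInf_lower) auto
  also have "\<dots> \<le> e"
    using ab rt xy by (intro max.boundedI cSUP_least) auto
  finally show ?thesis .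
qed

lemma skorokhod_dist_le_sup:
  assumes "a < b" "e \<ge> 0" "\<And>t. t \<in> {a..b} \<Longrightarrow> \<bar>x t - y t\<bar> \<le> e"
  shows "skorokhod_dist a b x y \<le> e"
  using assms by (intro skorokhod_dist_le[where r="\<lambda>t. t"]) (auto simp: strict_mono_on_def)

definition grid_ceil :: "real \<Rightarrow> real \<Rightarrow> real \<Rightarrow> real" where
  "grid_ceil a h t = a + h * of_int \<lceil>(t - a) / h\<rceil>"

lemma grid_ceil_bounds:
  assumes "h > 0" shows "t \<le> grid_ceil a h t" "grid_ceil a h t < t + h"
proof -
  have "(t - a) / h \<le> of_int \<lceil>(t - a) / h\<rceil>" "of_int \<lceil>(t - a) / h\<rceil> < (t - a) / h + 1" by linarith+
  from mult_right_mono[OF this(1), of h] mult_strict_right_mono[OF this(2), of h]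
  have "(t - a) \<le> of_int \<lceil>(t - a) / h\<rceil> * h" "of_int \<lceil>(t - a) / h\<rceil> * h < (t - a) + h"
    using assms by (simp_all add: distrib_right)
  then show "t \<le> grid_ceil a h t" "grid_ceil a h t < t + h"
    by (auto simp: grid_ceil_def mult.commute)
qed

text \<open>This makes \<open>grid_ceil\<close> the right target for the breakpoints of a chain:
  between the images of \<open>c\<close> and \<open>d\<close> the step approximation samples
  \<open>x\<close> only in the cell from \<open>c\<close> to \<open>d\<close>, where the oscillation
  is small.\<close>

lemma grid_floor_between:
  assumes ab: "a < b" "k > 0" and t: "grid_ceil a ((b - a) / real k) c \<le> t" "t < grid_ceil a ((b - a) / real k) d"
  shows "grid_floor a b k t \<in> {c..<d}"
proof -
  define h where "h = (b - a) / real k"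
  have h: "h > 0" using ab by (simp add: h_def)
  have g: "grid_floor a b k t = a + h * of_int \<lfloor>(t - a) / h\<rfloor>"
    using ab by (simp add: grid_floor_def h_def)
  have "of_int \<lceil>(c - a) / h\<rceil> \<le> (t - a) / h"
    using t(1) h by (simp add: grid_ceil_def h_def[symmetric] field_simps)
  then have 1: "\<lceil>(c - a) / h\<rceil> \<le> \<lfloor>(t - a) / h\<rfloor>" by linarith
  have "(t - a) / h < of_int \<lceil>(d - a) / h\<rceil>"
    using t(2) h by (simp add: grid_ceil_def h_def[symmetric] field_simps)
  then have 2: "\<lfloor>(t - a) / h\<rfloor> < \<lceil>(d - a) / h\<rceil>" by linarith
  have "(c - a) / h \<le> of_int \<lfloor>(t - a) / h\<rfloor>" "of_int \<lfloor>(t - a) / h\<rfloor> < (d - a) / h"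
    using 1 2 by linarith+
  then show ?thesis unfolding g using h by (auto simp: field_simps)
qed

text \<open>Breakpoints go to the first grid point not before them. The comparison of
  \<open>x\<close> with its sampled values stops short of \<open>c\<close>, since a jump at
  \<open>c\<close> belongs to the next cell.\<close>

definition time_change :: "real \<Rightarrow> real \<Rightarrow> (real \<Rightarrow> real) \<Rightarrow> real \<Rightarrow> nat \<Rightarrow> real \<Rightarrow> (real \<Rightarrow> real) \<Rightarrow> bool" where
  "time_change a b x e k c r \<longleftrightarrow> strict_mono_on {a..c} r \<and> continuous_on {a..c} r \<and> r a = a \<and>
     r c = grid_ceil a ((b - a) / real k) c \<and> (\<forall>t\<in>{a..<c}. \<bar>x t - x (grid_floor a b k (r t))\<bar> \<le> e) \<and>
     (\<forall>t\<in>{a..c}. \<bar>r t - t\<bar> \<le> (b - a) / real k)"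

lemma time_change_exists:
  assumes ab: "a < b"
  shows "osc_chain x e a c \<Longrightarrow> \<exists>\<delta>>0. \<forall>k>0. (b - a) / real k < \<delta> \<longrightarrow> (\<exists>r. time_change a b x e k c r)"
proof (induction rule: osc_chain.induct)
  case base
  show ?case
    by (intro exI[of _ 1] conjI allI impI exI[of _ "\<lambda>t. t"])
      (auto simp: time_change_def grid_ceil_def strict_mono_on_def ab less_imp_le)
next
  case (step c d)
  then obtain \<delta> where \<delta>: "\<delta> > 0" "\<And>k. k > 0 \<Longrightarrow> (b - a) / real k < \<delta> \<Longrightarrow> \<exists>r. time_change a b x e k c r" by blast
  have ac: "a \<le> c" using step.hyps(1) by (rule osc_chain_le)
  \<comment> \<open>The time change is continued linearly on the new cell. A mesh \<open>h\<close>
    below \<open>d - c\<close> gives \<open>C < c + h < d \<le> D\<close> for the images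
    \<open>C\<close>, \<open>D\<close> of the breakpoints, so the slope is positive.\<close>
  show ?case
  proof (intro exI[of _ "min \<delta> (d - c)"] conjI allI impI)
    show "min \<delta> (d - c) > 0" using \<delta> step by auto
    fix k :: nat assume k: "k > 0" "(b - a) / real k < min \<delta> (d - c)"
    define h where "h = (b - a) / real k"
    have h: "h > 0" "h < \<delta>" "h < d - c" using k ab by (auto simp: h_def)
    obtain r where r: "time_change a b x e k c r" using \<delta>(2)[OF k(1)] k by auto
    define C where "C = grid_ceil a h c"
    define D where "D = grid_ceil a h d"
    have CD: "c \<le> C" "C < c + h" "d \<le> D" "D < d + h" "C < D"
      using grid_ceil_bounds(1)[OF h(1), of c a] grid_ceil_bounds(2)[OF h(1), of a c]
      grid_ceil_bounds(1)[OF h(1), of d a] grid_ceil_bounds(2)[OF h(1), of a d] h by (auto simp: C_def D_def)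
    define q where "q = (\<lambda>t. C + (D - C) / (d - c) * (t - c))"
    define p where "p = (\<lambda>t. if t \<le> c then r t else q t)"
    have cd: "c < d" by fact
    have sl: "(D - C) / (d - c) > 0" using CD cd by simp
    have qc: "q c = C" "q d = D" using cd by (auto simp: q_def)
    have rc: "r c = C" "r a = a" using r by (auto simp: time_change_def C_def h_def)
    have qmono: "q s < q t" if "s < t" for s t using that sl mult_strict_left_mono[OF _ sl, of "s-c" "t-c"]
      by (auto simp: q_def)
    have rmono: "r s < r t" if "s < t" "a \<le> s" "t \<le> c" for s t
      using r that unfolding time_change_def strict_mono_on_def by auto
    have "time_change a b x e k d p"
      unfolding time_change_def
    proof (intro conjI ballI)
      show "strict_mono_on {a..d} p"
      proof (rule strict_mono_onI)
        fix s t assume st: "s \<in> {a..d}" "t \<in> {a..d}" "s < t"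
        consider "t \<le> c" | "s \<le> c" "c < t" | "c < s" using st by linarith
        then show "p s < p t"
        proof cases
          case 1 then show ?thesis using rmono st by (auto simp: p_def)
        next
          case 2
          have "r s \<le> r c" using rmono[of s c] 2 st by (cases "s = c") auto
          also have "\<dots> = q c" using qc rc by simp
          also have "\<dots> < q t" using qmono 2 by auto
          finally show ?thesis using 2 by (auto simp: p_def)
        next
          case 3 then show ?thesis using qmono st by (auto simp: p_def)
        qed
      qed
      have "continuous_on ({a..c} \<union> {c..d}) (\<lambda>t. if t \<le> c then r t else q t)"
        using r ac cd qc rc unfolding time_change_def q_def
        by (intro continuous_on_cases continuous_intros) auto
      moreover have "{a..c} \<union> {c..d} = {a..d}" using ac cd by auto
      ultimately show "continuous_on {a..d} p" unfolding p_def by simp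
      show "p a = a" using ac rc by (simp add: p_def)
      show "p d = grid_ceil a ((b - a) / real k) d" using qc cd by (simp add: p_def D_def h_def)
      fix t assume t: "t \<in> {a..<d}"
      show "\<bar>x t - x (grid_floor a b k (p t))\<bar> \<le> e"
      proof (cases "t < c")
        case True then show ?thesis using t r by (auto simp: time_change_def p_def)
      next
        case False
        have pq: "p t = q t" using False qc rc by (auto simp: p_def)
        have "C \<le> q t" "q t < D" using qmono[of c t] qmono[of t d] qc t False by (cases "t = c"; force)+
        then have "grid_floor a b k (p t) \<in> {c..<d}"
          unfolding pq by (intro grid_floor_between[OF ab k(1)]) (auto simp: C_def D_def h_def)
        then show ?thesis using step.hyps(3)[of t] t False by auto
      qed
    next
      fix t assume t: "t \<in> {a..d}"
      show "\<bar>p t - t\<bar> \<le> (b - a) / real k"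
      proof (cases "t \<le> c")
        case True then show ?thesis using t r by (auto simp: time_change_def p_def)
      next
        case False
        define \<theta> where "\<theta> = (t - c) / (d - c)"
        have th: "0 \<le> \<theta>" "\<theta> \<le> 1" using t False cd by (auto simp: \<theta>_def)
        have tt: "t = c + \<theta> * (d - c)" using cd by (simp add: \<theta>_def)
        \<comment> \<open>On the linear piece the displacement is a convex combination of the
          displacements at the two breakpoints, and these lie between 0 and
          \<open>h\<close>.\<close>
        have "p t - t = (1 - \<theta>) * (C - c) + \<theta> * (D - d)"
        proof -
          have "p t = C + (D - C) * \<theta>" using False by (simp add: p_def q_def \<theta>_def)
          then show ?thesis by (subst (2) tt) (simp add: algebra_simps)
        qed
        moreover have "0 \<le> (1 - \<theta>) * (C - c)" "0 \<le> \<theta> * (D - d)" using th CD by auto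
        moreover have "(1 - \<theta>) * (C - c) \<le> (1 - \<theta>) * h" "\<theta> * (D - d) \<le> \<theta> * h"
          using th CD by (auto intro!: mult_left_mono)
        ultimately have "\<bar>p t - t\<bar> \<le> (1 - \<theta>) * h + \<theta> * h" by linarith
        moreover have "(1 - \<theta>) * h + \<theta> * h = h" by (simp add: algebra_simps)
        ultimately show ?thesis by (simp add: h_def)
      qed
    qed
    then show "\<exists>r. time_change a b x e k d r" by blast
  qed
qed

lemma step_approx_skorokhod:
  assumes x: "cadlag_on a b x" and ab: "a < b" and e: "e > 0"
  shows "eventually (\<lambda>k. skorokhod_dist a b x (step_approx a b k x) \<le> e) sequentially"
proof -
  obtain \<delta> where \<delta>: "\<delta> > 0" "\<And>k. k > 0 \<Longrightarrow> (b - a) / real k < \<delta> \<Longrightarrow> \<exists>r. time_change a b x e k b r"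
    using time_change_exists[OF ab cadlag_on_osc_chain[OF x ab e]] by blast
  have "(\<lambda>k. (b - a) / real k) \<longlonglongrightarrow> 0"
    by (rule tendsto_divide_0[OF tendsto_const filterlim_at_top_imp_at_infinity[OF filterlim_real_sequentially]])
  then have "eventually (\<lambda>k. (b - a) / real k < min \<delta> e) sequentially"
    using \<delta>(1) e by (intro order_tendstoD(2)) auto
  then show ?thesis using eventually_gt_at_top[of 0]
  proof eventually_elim
    case (elim k)
    then obtain r where r: "time_change a b x e k b r" using \<delta>(2) by force
    have rb: "r b = b" using r elim ab by (simp add: time_change_def grid_ceil_def)
    have ra: "r a = a" using r by (simp add: time_change_def)
    have mono: "strict_mono_on {a..b} r" and cont: "continuous_on {a..b} r"
      using r by (auto simp: time_change_def)
    have mono': "mono_on {a..b} r" using mono by (rule strict_mono_on_imp_mono_on)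
    have sub: "r t \<in> {a..b}" if "t \<in> {a..b}" for t
      using that mono_onD[OF mono', of a t] mono_onD[OF mono', of t b] ab by (auto simp: ra rb)
    have img: "r ` {a..b} = {a..b}"
    proof
      show "r ` {a..b} \<subseteq> {a..b}" using sub by auto
      show "{a..b} \<subseteq> r ` {a..b}"
      proof
        fix y assume "y \<in> {a..b}"
        then have "\<exists>t\<ge>a. t \<le> b \<and> r t = y"
          using IVT'[of r a y b] cont ab ra rb by auto
        then show "y \<in> r ` {a..b}" by auto
      qed
    qed
    show ?case
    proof (rule skorokhod_dist_le[OF ab _ mono cont img])
      fix t assume t: "t \<in> {a..b}"
      show "\<bar>r t - t\<bar> \<le> e" using r t elim by (force simp: time_change_def)
      \<comment> \<open>The time change says nothing about oscillation at the right endpoint, but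
        \<open>b\<close> is itself a grid point, so there the step approximation is exact.\<close>
      show "\<bar>x t - step_approx a b k x (r t)\<bar> \<le> e"
      proof (cases "t = b")
        case True
        have "grid_floor a b k b = b" using elim ab by (simp add: grid_floor_def)
        then show ?thesis using True rb elim ab e by (simp add: step_approx_eq)
      next
        case False
        then show ?thesis using r t elim ab sub[OF t] by (auto simp: step_approx_eq time_change_def)
      qed
    qed (use e in auto)
  qed
qed

text \<open>Step approximations converge in the Skorokhod distance even at jumps, where uniform
  convergence may fail. Thus \<open>f\<close> is a pointwise limit of functions of finitely many
  coordinates, which is the source of its measurability.\<close>

lemma skorokhod_bcont_tendsto_step_approx:
  assumes f: "skorokhod_bcont a b f" and x: "cadlag_on a b x" and ab: "a < b"
  shows "(\<lambda>k. f (step_approx a b k x)) \<longlonglongrightarrow> f x"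
proof (rule tendstoI)
  fix e :: real assume "e > 0"
  then obtain d where d: "d > 0" "\<And>y. cadlag_on a b y \<Longrightarrow> skorokhod_dist a b x y < d \<Longrightarrow> \<bar>f y - f x\<bar> < e"
    using f x unfolding skorokhod_bcont_def by blast
  have "eventually (\<lambda>k. skorokhod_dist a b x (step_approx a b k x) \<le> d/2) sequentially"
    using step_approx_skorokhod[OF x ab, of "d/2"] d(1) by linarith
  then show "eventually (\<lambda>k. dist (f (step_approx a b k x)) (f x) < e) sequentially"
    using eventually_gt_at_top[of 0]
  proof eventually_elim
    case (elim k)
    then show ?case using d(2)[of "step_approx a b k x"] d(1) cadlag_on_step_fn[OF ab]
      by (auto simp: dist_real_def step_approx_def)
  qed
qed

lemma tendsto_nat_fun_component:
  "((\<lambda>w::nat \<Rightarrow> real. w i) \<longlongrightarrow> v i) (at v)"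
proof -
  have "((\<lambda>w::nat \<Rightarrow> real. w i) \<longlongrightarrow> v i) (at v within UNIV)"
    using continuous_on_product_coordinates[of i] unfolding continuous_on_def by blast
  then show ?thesis by simp
qed

text \<open>A constraint on finitely many coordinates defines a neighbourhood in the product
  topology, so an epsilon-delta estimate in the coordinates up to \<open>k\<close> is
  enough.\<close>

lemma isCont_nat_funI:
  fixes F :: "(nat \<Rightarrow> real) \<Rightarrow> real"
  assumes "\<And>e. e > 0 \<Longrightarrow> \<exists>d>0. \<forall>w. (\<forall>i\<le>k. \<bar>w i - v i\<bar> < d) \<longrightarrow> \<bar>F w - F v\<bar> < e"
  shows "isCont F v"
  unfolding isCont_def
proof (rule tendstoI)
  fix e :: real assume "e > 0"
  then obtain d where d: "d > 0" "\<And>w. (\<forall>i\<le>k. \<bar>w i - v i\<bar> < d) \<Longrightarrow> \<bar>F w - F v\<bar> < e" using assms by blast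
  have "eventually (\<lambda>w. \<forall>i\<in>{..k}. dist (w i) (v i) < d) (at v)"
    using tendstoD[OF tendsto_nat_fun_component d(1)] by (intro eventually_ball_finite) auto
  then show "eventually (\<lambda>w. dist (F w) (F v) < e) (at v)"
    by eventually_elim (auto simp: dist_real_def intro!: d(2))
qed

lemma measurable_nat_fun:
  fixes F :: "(nat \<Rightarrow> real) \<Rightarrow> real"
  assumes "\<And>v. isCont F v" and "\<And>i. X i \<in> borel_measurable M"
  shows "(\<lambda>\<omega>. F (\<lambda>i. X i \<omega>)) \<in> borel_measurable M"
proof -
  have "F \<in> borel_measurable borel"
    using assms(1) by (intro borel_measurable_continuous_onI continuous_at_imp_continuous_on) auto
  moreover have "(\<lambda>\<omega> i. X i \<omega>) \<in> M \<rightarrow>\<^sub>M borel"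
    using assms(2) by (intro measurable_coordinatewise_then_product)
  ultimately show ?thesis by (rule measurable_compose[rotated])
qed

lemma isCont_step_fn:
  assumes f: "skorokhod_bcont a b f" and ab: "a < b" and k: "k > 0"
  shows "isCont (\<lambda>v. f (step_fn a b k v)) v"
proof (rule isCont_nat_funI[of k])
  fix e :: real assume "e > 0"
  then obtain d where d: "d > 0" "\<And>y. cadlag_on a b y \<Longrightarrow> skorokhod_dist a b (step_fn a b k v) y < d \<Longrightarrow> \<bar>f y - f (step_fn a b k v)\<bar> < e"
    using f cadlag_on_step_fn[OF ab k] unfolding skorokhod_bcont_def by blast
  show "\<exists>d>0. \<forall>w. (\<forall>i\<le>k. \<bar>w i - v i\<bar> < d) \<longrightarrow> \<bar>f (step_fn a b k w) - f (step_fn a b k v)\<bar> < e"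
  proof (intro exI[of _ "d/2"] conjI allI impI)
    fix w assume w: "\<forall>i\<le>k. \<bar>w i - v i\<bar> < d/2"
    have "skorokhod_dist a b (step_fn a b k v) (step_fn a b k w) \<le> d/2"
    proof (rule skorokhod_dist_le_sup[OF ab])
      fix t assume "t \<in> {a..b}"
      then have "\<bar>w (nat \<lfloor>(t - a) * real k / (b - a)\<rfloor>) - v (nat \<lfloor>(t - a) * real k / (b - a)\<rfloor>)\<bar> < d/2"
        using grid_floor_index[OF ab k] w by blast
      then show "\<bar>step_fn a b k v t - step_fn a b k w t\<bar> \<le> d/2"
        unfolding step_fn_def by linarith
    qed (use d in auto)
    then show "\<bar>f (step_fn a b k w) - f (step_fn a b k v)\<bar> < e"
      using d cadlag_on_step_fn[OF ab k] by auto
  qed (use d in auto)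
qed

text \<open>Functionals act on functions of the whole line, but the distance sees only
  \<open>{a..b}\<close>. Paths that agree there have distance at most 0, and continuity then forces
  equal values.\<close>

lemma skorokhod_bcont_cong:
  assumes f: "skorokhod_bcont a b f" and ab: "a < b" and x: "cadlag_on a b x" "cadlag_on a b y"
    and eq: "\<And>t. t \<in> {a..b} \<Longrightarrow> x t = y t"
  shows "f x = f y"
proof (rule ccontr)
  assume "f x \<noteq> f y"
  then obtain d where d: "d > 0" "\<And>z. cadlag_on a b z \<Longrightarrow> skorokhod_dist a b x z < d \<Longrightarrow> \<bar>f z - f x\<bar> < \<bar>f y - f x\<bar>"
    using f x unfolding skorokhod_bcont_def by (metis right_minus_eq zero_less_abs_iff)
  have "skorokhod_dist a b x y \<le> 0" using eq by (intro skorokhod_dist_le_sup[OF ab]) auto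
  then show False using d x by force
qed

lemma skorokhod_bcont_measurable:
  assumes f: "skorokhod_bcont a b f" and ab: "a < b"
    and X: "\<And>t. t \<in> {a..b} \<Longrightarrow> X t \<in> borel_measurable M"
    and cad: "\<And>\<omega>. \<omega> \<in> space M \<Longrightarrow> cadlag_on a b (\<lambda>t. X t \<omega>)"
  shows "(\<lambda>\<omega>. f (\<lambda>t. X t \<omega>)) \<in> borel_measurable M"
proof (rule borel_measurable_LIMSEQ_real)
  fix k
  \<comment> \<open>Clamping the index with \<open>min\<close> keeps all sampling times inside
    \<open>{a..b}\<close>, where \<open>X\<close> is measurable; larger indices do not affect the
    step path on \<open>{a..b}\<close>.\<close>
  have "(\<lambda>\<omega>. f (step_fn a b (Suc k) (\<lambda>i. X (grid_pt a b (Suc k) (min i (Suc k))) \<omega>))) \<in> borel_measurable M"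
    using grid_pt_mem[OF ab, of "Suc k"] by (intro measurable_nat_fun[OF isCont_step_fn[OF f ab]] X) auto
  moreover have "f (step_fn a b (Suc k) (\<lambda>i. X (grid_pt a b (Suc k) (min i (Suc k))) \<omega>)) = f (step_approx a b (Suc k) (\<lambda>t. X t \<omega>))" for \<omega>
    using grid_floor_index[OF ab, of "Suc k"] unfolding step_approx_def
    by (intro skorokhod_bcont_cong[OF f ab] cadlag_on_step_fn[OF ab]) (auto simp: step_fn_def min_absorb1 simp del: of_nat_Suc)
  ultimately show "(\<lambda>\<omega>. f (step_approx a b (Suc k) (\<lambda>t. X t \<omega>))) \<in> borel_measurable M" by simp
next
  fix \<omega> assume "\<omega> \<in> space M"
  then show "(\<lambda>k. f (step_approx a b (Suc k) (\<lambda>t. X t \<omega>))) \<longlonglongrightarrow> f (\<lambda>t. X t \<omega>)"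
    by (intro LIMSEQ_Suc skorokhod_bcont_tendsto_step_approx[OF f cad ab])
qed

section \<open>Weak convergence of random vectors\<close>

text \<open>The free phase \<open>c\<close> keeps everything real: product-to-sum formulas make the
  class an algebra, it contains sines and constants, and convergence of expectations only has to be
  known for the generators.\<close>

inductive trig_poly :: "nat \<Rightarrow> ((nat \<Rightarrow> real) \<Rightarrow> real) \<Rightarrow> bool" for m where
  cos: "trig_poly m (\<lambda>x. cos ((\<Sum>i<m. u i * x i) + c))"
| add: "trig_poly m f \<Longrightarrow> trig_poly m g \<Longrightarrow> trig_poly m (\<lambda>x. f x + g x)"
| scale: "trig_poly m f \<Longrightarrow> trig_poly m (\<lambda>x. a * f x)"

lemma trig_poly_mult_cos:
  "trig_poly m g \<Longrightarrow> trig_poly m (\<lambda>x. cos ((\<Sum>i<m. u i * x i) + c) * g x)"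
proof (induction rule: trig_poly.induct)
  case (cos w d)
  have "trig_poly m (\<lambda>x. (1/2) * (cos ((\<Sum>i<m. (u i - w i) * x i) + (c - d)) + cos ((\<Sum>i<m. (u i + w i) * x i) + (c + d))))"
    by (intro trig_poly.intros)
  moreover have "(1/2) * (cos ((\<Sum>i<m. (u i - w i) * x i) + (c - d)) + cos ((\<Sum>i<m. (u i + w i) * x i) + (c + d)))
     = cos ((\<Sum>i<m. u i * x i) + c) * cos ((\<Sum>i<m. w i * x i) + d)" for x
    by (simp add: cos_times_cos algebra_simps sum.distrib sum_subtractf)
  ultimately show ?case by simp
next
  case (add f g)
  then show ?case using trig_poly.add[OF add.IH] by (simp add: distrib_left)
next
  case (scale f a)
  then show ?case using trig_poly.scale[OF scale.IH, of a] by (simp add: mult.left_commute)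
qed

lemma trig_poly_mult: "trig_poly m f \<Longrightarrow> trig_poly m g \<Longrightarrow> trig_poly m (\<lambda>x. f x * g x)"
proof (induction rule: trig_poly.induct)
  case (cos u c)
  then show ?case by (rule trig_poly_mult_cos)
next
  case (add f g)
  then show ?case using trig_poly.add[OF add.IH] by (simp add: distrib_right)
next
  case (scale f a)
  then show ?case using trig_poly.scale[OF scale.IH, of a] by (simp add: mult.assoc)
qed

lemma trig_poly_const: "trig_poly m (\<lambda>x. c)"
  using trig_poly.scale[OF trig_poly.cos[of m "\<lambda>_. 0" 0], of c] by simp

lemma trig_poly_sin:
  assumes "i < m" shows "trig_poly m (\<lambda>x. sin (\<theta> * x i))"
proof -
  have "cos ((\<Sum>j<m. (if j = i then \<theta> else 0) * x j) + (- pi/2)) = sin (\<theta> * x i)" for x :: "nat \<Rightarrow> real"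
  proof -
    have "(\<Sum>j<m. (if j = i then \<theta> else 0) * x j) = (\<Sum>j<m. if j = i then \<theta> * x j else 0)"
      by (intro sum.cong) auto
    also have "\<dots> = \<theta> * x i" using assms by simp
    finally show ?thesis by (simp add: cos_diff)
  qed
  then show ?thesis using trig_poly.cos[of m "\<lambda>j. if j = i then \<theta> else 0" "-pi/2"] by simp
qed

lemma (in prob_space) trig_poly_integrable:
  assumes "trig_poly m f" "\<And>i. i < m \<Longrightarrow> X i \<in> borel_measurable M"
  shows "integrable M (\<lambda>\<omega>. f (\<lambda>i. X i \<omega>))"
  using assms
proof (induction rule: trig_poly.induct)
  case (cos u c)
  then show ?case by (intro integrable_const_bound[where B=1]) (auto intro!: borel_measurable_sum)
qed auto

lemma trig_poly_tendsto:
  assumes "prob_space M" "prob_space P" and f: "trig_poly m f"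
    and X: "\<And>N i. i < m \<Longrightarrow> X N i \<in> borel_measurable M" and Y: "\<And>i. i < m \<Longrightarrow> Y i \<in> borel_measurable P"
    and conv: "\<And>u c. (\<lambda>N. integral\<^sup>L M (\<lambda>\<omega>. cos ((\<Sum>i<m. u i * X N i \<omega>) + c)))
        \<longlonglongrightarrow> integral\<^sup>L P (\<lambda>\<omega>. cos ((\<Sum>i<m. u i * Y i \<omega>) + c))"
  shows "(\<lambda>N. integral\<^sup>L M (\<lambda>\<omega>. f (\<lambda>i. X N i \<omega>))) \<longlonglongrightarrow> integral\<^sup>L P (\<lambda>\<omega>. f (\<lambda>i. Y i \<omega>))"
proof -
  interpret M: prob_space M by fact
  interpret P: prob_space P by fact
  show ?thesis using f
  proof (induction rule: trig_poly.induct)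
    case (cos u c)
    then show ?case by (rule conv)
  next
    case (add f g)
    then show ?case
      using M.trig_poly_integrable[OF add.hyps(1) X] M.trig_poly_integrable[OF add.hyps(2) X]
        P.trig_poly_integrable[OF add.hyps(1) Y] P.trig_poly_integrable[OF add.hyps(2) Y]
      by (simp add: tendsto_add)
  next
    case (scale f a)
    then show ?case by (simp add: tendsto_mult)
  qed
qed

text \<open>Coordinates from \<open>m\<close> on are pinned to 0, so that the box is compact by
  Tychonoff and its points are separated by the first \<open>m\<close> coordinates, those for which
  trigonometric polynomials are available.\<close>

lemma compact_nat_box: "compact {y::nat \<Rightarrow> real. \<forall>i. y i \<in> (if i < m then {-1..1} else {0})}"
proof -
  have "compactin (product_topology (\<lambda>i. euclidean) UNIV) (Pi\<^sub>E UNIV (\<lambda>i. if i < m then {-1..1::real} else {0}))"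
    unfolding compactin_PiE by auto
  then have "compact (Pi\<^sub>E UNIV (\<lambda>i::nat. if i < m then {-1..1::real} else {0}))"
    by (simp add: euclidean_product_topology)
  moreover have "Pi\<^sub>E UNIV (\<lambda>i. if i < m then {-1..1} else {0}) = {y::nat \<Rightarrow> real. \<forall>i. y i \<in> (if i < m then {-1..1} else {0})}"
    by (auto simp: PiE_UNIV_domain Pi_def)
  ultimately show ?thesis by simp
qed

text \<open>The triangle wave \<open>arcsin (sin (\<theta> x)) / \<theta>\<close> is the identity on \<open>[-L, L]\<close> for \<open>\<theta> = \<pi> / (2 L)\<close>; composing with it makes
  a function continuous in the variables \<open>sin (\<theta> x\<^sub>i)\<close>, so that polynomials in these approximate it uniformly.\<close>

lemma trig_poly_approx:
  fixes F :: "(nat \<Rightarrow> real) \<Rightarrow> real"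
  assumes F: "\<And>v. isCont F v" and dep: "\<And>v w. (\<And>i. i < m \<Longrightarrow> v i = w i) \<Longrightarrow> F v = F w"
    and \<theta>: "\<theta> > 0" and e: "e > 0"
  obtains g where "trig_poly m g" "\<And>x. \<bar>F (\<lambda>i. arcsin (sin (\<theta> * x i)) / \<theta>) - g x\<bar> < e"
proof -
  let ?S = "{y::nat \<Rightarrow> real. \<forall>i. y i \<in> (if i < m then {-1..1} else {0})}"
  \<comment> \<open>\<open>R\<close> collects the continuous functions that become trigonometric
    polynomials once \<open>sin (\<theta> * x i)\<close> is substituted for the \<open>i\<close>-th
    variable; it is the algebra for Stone-Weierstrass.\<close>
  define R where "R = (\<lambda>f. continuous_on UNIV f \<and> trig_poly m (\<lambda>x. f (\<lambda>i. if i < m then sin (\<theta> * x i) else (0::real))))"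
  have "\<exists>g. R g \<and> (\<forall>x\<in>?S. \<bar>F (\<lambda>i. arcsin (x i) / \<theta>) - g x\<bar> < e)"
  proof (rule Stone_Weierstrass_HOL[OF compact_nat_box _ _ _ _ _ _ e])
    show "R (\<lambda>x. c)" for c by (simp add: R_def trig_poly_const)
    show "R f \<Longrightarrow> continuous_on ?S f" for f unfolding R_def using continuous_on_subset by blast
    show "R f \<and> R g \<Longrightarrow> R (\<lambda>x. f x + g x)" for f g unfolding R_def by (auto intro: continuous_intros trig_poly.add)
    show "R f \<and> R g \<Longrightarrow> R (\<lambda>x. f x * g x)" for f g unfolding R_def by (auto intro: continuous_intros trig_poly_mult)
    show "\<exists>f. R f \<and> f x \<noteq> f y" if xy: "x \<in> ?S \<and> y \<in> ?S \<and> x \<noteq> y" for x y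
    proof -
      obtain i where i: "x i \<noteq> y i" using xy by blast
      have "i < m"
      proof (rule ccontr)
        assume "\<not> i < m"
        then have "x i \<in> {0}" "y i \<in> {0}" using xy by (metis (mono_tags, lifting) mem_Collect_eq)+
        then show False using i by simp
      qed
      then have "R (\<lambda>x. x i)" using trig_poly_sin[of i m \<theta>] by (simp add: R_def)
      then show ?thesis using i by blast
    qed
    show "continuous_on ?S (\<lambda>x. F (\<lambda>i. arcsin (x i) / \<theta>))"
    proof (rule continuous_on_compose2[where t=UNIV and g=F])
      show "continuous_on UNIV F" using F by (simp add: continuous_at_imp_continuous_on)
      show "continuous_on ?S (\<lambda>x i. arcsin (x i) / \<theta>)"
      proof (intro continuous_on_coordinatewise_then_product continuous_on_divide continuous_on_arcsin ballI)
        fix i :: nat and x :: "nat \<Rightarrow> real" assume "x \<in> ?S"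
        then have "x i \<in> (if i < m then {-1..1} else {0})" by blast
        then show "- 1 \<le> x i \<and> x i \<le> 1" by (auto split: if_splits)
      qed (use \<theta> in \<open>auto intro: continuous_on_subset[OF continuous_on_product_coordinates]\<close>)
    qed auto
  qed
  then obtain g where g: "R g" "\<And>x. x \<in> ?S \<Longrightarrow> \<bar>F (\<lambda>i. arcsin (x i) / \<theta>) - g x\<bar> < e" by blast
  show ?thesis
  proof (rule that)
    show "trig_poly m (\<lambda>x. g (\<lambda>i. if i < m then sin (\<theta> * x i) else 0))" using g by (simp add: R_def)
    fix x
    have "\<bar>F (\<lambda>i. arcsin (if i < m then sin (\<theta> * x i) else 0) / \<theta>) - g (\<lambda>i. if i < m then sin (\<theta> * x i) else 0)\<bar> < e"
      by (rule g(2)) auto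
    moreover have "F (\<lambda>i. arcsin (if i < m then sin (\<theta> * x i) else 0) / \<theta>) = F (\<lambda>i. arcsin (sin (\<theta> * x i)) / \<theta>)"
      by (rule dep) simp
    ultimately show "\<bar>F (\<lambda>i. arcsin (sin (\<theta> * x i)) / \<theta>) - g (\<lambda>i. if i < m then sin (\<theta> * x i) else 0)\<bar> < e" by simp
  qed
qed

lemma measurable_nat_fun_dep:
  fixes F :: "(nat \<Rightarrow> real) \<Rightarrow> real"
  assumes F: "\<And>v. isCont F v" and dep: "\<And>v w. (\<And>i. i < m \<Longrightarrow> v i = w i) \<Longrightarrow> F v = F w"
    and X: "\<And>i. i < m \<Longrightarrow> X i \<in> borel_measurable M"
  shows "(\<lambda>\<omega>. F (\<lambda>i. X i \<omega>)) \<in> borel_measurable M"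
proof -
  have "(\<lambda>\<omega>. if i < m then X i \<omega> else 0) \<in> borel_measurable M" for i
    using X by (cases "i < m") auto
  then have "(\<lambda>\<omega>. F (\<lambda>i. if i < m then X i \<omega> else 0)) \<in> borel_measurable M"
    by (rule measurable_nat_fun[OF F])
  moreover have "F (\<lambda>i. X i \<omega>) = F (\<lambda>i. if i < m then X i \<omega> else 0)" for \<omega> by (rule dep) simp
  ultimately show ?thesis by simp
qed

text \<open>The triangle wave changes nothing unless some coordinate exceeds \<open>L\<close> in
  modulus, and then the error is at most \<open>2 * B\<close>. As in Chebyshev's inequality, bounded
  second moments turn this into a uniform error, which does the work of tightness for the
  vectors.\<close>

lemma (in prob_space) truncation_error:
  fixes F :: "(nat \<Rightarrow> real) \<Rightarrow> real"
  assumes F: "\<And>v. isCont F v" and dep: "\<And>v w. (\<And>i. i < m \<Longrightarrow> v i = w i) \<Longrightarrow> F v = F w"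
    and B: "\<And>v. \<bar>F v\<bar> \<le> B" and L: "L > 0"
    and X: "\<And>i. i < m \<Longrightarrow> X i \<in> borel_measurable M"
    and X2: "\<And>i. i < m \<Longrightarrow> integrable M (\<lambda>\<omega>. (X i \<omega>)\<^sup>2)" "\<And>i. i < m \<Longrightarrow> integral\<^sup>L M (\<lambda>\<omega>. (X i \<omega>)\<^sup>2) \<le> C"
  defines "\<theta> \<equiv> pi / (2 * L)"
  shows "integrable M (\<lambda>\<omega>. F (\<lambda>i. X i \<omega>))" "integrable M (\<lambda>\<omega>. F (\<lambda>i. arcsin (sin (\<theta> * X i \<omega>)) / \<theta>))"
    "\<bar>integral\<^sup>L M (\<lambda>\<omega>. F (\<lambda>i. X i \<omega>)) - integral\<^sup>L M (\<lambda>\<omega>. F (\<lambda>i. arcsin (sin (\<theta> * X i \<omega>)) / \<theta>))\<bar> \<le> 2 * B * m * C / L\<^sup>2"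
proof -
  have \<theta>: "\<theta> > 0" using L by (simp add: \<theta>_def)
  have arc: "(\<lambda>\<omega>. arcsin (sin (\<theta> * X i \<omega>)) / \<theta>) \<in> borel_measurable M" if "i < m" for i
  proof -
    have "continuous_on UNIV (\<lambda>x::real. arcsin (sin (\<theta> * x)) / \<theta>)"
      using \<theta> by (intro continuous_intros) auto
    then have "(\<lambda>x::real. arcsin (sin (\<theta> * x)) / \<theta>) \<in> borel_measurable borel"
      by (rule borel_measurable_continuous_onI)
    then show ?thesis using X[OF that] by measurable
  qed
  have B0: "0 \<le> B" using B[of "\<lambda>_. 0"] by linarith
  show i1: "integrable M (\<lambda>\<omega>. F (\<lambda>i. X i \<omega>))"
    using B by (intro integrable_const_bound[where B=B] measurable_nat_fun_dep[OF F dep] X) auto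
  show i2: "integrable M (\<lambda>\<omega>. F (\<lambda>i. arcsin (sin (\<theta> * X i \<omega>)) / \<theta>))"
    using B by (intro integrable_const_bound[where B=B] measurable_nat_fun_dep[OF F dep] arc) auto
  have pt: "\<bar>F (\<lambda>i. X i \<omega>) - F (\<lambda>i. arcsin (sin (\<theta> * X i \<omega>)) / \<theta>)\<bar> \<le> (\<Sum>i<m. 2 * B / L\<^sup>2 * (X i \<omega>)\<^sup>2)" for \<omega>
  proof (cases "\<forall>i<m. \<bar>X i \<omega>\<bar> \<le> L")
    case True
    have "F (\<lambda>i. X i \<omega>) = F (\<lambda>i. arcsin (sin (\<theta> * X i \<omega>)) / \<theta>)"
    proof (rule dep)
      fix i assume "i < m"
      then have "\<bar>X i \<omega>\<bar> \<le> L" using True by blast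
      then have "- L \<le> X i \<omega>" "X i \<omega> \<le> L" by linarith+
      then have "\<theta> * (-L) \<le> \<theta> * X i \<omega>" "\<theta> * X i \<omega> \<le> \<theta> * L" using \<theta> by (intro mult_left_mono; simp)+
      then have "arcsin (sin (\<theta> * X i \<omega>)) = \<theta> * X i \<omega>"
        using L by (intro arcsin_sin) (auto simp: \<theta>_def)
      then show "X i \<omega> = arcsin (sin (\<theta> * X i \<omega>)) / \<theta>" using \<theta> by simp
    qed
    moreover have "0 \<le> (\<Sum>i<m. 2 * B / L\<^sup>2 * (X i \<omega>)\<^sup>2)" using B0 by (intro sum_nonneg) auto
    ultimately show ?thesis by simp
  next
    case False
    then obtain i where i: "i < m" "\<bar>X i \<omega>\<bar> > L" by force
    have "L\<^sup>2 \<le> (X i \<omega>)\<^sup>2" using i L by (metis abs_of_pos less_imp_le power2_abs power_mono)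
    then have "1 \<le> (X i \<omega>)\<^sup>2 / L\<^sup>2" using L by simp
    then have "2 * B * 1 \<le> 2 * B * ((X i \<omega>)\<^sup>2 / L\<^sup>2)" using B0 by (intro mult_left_mono) auto
    also have "\<dots> = 2 * B / L\<^sup>2 * (X i \<omega>)\<^sup>2" by simp
    also have "\<dots> \<le> (\<Sum>i<m. 2 * B / L\<^sup>2 * (X i \<omega>)\<^sup>2)"
      using i B0 by (intro member_le_sum) auto
    finally show ?thesis using B[of "\<lambda>i. X i \<omega>"] B[of "\<lambda>i. arcsin (sin (\<theta> * X i \<omega>)) / \<theta>"] by linarith
  qed
  have "\<bar>integral\<^sup>L M (\<lambda>\<omega>. F (\<lambda>i. X i \<omega>)) - integral\<^sup>L M (\<lambda>\<omega>. F (\<lambda>i. arcsin (sin (\<theta> * X i \<omega>)) / \<theta>))\<bar>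
     = \<bar>integral\<^sup>L M (\<lambda>\<omega>. F (\<lambda>i. X i \<omega>) - F (\<lambda>i. arcsin (sin (\<theta> * X i \<omega>)) / \<theta>))\<bar>"
    using i1 i2 by simp
  also have "\<dots> \<le> integral\<^sup>L M (\<lambda>\<omega>. \<bar>F (\<lambda>i. X i \<omega>) - F (\<lambda>i. arcsin (sin (\<theta> * X i \<omega>)) / \<theta>)\<bar>)"
    by (rule integral_abs_bound)
  also have "\<dots> \<le> integral\<^sup>L M (\<lambda>\<omega>. \<Sum>i<m. 2 * B / L\<^sup>2 * (X i \<omega>)\<^sup>2)"
    using i1 i2 X2 pt by (intro integral_mono) auto
  also have "\<dots> = (\<Sum>i<m. 2 * B / L\<^sup>2 * integral\<^sup>L M (\<lambda>\<omega>. (X i \<omega>)\<^sup>2))"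
    using X2 by (subst Bochner_Integration.integral_sum) auto
  also have "\<dots> \<le> (\<Sum>i<m. 2 * B / L\<^sup>2 * C)"
    using X2 B0 by (intro sum_mono mult_left_mono) auto
  finally show "\<bar>integral\<^sup>L M (\<lambda>\<omega>. F (\<lambda>i. X i \<omega>)) - integral\<^sup>L M (\<lambda>\<omega>. F (\<lambda>i. arcsin (sin (\<theta> * X i \<omega>)) / \<theta>))\<bar> \<le> 2 * B * m * C / L\<^sup>2"
    by (simp add: mult_ac)
qed

theorem trig_imp_weak_convergence:
  fixes F :: "(nat \<Rightarrow> real) \<Rightarrow> real"
  assumes M: "prob_space M" and P: "prob_space P"
    and X: "\<And>N i. i < m \<Longrightarrow> X N i \<in> borel_measurable M" and Y: "\<And>i. i < m \<Longrightarrow> Y i \<in> borel_measurable P"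
    and conv: "\<And>u c. (\<lambda>N. integral\<^sup>L M (\<lambda>\<omega>. cos ((\<Sum>i<m. u i * X N i \<omega>) + c)))
        \<longlonglongrightarrow> integral\<^sup>L P (\<lambda>\<omega>. cos ((\<Sum>i<m. u i * Y i \<omega>) + c))"
    and X2: "\<And>N i. i < m \<Longrightarrow> integrable M (\<lambda>\<omega>. (X N i \<omega>)\<^sup>2)" "\<And>N i. i < m \<Longrightarrow> integral\<^sup>L M (\<lambda>\<omega>. (X N i \<omega>)\<^sup>2) \<le> C"
    and Y2: "\<And>i. i < m \<Longrightarrow> integrable P (\<lambda>\<omega>. (Y i \<omega>)\<^sup>2)" "\<And>i. i < m \<Longrightarrow> integral\<^sup>L P (\<lambda>\<omega>. (Y i \<omega>)\<^sup>2) \<le> C"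
    and F: "\<And>v. isCont F v" and dep: "\<And>v w. (\<And>i. i < m \<Longrightarrow> v i = w i) \<Longrightarrow> F v = F w"
    and B: "\<And>v. \<bar>F v\<bar> \<le> B"
  shows "(\<lambda>N. integral\<^sup>L M (\<lambda>\<omega>. F (\<lambda>i. X N i \<omega>))) \<longlonglongrightarrow> integral\<^sup>L P (\<lambda>\<omega>. F (\<lambda>i. Y i \<omega>))"
proof (rule tendstoI)
  interpret M: prob_space M by fact
  interpret P: prob_space P by fact
  fix e :: real assume e: "e > 0"
  \<comment> \<open>Five errors of size \<open>e/5\<close> will be added: truncation on both sides,
    trigonometric approximation on both sides, and convergence for the polynomial
    \<open>g\<close>.\<close>
  have "((\<lambda>L. 2 * B * m * C / L\<^sup>2) \<longlongrightarrow> 0) at_top"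
    by (intro tendsto_divide_0[OF tendsto_const] filterlim_at_top_imp_at_infinity filterlim_pow_at_top filterlim_ident) auto
  then have "eventually (\<lambda>L. 2 * B * m * C / L\<^sup>2 < e/5) at_top" using e by (intro order_tendstoD(2)) auto
  then obtain L where L: "L > 0" "2 * B * m * C / L\<^sup>2 < e/5"
    using eventually_happens[OF eventually_conj[OF _ eventually_gt_at_top[of 0]]] by (metis trivial_limit_at_top_linorder)
  define \<theta> where "\<theta> = pi / (2 * L)"
  have \<theta>: "\<theta> > 0" using L by (simp add: \<theta>_def)
  obtain g where g: "trig_poly m g" "\<And>x. \<bar>F (\<lambda>i. arcsin (sin (\<theta> * x i)) / \<theta>) - g x\<bar> < e/5"
    using trig_poly_approx[OF F dep \<theta>, of m "e/5"] e by auto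
  note tM = M.truncation_error[where F=F and m=m and B=B and L=L and C=C, OF F dep B L(1), folded \<theta>_def]
  note tP = P.truncation_error[where F=F and m=m and B=B and L=L and C=C, OF F dep B L(1), folded \<theta>_def]
  have close: "\<bar>integral\<^sup>L K (\<lambda>\<omega>. F (\<lambda>i. arcsin (sin (\<theta> * Z i \<omega>)) / \<theta>)) - integral\<^sup>L K (\<lambda>\<omega>. g (\<lambda>i. Z i \<omega>))\<bar> \<le> e/5"
    if K: "prob_space K" and i: "integrable K (\<lambda>\<omega>. F (\<lambda>i. arcsin (sin (\<theta> * Z i \<omega>)) / \<theta>))" "integrable K (\<lambda>\<omega>. g (\<lambda>i. Z i \<omega>))" for K :: "'c measure" and Z
  proof -
    interpret K: prob_space K by fact
    have "\<bar>integral\<^sup>L K (\<lambda>\<omega>. F (\<lambda>i. arcsin (sin (\<theta> * Z i \<omega>)) / \<theta>)) - integral\<^sup>L K (\<lambda>\<omega>. g (\<lambda>i. Z i \<omega>))\<bar>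
      = \<bar>integral\<^sup>L K (\<lambda>\<omega>. F (\<lambda>i. arcsin (sin (\<theta> * Z i \<omega>)) / \<theta>) - g (\<lambda>i. Z i \<omega>))\<bar>" using i by simp
    also have "\<dots> \<le> integral\<^sup>L K (\<lambda>\<omega>. \<bar>F (\<lambda>i. arcsin (sin (\<theta> * Z i \<omega>)) / \<theta>) - g (\<lambda>i. Z i \<omega>)\<bar>)"
      by (rule integral_abs_bound)
    also have "\<dots> \<le> integral\<^sup>L K (\<lambda>\<omega>. e/5)"
      using i less_imp_le[OF g(2)] by (intro integral_mono) auto
    finally show ?thesis by (simp add: K.prob_space)
  qed
  have "(\<lambda>N. integral\<^sup>L M (\<lambda>\<omega>. g (\<lambda>i. X N i \<omega>))) \<longlonglongrightarrow> integral\<^sup>L P (\<lambda>\<omega>. g (\<lambda>i. Y i \<omega>))"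
    by (rule trig_poly_tendsto[OF M P g(1) X Y conv])
  then have "eventually (\<lambda>N. dist (integral\<^sup>L M (\<lambda>\<omega>. g (\<lambda>i. X N i \<omega>))) (integral\<^sup>L P (\<lambda>\<omega>. g (\<lambda>i. Y i \<omega>))) < e/5) sequentially"
    using e by (intro tendstoD) auto
  then show "eventually (\<lambda>N. dist (integral\<^sup>L M (\<lambda>\<omega>. F (\<lambda>i. X N i \<omega>))) (integral\<^sup>L P (\<lambda>\<omega>. F (\<lambda>i. Y i \<omega>))) < e) sequentially"
  proof eventually_elim
    case (elim N)
    have 1: "\<bar>integral\<^sup>L M (\<lambda>\<omega>. F (\<lambda>i. X N i \<omega>)) - integral\<^sup>L M (\<lambda>\<omega>. F (\<lambda>i. arcsin (sin (\<theta> * X N i \<omega>)) / \<theta>))\<bar> \<le> 2 * B * m * C / L\<^sup>2"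
      by (rule tM(3)[of "X N"]) (use X X2 in auto)
    have 2: "\<bar>integral\<^sup>L P (\<lambda>\<omega>. F (\<lambda>i. Y i \<omega>)) - integral\<^sup>L P (\<lambda>\<omega>. F (\<lambda>i. arcsin (sin (\<theta> * Y i \<omega>)) / \<theta>))\<bar> \<le> 2 * B * m * C / L\<^sup>2"
      by (rule tP(3)[of Y]) (use Y Y2 in auto)
    have 3: "\<bar>integral\<^sup>L M (\<lambda>\<omega>. F (\<lambda>i. arcsin (sin (\<theta> * X N i \<omega>)) / \<theta>)) - integral\<^sup>L M (\<lambda>\<omega>. g (\<lambda>i. X N i \<omega>))\<bar> \<le> e/5"
      by (intro close M tM(2)[of "X N"] M.trig_poly_integrable[OF g(1)]) (use X X2 in auto)
    have 4: "\<bar>integral\<^sup>L P (\<lambda>\<omega>. F (\<lambda>i. arcsin (sin (\<theta> * Y i \<omega>)) / \<theta>)) - integral\<^sup>L P (\<lambda>\<omega>. g (\<lambda>i. Y i \<omega>))\<bar> \<le> e/5"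
      by (intro close P tP(2)[of Y] P.trig_poly_integrable[OF g(1)]) (use Y Y2 in auto)
    show ?case using 1 2 3 4 L(2) elim unfolding dist_real_def by linarith
  qed
qed

section \<open>Weak convergence of processes with a continuous limit\<close>

definition sup_dist :: "real \<Rightarrow> real \<Rightarrow> (real \<Rightarrow> real) \<Rightarrow> (real \<Rightarrow> real) \<Rightarrow> real" where
  "sup_dist a b x y = (SUP t\<in>{a..b}. \<bar>x t - y t\<bar>)"

text \<open>The Pasch-Hausdorff envelope: for bounded \<open>f\<close>, the largest function below
  \<open>f\<close> on the cadlag paths that is \<open>n\<close>-Lipschitz for the uniform
  distance.\<close>

definition inf_conv :: "real \<Rightarrow> real \<Rightarrow> ((real \<Rightarrow> real) \<Rightarrow> real) \<Rightarrow> nat \<Rightarrow> (real \<Rightarrow> real) \<Rightarrow> real" where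
  "inf_conv a b f n x = (INF y\<in>Collect (cadlag_on a b). f y + real n * sup_dist a b x y)"

lemma sup_dist_bdd_above:
  assumes "a < b" "cadlag_on a b x" "cadlag_on a b y"
  shows "bdd_above ((\<lambda>t. \<bar>x t - y t\<bar>) ` {a..b})"
proof -
  obtain C where C: "\<And>t. t \<in> {a..b} \<Longrightarrow> \<bar>x t\<bar> \<le> C" using cadlag_on_bounded assms by blast
  obtain D where D: "\<And>t. t \<in> {a..b} \<Longrightarrow> \<bar>y t\<bar> \<le> D" using cadlag_on_bounded assms by blast
  show ?thesis
  proof (rule bdd_aboveI2)
    fix t assume "t \<in> {a..b}"
    then show "\<bar>x t - y t\<bar> \<le> C + D" using C[of t] D[of t] by linarith
  qed
qed

lemma sup_dist_upper:
  assumes "a < b" "cadlag_on a b x" "cadlag_on a b y" "t \<in> {a..b}"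
  shows "\<bar>x t - y t\<bar> \<le> sup_dist a b x y"
  unfolding sup_dist_def using assms sup_dist_bdd_above by (intro cSUP_upper)

lemma sup_dist_least:
  assumes "a < b" "\<And>t. t \<in> {a..b} \<Longrightarrow> \<bar>x t - y t\<bar> \<le> c"
  shows "sup_dist a b x y \<le> c"
  unfolding sup_dist_def using assms by (intro cSUP_least) auto

lemma sup_dist_nonneg:
  assumes "a < b" "cadlag_on a b x" "cadlag_on a b y"
  shows "0 \<le> sup_dist a b x y"
  using sup_dist_upper[OF assms, of a] assms(1) by auto

lemma sup_dist_triangle:
  assumes "a < b" "cadlag_on a b x" "cadlag_on a b y" "cadlag_on a b z"
  shows "sup_dist a b x z \<le> sup_dist a b x y + sup_dist a b y z"
proof (rule sup_dist_least[OF assms(1)])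
  fix t assume "t \<in> {a..b}"
  then show "\<bar>x t - z t\<bar> \<le> sup_dist a b x y + sup_dist a b y z"
    using sup_dist_upper[OF assms(1,2,3), of t] sup_dist_upper[OF assms(1,3,4), of t] by linarith
qed

lemma sup_dist_commute: "sup_dist a b x y = sup_dist a b y x"
  by (simp add: sup_dist_def abs_minus_commute)

context
  fixes a b :: real and f :: "(real \<Rightarrow> real) \<Rightarrow> real" and B :: real
  assumes ab: "a < b" and B': "\<forall>x. cadlag_on a b x \<longrightarrow> \<bar>f x\<bar> \<le> B"
begin

lemma abs_le_bound: "cadlag_on a b x \<Longrightarrow> \<bar>f x\<bar> \<le> B"
  using B' by blast

lemma inf_conv_bdd_below:
  assumes "cadlag_on a b x"
  shows "bdd_below ((\<lambda>y. f y + real n * sup_dist a b x y) ` Collect (cadlag_on a b))"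
proof (rule bdd_belowI2)
  fix y assume "y \<in> Collect (cadlag_on a b)"
  then show "- B \<le> f y + real n * sup_dist a b x y"
    using abs_le_bound[of y] sup_dist_nonneg[OF ab assms, of y] by (smt (verit) mem_Collect_eq mult_nonneg_nonneg of_nat_0_le_iff)
qed

lemma inf_conv_le_self:
  assumes x: "cadlag_on a b x"
  shows "inf_conv a b f n x \<le> f x"
proof -
  have "sup_dist a b x x = 0" using ab by (simp add: sup_dist_def)
  then show ?thesis
    unfolding inf_conv_def using cINF_lower[OF inf_conv_bdd_below[OF x, of n], of x] x by simp
qed

lemma inf_conv_lower:
  assumes x: "cadlag_on a b x"
  shows "- B \<le> inf_conv a b f n x"
  unfolding inf_conv_def
proof (rule cINF_greatest)
  fix y assume "y \<in> Collect (cadlag_on a b)"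
  then show "- B \<le> f y + real n * sup_dist a b x y"
    using abs_le_bound[of y] sup_dist_nonneg[OF ab x, of y] by (smt (verit) mem_Collect_eq mult_nonneg_nonneg of_nat_0_le_iff)
qed (use x in auto)

lemma inf_conv_abs_le:
  assumes x: "cadlag_on a b x"
  shows "\<bar>inf_conv a b f n x\<bar> \<le> B"
  using inf_conv_lower[OF x, of n] inf_conv_le_self[OF x, of n] abs_le_bound[OF x] by linarith

lemma inf_conv_lipschitz:
  assumes x: "cadlag_on a b x" and z: "cadlag_on a b z"
  shows "inf_conv a b f n x \<le> inf_conv a b f n z + real n * sup_dist a b x z"
proof -
  have "inf_conv a b f n x - real n * sup_dist a b x z \<le> inf_conv a b f n z"
    unfolding inf_conv_def[of _ _ _ _ z]
  proof (rule cINF_greatest)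
    fix y assume y: "y \<in> Collect (cadlag_on a b)"
    then have "inf_conv a b f n x \<le> f y + real n * sup_dist a b x y"
      unfolding inf_conv_def by (intro cINF_lower inf_conv_bdd_below[OF x])
    also have "\<dots> \<le> f y + real n * (sup_dist a b x z + sup_dist a b z y)"
      using sup_dist_triangle[OF ab x z, of y] y by (intro add_left_mono mult_left_mono) auto
    finally show "inf_conv a b f n x - real n * sup_dist a b x z \<le> f y + real n * sup_dist a b z y"
      by (simp add: algebra_simps)
  qed (use x in auto)
  then show ?thesis by simp
qed

lemma inf_conv_lipschitz_abs:
  assumes x: "cadlag_on a b x" and z: "cadlag_on a b z"
  shows "\<bar>inf_conv a b f n x - inf_conv a b f n z\<bar> \<le> real n * sup_dist a b x z"
  using inf_conv_lipschitz[OF x z, of n] inf_conv_lipschitz[OF z x, of n, unfolded sup_dist_commute[of a b z x]]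
  by linarith

text \<open>A competitor \<open>y\<close> at uniform distance at least \<open>d\<close> from
  \<open>x\<close> pays more than \<open>2 * B\<close>, which is all it can gain. A competitor
  within \<open>d\<close> is also Skorokhod close, so \<open>f y\<close> is nearly
  \<open>f x\<close>.\<close>

lemma inf_conv_tendsto:
  assumes f: "skorokhod_bcont a b f" and x: "cadlag_on a b x"
  shows "(\<lambda>n. inf_conv a b f n x) \<longlonglongrightarrow> f x"
proof (rule tendstoI)
  fix e :: real assume e: "e > 0"
  then obtain d where d: "d > 0" "\<And>y. cadlag_on a b y \<Longrightarrow> skorokhod_dist a b x y < d \<Longrightarrow> \<bar>f y - f x\<bar> < e/2"
    using f x unfolding skorokhod_bcont_def by (meson half_gt_zero)
  have "eventually (\<lambda>n. 2 * B / d < real n) sequentially"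
    using filterlim_real_sequentially unfolding filterlim_at_top_dense by blast
  then show "eventually (\<lambda>n. dist (inf_conv a b f n x) (f x) < e) sequentially"
  proof eventually_elim
    case (elim n)
    have "f x - e/2 \<le> inf_conv a b f n x"
      unfolding inf_conv_def
    proof (rule cINF_greatest)
      fix y assume y': "y \<in> Collect (cadlag_on a b)"
      then have y: "cadlag_on a b y" by simp
      have nn: "0 \<le> real n * sup_dist a b x y" using sup_dist_nonneg[OF ab x y] by simp
      show "f x - e/2 \<le> f y + real n * sup_dist a b x y"
      proof (cases "sup_dist a b x y < d")
        case True
        have "skorokhod_dist a b x y \<le> sup_dist a b x y"
          by (rule skorokhod_dist_le_sup[OF ab sup_dist_nonneg[OF ab x y] sup_dist_upper[OF ab x y]])
        then have "\<bar>f y - f x\<bar> < e/2" using True by (intro d(2)[OF y]) linarith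
        then show ?thesis using nn by linarith
      next
        case False
        have "2 * B < real n * d" using elim d(1) by (simp add: divide_simps)
        also have "\<dots> \<le> real n * sup_dist a b x y" using False by (intro mult_left_mono) auto
        finally show ?thesis using abs_le_bound[OF x] abs_le_bound[OF y] e by linarith
      qed
    qed (use x in auto)
    then show ?case using inf_conv_le_self[OF x, of n] e by (simp add: dist_real_def)
  qed
qed

lemma inf_conv_step_isCont:
  assumes k: "k > 0"
  shows "isCont (\<lambda>v. inf_conv a b f n (step_fn a b k v)) v"
proof (rule isCont_nat_funI[of k])
  fix e :: real assume e: "e > 0"
  show "\<exists>d>0. \<forall>w. (\<forall>i\<le>k. \<bar>w i - v i\<bar> < d) \<longrightarrow> \<bar>inf_conv a b f n (step_fn a b k w) - inf_conv a b f n (step_fn a b k v)\<bar> < e"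
  proof (intro exI[of _ "e / (n + 1)"] conjI allI impI)
    fix w assume w: "\<forall>i\<le>k. \<bar>w i - v i\<bar> < e / (n + 1)"
    have "sup_dist a b (step_fn a b k w) (step_fn a b k v) \<le> e / (n + 1)"
    proof (rule sup_dist_least[OF ab])
      fix t assume "t \<in> {a..b}"
      then show "\<bar>step_fn a b k w t - step_fn a b k v t\<bar> \<le> e / (n + 1)"
        unfolding step_fn_def using grid_floor_index[OF ab k] w less_imp_le by blast
    qed
    then have "real n * sup_dist a b (step_fn a b k w) (step_fn a b k v) \<le> real n * (e / (n + 1))"
      by (intro mult_left_mono) auto
    also have "\<dots> < e" using e by (simp add: field_simps)
    finally show "\<bar>inf_conv a b f n (step_fn a b k w) - inf_conv a b f n (step_fn a b k v)\<bar> < e"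
      using inf_conv_lipschitz_abs[OF cadlag_on_step_fn[OF ab k] cadlag_on_step_fn[OF ab k], of n w v]
        by linarith
  qed (use e in auto)
qed

lemma inf_conv_step_dep:
  assumes k: "k > 0" and vw: "\<And>i. i < Suc k \<Longrightarrow> v i = w i"
  shows "inf_conv a b f n (step_fn a b k v) = inf_conv a b f n (step_fn a b k w)"
proof -
  have "\<bar>step_fn a b k v t - y t\<bar> = \<bar>step_fn a b k w t - y t\<bar>" if "t \<in> {a..b}" for t y
    using grid_floor_index[OF ab k that] vw by (simp add: step_fn_def)
  then have "sup_dist a b (step_fn a b k v) = sup_dist a b (step_fn a b k w)"
    unfolding sup_dist_def by (intro ext SUP_cong) auto
  then show ?thesis by (simp add: inf_conv_def)
qed

lemma inf_conv_step_approx_tendsto: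
  assumes x: "cadlag_on a b x" and lim: "(\<lambda>k. sup_dist a b x (step_approx a b k x)) \<longlonglongrightarrow> 0"
  shows "(\<lambda>k. inf_conv a b f n (step_approx a b k x)) \<longlonglongrightarrow> inf_conv a b f n x"
proof (rule LIM_zero_cancel, rule tendsto_rabs_zero_cancel, rule tendsto_sandwich[OF _ _ tendsto_const])
  show "(\<lambda>k. real n * sup_dist a b x (step_approx a b k x)) \<longlonglongrightarrow> 0"
    using tendsto_mult_right_zero[OF lim] by simp
  show "eventually (\<lambda>k. \<bar>inf_conv a b f n (step_approx a b k x) - inf_conv a b f n x\<bar> \<le> real n * sup_dist a b x (step_approx a b k x)) sequentially"
    using eventually_gt_at_top[of 0]
  proof eventually_elim
    case (elim k)
    have c: "cadlag_on a b (step_approx a b k x)"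
      unfolding step_approx_def by (rule cadlag_on_step_fn[OF ab elim])
    show ?case using inf_conv_lipschitz_abs[OF x c, of n] by linarith
  qed
qed auto

end

text \<open>Uniform continuity on a compact interval. A jump off the grid would leave a fixed
  distance, so this serves the limit process only; the particle paths need the tightness bound
  instead.\<close>

lemma continuous_sup_dist_step_approx:
  assumes ab: "a < b" and c: "continuous_on {a..b} x"
  shows "(\<lambda>k. sup_dist a b x (step_approx a b k x)) \<longlonglongrightarrow> 0"
proof (rule tendstoI)
  fix e :: real assume e: "e > 0"
  have "uniformly_continuous_on {a..b} x" using c by (intro compact_uniformly_continuous) auto
  then obtain d where d: "d > 0" "\<And>s t. s \<in> {a..b} \<Longrightarrow> t \<in> {a..b} \<Longrightarrow> dist t s < d \<Longrightarrow> dist (x t) (x s) < e/2"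
    unfolding uniformly_continuous_on_def using e by (meson half_gt_zero)
  have "(\<lambda>k. (b - a) / real k) \<longlonglongrightarrow> 0"
    by (rule tendsto_divide_0[OF tendsto_const filterlim_at_top_imp_at_infinity[OF filterlim_real_sequentially]])
  then have "eventually (\<lambda>k. (b - a) / real k < d) sequentially"
    using d(1) by (intro order_tendstoD(2)) auto
  then show "eventually (\<lambda>k. dist (sup_dist a b x (step_approx a b k x)) 0 < e) sequentially"
    using eventually_gt_at_top[of 0]
  proof eventually_elim
    case (elim k)
    have bd: "\<bar>x t - step_approx a b k x t\<bar> \<le> e/2" if t: "t \<in> {a..b}" for t
    proof -
      have "dist t (grid_floor a b k t) < d"
        using grid_floor_bounds[OF ab elim(2), of t] elim(1) by (simp add: dist_real_def)
      then have "dist (x t) (x (grid_floor a b k t)) < e/2"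
        using d(2) t grid_floor_mem[OF ab elim(2) t] by blast
      then show ?thesis using step_approx_eq[OF ab elim(2), of t x] t by (simp add: dist_real_def)
    qed
    have "sup_dist a b x (step_approx a b k x) \<le> e/2" using bd by (rule sup_dist_least[OF ab])
    moreover have "\<bar>x a - step_approx a b k x a\<bar> \<le> sup_dist a b x (step_approx a b k x)"
      unfolding sup_dist_def using ab bd by (intro cSUP_upper bdd_aboveI2[where M="e/2"]) auto
    ultimately show ?case using e by (simp add: dist_real_def)
  qed
qed

lemma continuous_imp_cadlag_on:
  assumes ab: "a < b" and c: "continuous_on {a..b} x" shows "cadlag_on a b x"
  unfolding cadlag_on_def
proof (intro conjI ballI)
  fix t assume t: "t \<in> {a..<b}"
  have "(x \<longlongrightarrow> x t) (at t within {t..b})"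
    using c t by (metis atLeastAtMost_iff atLeastLessThan_iff greaterThanAtMost_iff atLeastatMost_subset_iff continuous_on_def less_eq_real_def order_refl tendsto_within_subset)
  then show "(x \<longlongrightarrow> x t) (at_right t)" using t by (simp add: at_within_Icc_at_right)
next
  fix t assume t: "t \<in> {a<..b}"
  have "(x \<longlongrightarrow> x t) (at t within {a..t})"
    using c t by (metis atLeastAtMost_iff atLeastLessThan_iff greaterThanAtMost_iff atLeastatMost_subset_iff continuous_on_def less_eq_real_def order_refl tendsto_within_subset)
  then show "\<exists>l. (x \<longlongrightarrow> l) (at_left t)" using t by (auto simp: at_within_Icc_at_left)
qed

text \<open>With \<open>g\<close> an envelope of \<open>f\<close>, the chain of expectations is
  \<open>f\<close> at \<open>Y\<close>, \<open>g\<close> at \<open>Y\<close>, \<open>g\<close> at a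
  step approximation of \<open>Y\<close>, \<open>g\<close> at a step approximation of
  \<open>X\<close>, \<open>f\<close> at \<open>X\<close>. The last link is only an inequality,
  because \<open>g\<close> lies below \<open>f\<close>; hence the one-sided conclusion.\<close>

lemma skorokhod_weak_lower:
  fixes X :: "nat \<Rightarrow> real \<Rightarrow> 'a \<Rightarrow> real" and Y :: "real \<Rightarrow> 'b \<Rightarrow> real"
  assumes M: "prob_space M" and P: "prob_space P" and ab: "a < b"
    and X: "\<And>N t. t \<in> {a..b} \<Longrightarrow> X N t \<in> borel_measurable M" and Y: "\<And>t. t \<in> {a..b} \<Longrightarrow> Y t \<in> borel_measurable P"
    and Xc: "\<And>N \<omega>. \<omega> \<in> space M \<Longrightarrow> cadlag_on a b (\<lambda>t. X N t \<omega>)"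
    and Yc: "\<And>\<omega>. \<omega> \<in> space P \<Longrightarrow> continuous_on {a..b} (\<lambda>t. Y t \<omega>)"
    and conv: "\<And>m ts u c. (\<And>i. i < m \<Longrightarrow> ts i \<in> {a..b}) \<Longrightarrow>
        (\<lambda>N. integral\<^sup>L M (\<lambda>\<omega>. cos ((\<Sum>i<(m::nat). u i * X N (ts i) \<omega>) + c)))
        \<longlonglongrightarrow> integral\<^sup>L P (\<lambda>\<omega>. cos ((\<Sum>i<m. u i * Y (ts i) \<omega>) + c))"
    and X2: "\<And>N t. t \<in> {a..b} \<Longrightarrow> integrable M (\<lambda>\<omega>. (X N t \<omega>)\<^sup>2)" "\<And>N t. t \<in> {a..b} \<Longrightarrow> integral\<^sup>L M (\<lambda>\<omega>. (X N t \<omega>)\<^sup>2) \<le> C"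
    and Y2: "\<And>t. t \<in> {a..b} \<Longrightarrow> integrable P (\<lambda>\<omega>. (Y t \<omega>)\<^sup>2)" "\<And>t. t \<in> {a..b} \<Longrightarrow> integral\<^sup>L P (\<lambda>\<omega>. (Y t \<omega>)\<^sup>2) \<le> C"
    and tight: "\<And>\<epsilon> \<eta>. \<epsilon> > 0 \<Longrightarrow> \<eta> > 0 \<Longrightarrow> eventually (\<lambda>k. eventually (\<lambda>N. \<exists>A\<in>sets M. measure M A \<le> \<eta> \<and>
        (\<forall>\<omega>\<in>space M - A. \<forall>t\<in>{a..b}. \<bar>X N t \<omega> - step_approx a b k (\<lambda>t. X N t \<omega>) t\<bar> \<le> \<epsilon>)) sequentially) sequentially"
    and f: "skorokhod_bcont a b f" and e: "e > 0"
  shows "eventually (\<lambda>N. integral\<^sup>L P (\<lambda>\<omega>. f (\<lambda>t. Y t \<omega>)) - e < integral\<^sup>L M (\<lambda>\<omega>. f (\<lambda>t. X N t \<omega>))) sequentially"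
proof -
  interpret M: prob_space M by fact
  interpret P: prob_space P by fact
  obtain B where B: "\<And>x. cadlag_on a b x \<Longrightarrow> \<bar>f x\<bar> \<le> B" using f unfolding skorokhod_bcont_def by blast
  then have B': "\<forall>x. cadlag_on a b x \<longrightarrow> \<bar>f x\<bar> \<le> B" by blast
  have Yd: "cadlag_on a b (\<lambda>t. Y t \<omega>)" if "\<omega> \<in> space P" for \<omega>
    using continuous_imp_cadlag_on[OF ab Yc[OF that]] .
  have B0: "0 \<le> B" using B[OF cadlag_on_step_fn[OF ab, of 1]] by (metis abs_ge_zero order_trans zero_less_one)
  let ?g = "inf_conv a b f"
  let ?G = "\<lambda>n k v. ?g n (step_fn a b (Suc k) v)"
  note gC = inf_conv_step_isCont[where f=f and B=B, OF ab B' zero_less_Suc]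
  note gD = inf_conv_step_dep[where f=f and B=B, OF ab B' zero_less_Suc]
  note gB = inf_conv_abs_le[where f=f and B=B, OF ab B']
  have sc: "cadlag_on a b (step_approx a b (Suc k) x)" for k x
    unfolding step_approx_def by (rule cadlag_on_step_fn[OF ab]) simp
  \<comment> \<open>A grid of \<open>Suc k\<close> cells has \<open>Suc (Suc k)\<close> points; this
    is the number of coordinates in the finite-dimensional limit.\<close>
  have gp: "grid_pt a b (Suc k) i \<in> {a..b}" if "i < Suc (Suc k)" for i k
    using grid_pt_mem[OF ab, of "Suc k" i] that by simp
  have measY: "(\<lambda>\<omega>. ?g n (step_approx a b (Suc k) (\<lambda>t. Y t \<omega>))) \<in> borel_measurable P" for n k
    unfolding step_approx_def
    by (rule measurable_nat_fun_dep[where F="?G n k" and m="Suc (Suc k)" and X="\<lambda>i. Y (grid_pt a b (Suc k) i)"])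
      (auto intro: gC gD Y gp simp del: atLeastAtMost_iff)
  have measX: "(\<lambda>\<omega>. ?g n (step_approx a b (Suc k) (\<lambda>t. X N t \<omega>))) \<in> borel_measurable M" for n k N
    unfolding step_approx_def
    by (rule measurable_nat_fun_dep[where F="?G n k" and m="Suc (Suc k)" and X="\<lambda>i. X N (grid_pt a b (Suc k) i)"])
      (auto intro: gC gD X gp simp del: atLeastAtMost_iff)
  have limY: "(\<lambda>k. ?g n (step_approx a b (Suc k) (\<lambda>t. Y t \<omega>))) \<longlonglongrightarrow> ?g n (\<lambda>t. Y t \<omega>)" if "\<omega> \<in> space P" for n \<omega>
    by (intro LIMSEQ_Suc inf_conv_step_approx_tendsto[where f=f and B=B, OF ab B' Yd[OF that]] continuous_sup_dist_step_approx[OF ab Yc[OF that]])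
  have measY': "(\<lambda>\<omega>. ?g n (\<lambda>t. Y t \<omega>)) \<in> borel_measurable P" for n
    by (rule borel_measurable_LIMSEQ_real[OF limY measY])
  have measfY: "(\<lambda>\<omega>. f (\<lambda>t. Y t \<omega>)) \<in> borel_measurable P" by (rule skorokhod_bcont_measurable[OF f ab Y Yd])
  have measfX: "(\<lambda>\<omega>. f (\<lambda>t. X N t \<omega>)) \<in> borel_measurable M" for N by (rule skorokhod_bcont_measurable[OF f ab X Xc])
  have intX: "integrable M (\<lambda>\<omega>. ?g n (step_approx a b (Suc k) (\<lambda>t. X N t \<omega>)))" for n k N
    using gB[OF sc] by (intro M.integrable_const_bound[where B=B] measX) auto
  have intfX: "integrable M (\<lambda>\<omega>. f (\<lambda>t. X N t \<omega>))" for N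
    using B[OF Xc] by (intro M.integrable_const_bound[where B=B] measfX) auto
  have "(\<lambda>n. integral\<^sup>L P (\<lambda>\<omega>. ?g n (\<lambda>t. Y t \<omega>))) \<longlonglongrightarrow> integral\<^sup>L P (\<lambda>\<omega>. f (\<lambda>t. Y t \<omega>))"
    using measfY measY' inf_conv_tendsto[where f=f and B=B, OF ab B' f Yd] gB[OF Yd]
    by (intro integral_dominated_convergence[where w="\<lambda>_. B"]) auto
  then have "eventually (\<lambda>n. integral\<^sup>L P (\<lambda>\<omega>. f (\<lambda>t. Y t \<omega>)) - e/4 < integral\<^sup>L P (\<lambda>\<omega>. ?g n (\<lambda>t. Y t \<omega>))) sequentially"
    using e by (intro order_tendstoD(1)) auto
  then obtain n where n: "integral\<^sup>L P (\<lambda>\<omega>. f (\<lambda>t. Y t \<omega>)) - e/4 < integral\<^sup>L P (\<lambda>\<omega>. ?g n (\<lambda>t. Y t \<omega>))"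
    by (auto simp: eventually_sequentially)
  \<comment> \<open>Three links of the chain cost \<open>e/4\<close> each. The last quarter is split
    between the Lipschitz error \<open>n * \<epsilon>\<close> and the bad-set error
    \<open>2 * B * \<eta>\<close>; adding 1 to \<open>n\<close> and to \<open>B\<close> keeps the
    denominators positive.\<close>
  define \<epsilon> where "\<epsilon> = e / (8 * (real n + 1))"
  define \<eta> where "\<eta> = e / (16 * (B + 1))"
  have pos: "\<epsilon> > 0" "\<eta> > 0" using e B0 by (auto simp: \<epsilon>_def \<eta>_def)
  have n\<epsilon>: "real n * \<epsilon> \<le> e/8" using e by (simp add: \<epsilon>_def field_simps)
  have B\<eta>: "2 * B * \<eta> \<le> e/8" using e B0 by (simp add: \<eta>_def field_simps)
  have "(\<lambda>k. integral\<^sup>L P (\<lambda>\<omega>. ?g n (step_approx a b (Suc k) (\<lambda>t. Y t \<omega>)))) \<longlonglongrightarrow> integral\<^sup>L P (\<lambda>\<omega>. ?g n (\<lambda>t. Y t \<omega>))"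
    using measY' measY limY gB[OF sc]
    by (intro integral_dominated_convergence[where w="\<lambda>_. B"]) auto
  then have "eventually (\<lambda>k. integral\<^sup>L P (\<lambda>\<omega>. ?g n (\<lambda>t. Y t \<omega>)) - e/4 < integral\<^sup>L P (\<lambda>\<omega>. ?g n (step_approx a b (Suc k) (\<lambda>t. Y t \<omega>)))) sequentially"
    using e by (intro order_tendstoD(1)) auto
  moreover have "eventually (\<lambda>k. eventually (\<lambda>N. \<exists>A\<in>sets M. measure M A \<le> \<eta> \<and>
        (\<forall>\<omega>\<in>space M - A. \<forall>t\<in>{a..b}. \<bar>X N t \<omega> - step_approx a b (Suc k) (\<lambda>t. X N t \<omega>) t\<bar> \<le> \<epsilon>)) sequentially) sequentially"
    using tight[OF pos] by (subst eventually_sequentially_Suc)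
  ultimately obtain k where k: "integral\<^sup>L P (\<lambda>\<omega>. ?g n (\<lambda>t. Y t \<omega>)) - e/4 < integral\<^sup>L P (\<lambda>\<omega>. ?g n (step_approx a b (Suc k) (\<lambda>t. Y t \<omega>)))"
    and ev: "eventually (\<lambda>N. \<exists>A\<in>sets M. measure M A \<le> \<eta> \<and>
        (\<forall>\<omega>\<in>space M - A. \<forall>t\<in>{a..b}. \<bar>X N t \<omega> - step_approx a b (Suc k) (\<lambda>t. X N t \<omega>) t\<bar> \<le> \<epsilon>)) sequentially"
    using eventually_happens'[OF sequentially_bot eventually_conj] that by blast
  have "(\<lambda>N. integral\<^sup>L M (\<lambda>\<omega>. ?G n k (\<lambda>i. X N (grid_pt a b (Suc k) i) \<omega>))) \<longlonglongrightarrow> integral\<^sup>L P (\<lambda>\<omega>. ?G n k (\<lambda>i. Y (grid_pt a b (Suc k) i) \<omega>))"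
  proof (rule trig_imp_weak_convergence[where m="Suc (Suc k)" and B=B and C=C and F="?G n k", OF M P])
    show "(\<lambda>N. integral\<^sup>L M (\<lambda>\<omega>. cos ((\<Sum>i<Suc (Suc k). u i * X N (grid_pt a b (Suc k) i) \<omega>) + c)))
        \<longlonglongrightarrow> integral\<^sup>L P (\<lambda>\<omega>. cos ((\<Sum>i<Suc (Suc k). u i * Y (grid_pt a b (Suc k) i) \<omega>) + c))" for u c
      by (rule conv[OF gp])
    show "inf_conv a b f n (step_fn a b (Suc k) v) = inf_conv a b f n (step_fn a b (Suc k) w)"
      if "\<And>i. i < Suc (Suc k) \<Longrightarrow> v i = w i" for v w using that by (rule gD)
    show "\<bar>inf_conv a b f n (step_fn a b (Suc k) v)\<bar> \<le> B" for v by (rule gB[OF cadlag_on_step_fn[OF ab zero_less_Suc]])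
  qed (rule gC X[OF gp] Y[OF gp] X2(1)[OF gp] X2(2)[OF gp] Y2(1)[OF gp] Y2(2)[OF gp], assumption?)+
  then have "eventually (\<lambda>N. integral\<^sup>L P (\<lambda>\<omega>. ?g n (step_approx a b (Suc k) (\<lambda>t. Y t \<omega>))) - e/4
      < integral\<^sup>L M (\<lambda>\<omega>. ?g n (step_approx a b (Suc k) (\<lambda>t. X N t \<omega>)))) sequentially"
    using e unfolding step_approx_def by (intro order_tendstoD(1)) auto
  with ev show ?thesis
  proof eventually_elim
    case (elim N)
    then obtain A where A: "A \<in> sets M" "measure M A \<le> \<eta>"
      "\<And>\<omega> t. \<omega> \<in> space M - A \<Longrightarrow> t \<in> {a..b} \<Longrightarrow> \<bar>X N t \<omega> - step_approx a b (Suc k) (\<lambda>t. X N t \<omega>) t\<bar> \<le> \<epsilon>" by blast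
    \<comment> \<open>Only \<open>f\<close> is evaluated at the full path. Off \<open>A\<close> the
      Lipschitz bound applies and the envelope lies below \<open>f\<close>; on \<open>A\<close> both
      values are bounded by \<open>B\<close>.\<close>
    have pt: "?g n (step_approx a b (Suc k) (\<lambda>t. X N t \<omega>)) - (real n * \<epsilon> + 2 * B * indicator A \<omega>) \<le> f (\<lambda>t. X N t \<omega>)"
      if w: "\<omega> \<in> space M" for \<omega>
    proof (cases "\<omega> \<in> A")
      case True
      have "0 \<le> real n * \<epsilon>" using pos by simp
      then show ?thesis using gB[OF sc, of n k "\<lambda>t. X N t \<omega>"] B[OF Xc[OF w, of N]] True by simp
    next
      case False
      have "sup_dist a b (\<lambda>t. X N t \<omega>) (step_approx a b (Suc k) (\<lambda>t. X N t \<omega>)) \<le> \<epsilon>"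
        using A(3) w False by (intro sup_dist_least[OF ab]) auto
      then have "real n * sup_dist a b (\<lambda>t. X N t \<omega>) (step_approx a b (Suc k) (\<lambda>t. X N t \<omega>)) \<le> real n * \<epsilon>"
        by (intro mult_left_mono) auto
      then have "real n * sup_dist a b (step_approx a b (Suc k) (\<lambda>t. X N t \<omega>)) (\<lambda>t. X N t \<omega>) \<le> real n * \<epsilon>"
        by (subst sup_dist_commute)
      moreover have "2 * B * indicator A \<omega> = 0" using False by simp
      ultimately show ?thesis
        using inf_conv_lipschitz[where f=f and B=B, OF ab B' sc Xc[OF w], of n k "\<lambda>t. X N t \<omega>" N] inf_conv_le_self[where f=f and B=B, OF ab B' Xc[OF w], of n N]
        by linarith
    qed
    have iA: "integrable M (indicator A :: 'a \<Rightarrow> real)" using A(1) by (simp add: M.emeasure_eq_measure)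
    have "integral\<^sup>L M (\<lambda>\<omega>. ?g n (step_approx a b (Suc k) (\<lambda>t. X N t \<omega>))) - (real n * \<epsilon> + 2 * B * measure M A)
       = integral\<^sup>L M (\<lambda>\<omega>. ?g n (step_approx a b (Suc k) (\<lambda>t. X N t \<omega>)) - (real n * \<epsilon> + 2 * B * indicator A \<omega>))"
      using intX iA A(1) by (simp add: M.prob_space)
    also have "\<dots> \<le> integral\<^sup>L M (\<lambda>\<omega>. f (\<lambda>t. X N t \<omega>))"
      using intX iA intfX pt by (intro integral_mono) auto
    finally have "integral\<^sup>L M (\<lambda>\<omega>. ?g n (step_approx a b (Suc k) (\<lambda>t. X N t \<omega>))) - (real n * \<epsilon> + 2 * B * measure M A)
      \<le> integral\<^sup>L M (\<lambda>\<omega>. f (\<lambda>t. X N t \<omega>))" .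
    moreover have "2 * B * measure M A \<le> 2 * B * \<eta>" using A(2) B0 by (intro mult_left_mono) auto
    ultimately show ?case using n k elim(2) n\<epsilon> B\<eta> by linarith
  qed
qed

text \<open>Lets the one-sided bound be applied to \<open>- f\<close> as well, which gives the
  matching upper bound.\<close>

lemma skorokhod_bcont_uminus: "skorokhod_bcont a b f \<Longrightarrow> skorokhod_bcont a b (\<lambda>x. - f x)"
  unfolding skorokhod_bcont_def by (simp add: abs_minus_commute)

theorem skorokhod_weak_convergence:
  fixes X :: "nat \<Rightarrow> real \<Rightarrow> 'a \<Rightarrow> real" and Y :: "real \<Rightarrow> 'b \<Rightarrow> real"
  assumes M: "prob_space M" and P: "prob_space P" and ab: "a < b"
    and X: "\<And>N t. t \<in> {a..b} \<Longrightarrow> X N t \<in> borel_measurable M" and Y: "\<And>t. t \<in> {a..b} \<Longrightarrow> Y t \<in> borel_measurable P"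
    and Xc: "\<And>N \<omega>. \<omega> \<in> space M \<Longrightarrow> cadlag_on a b (\<lambda>t. X N t \<omega>)"
    and Yc: "\<And>\<omega>. \<omega> \<in> space P \<Longrightarrow> continuous_on {a..b} (\<lambda>t. Y t \<omega>)"
    and conv: "\<And>m ts u c. (\<And>i. i < m \<Longrightarrow> ts i \<in> {a..b}) \<Longrightarrow>
        (\<lambda>N. integral\<^sup>L M (\<lambda>\<omega>. cos ((\<Sum>i<(m::nat). u i * X N (ts i) \<omega>) + c)))
        \<longlonglongrightarrow> integral\<^sup>L P (\<lambda>\<omega>. cos ((\<Sum>i<m. u i * Y (ts i) \<omega>) + c))"
    and X2: "\<And>N t. t \<in> {a..b} \<Longrightarrow> integrable M (\<lambda>\<omega>. (X N t \<omega>)\<^sup>2)" "\<And>N t. t \<in> {a..b} \<Longrightarrow> integral\<^sup>L M (\<lambda>\<omega>. (X N t \<omega>)\<^sup>2) \<le> C"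
    and Y2: "\<And>t. t \<in> {a..b} \<Longrightarrow> integrable P (\<lambda>\<omega>. (Y t \<omega>)\<^sup>2)" "\<And>t. t \<in> {a..b} \<Longrightarrow> integral\<^sup>L P (\<lambda>\<omega>. (Y t \<omega>)\<^sup>2) \<le> C"
    and tight: "\<And>\<epsilon> \<eta>. \<epsilon> > 0 \<Longrightarrow> \<eta> > 0 \<Longrightarrow> eventually (\<lambda>k. eventually (\<lambda>N. \<exists>A\<in>sets M. measure M A \<le> \<eta> \<and>
        (\<forall>\<omega>\<in>space M - A. \<forall>t\<in>{a..b}. \<bar>X N t \<omega> - step_approx a b k (\<lambda>t. X N t \<omega>) t\<bar> \<le> \<epsilon>)) sequentially) sequentially"
    and f: "skorokhod_bcont a b f"
  shows "(\<lambda>N. integral\<^sup>L M (\<lambda>\<omega>. f (\<lambda>t. X N t \<omega>))) \<longlonglongrightarrow> integral\<^sup>L P (\<lambda>\<omega>. f (\<lambda>t. Y t \<omega>))"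
proof (rule tendstoI)
  fix e :: real assume e: "e > 0"
  have lower: "eventually (\<lambda>N. integral\<^sup>L P (\<lambda>\<omega>. g (\<lambda>t. Y t \<omega>)) - e < integral\<^sup>L M (\<lambda>\<omega>. g (\<lambda>t. X N t \<omega>))) sequentially"
    if "skorokhod_bcont a b g" for g
    by (rule skorokhod_weak_lower[where C=C and X=X and Y=Y, OF M P ab]) (fact X, fact Y, fact Xc, fact Yc, fact conv, fact X2(1), fact X2(2), fact Y2(1), fact Y2(2), fact tight, fact that, fact e)
  show "eventually (\<lambda>N. dist (integral\<^sup>L M (\<lambda>\<omega>. f (\<lambda>t. X N t \<omega>))) (integral\<^sup>L P (\<lambda>\<omega>. f (\<lambda>t. Y t \<omega>))) < e) sequentially"
    using lower[OF f] lower[OF skorokhod_bcont_uminus[OF f]]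
    by eventually_elim (auto simp: dist_real_def)
qed

section \<open>Brownian motion\<close>

definition hat :: "real \<Rightarrow> real" where "hat x = max 0 (1 - \<bar>x\<bar>)"

lemma hat_nonneg: "0 \<le> hat x" and hat_le_1: "hat x \<le> 1"
  by (auto simp: hat_def)

lemma hat_of_int: "hat (of_int k) = (if k = 0 then 1 else 0)"
proof (cases "k = 0")
  case False
  then have "1 \<le> \<bar>real_of_int k\<bar>" by linarith
  then show ?thesis using False by (simp add: hat_def)
qed (simp add: hat_def)

text \<open>Affinity between consecutive integers, in the form of a midpoint rule because dyadic
  refinement only asks for values at midpoints.\<close>

lemma hat_affine:
  fixes k :: int
  assumes "x \<in> {of_int k..of_int k + 1}" "y \<in> {of_int k..of_int k + 1}"
  shows "hat ((x + y) / 2) = (hat x + hat y) / 2"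
proof -
  consider "k \<ge> 1" | "k = 0" | "k = -1" | "k \<le> -2" by linarith
  then show ?thesis
  proof cases
    case 1 then have "real_of_int k \<ge> 1" by simp
    then have "x \<ge> 1" "y \<ge> 1" using assms by auto
    then show ?thesis by (simp add: hat_def)
  next
    case 2 then show ?thesis using assms by (auto simp: hat_def max_def field_simps)
  next
    case 3 then show ?thesis using assms by (auto simp: hat_def max_def field_simps)
  next
    case 4 then have "real_of_int k \<le> -2" by simp
    then have "x \<le> -1" "y \<le> -1" using assms by auto
    then show ?thesis by (simp add: hat_def)
  qed
qed

text \<open>The primitive of the \<open>j\<close>-th Haar function of level \<open>n\<close>: a tent
  over the dyadic interval from \<open>j / 2 ^ n\<close> to \<open>(j + 1) / 2 ^ n\<close> with peak
  \<open>1 / (2 * sqrt (2 ^ n))\<close>.\<close>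

definition schauder :: "nat \<Rightarrow> nat \<Rightarrow> real \<Rightarrow> real" where
  "schauder n j t = hat (2 ^ Suc n * t - (2 * real j + 1)) / (2 * sqrt (2 ^ n))"

text \<open>The index \<open>2 ^ n + j\<close> with \<open>j < 2 ^ n\<close> stands for the \<open>j\<close>-th tent of level \<open>n\<close>; the index \<open>0\<close> for the linear term.\<close>

definition brown_coeff :: "real \<Rightarrow> nat \<Rightarrow> real" where
  "brown_coeff t i = (if i = 0 then t else schauder (floor_log i) (i - 2 ^ floor_log i) t)"

lemma brown_coeff_level: "j < 2 ^ n \<Longrightarrow> brown_coeff t (2 ^ n + j) = schauder n j t"
proof -
  assume j: "j < 2 ^ n"
  have "floor_log (2 ^ n + j) = n" using j by (intro floor_log_eqI) auto
  then show ?thesis by (simp add: brown_coeff_def)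
qed

lemma sum_lessThan_add:
  fixes f :: "nat \<Rightarrow> 'a :: comm_monoid_add"
  shows "(\<Sum>i<m + n. f i) = (\<Sum>i<m. f i) + (\<Sum>j<n. f (m + j))"
  by (induction n) (simp_all add: add.assoc)

lemma sum_levels:
  fixes f :: "nat \<Rightarrow> 'a :: comm_monoid_add"
  shows "(\<Sum>i<2 ^ Suc n. f i) = (\<Sum>i<2 ^ n. f i) + (\<Sum>j<2 ^ n. f (2 ^ n + j))"
proof -
  have "(2::nat) ^ Suc n = 2 ^ n + 2 ^ n" by simp
  then show ?thesis by (simp only: sum_lessThan_add)
qed

text \<open>In the scaled variable a grid point of level at most \<open>n\<close> is an even integer
  and the centre of the tent an odd one, so \<open>hat\<close> is evaluated at a nonzero
  integer.\<close>

lemma schauder_grid_coarse: "m \<le> n \<Longrightarrow> schauder n j (real k / 2 ^ m) = 0"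
proof -
  assume "m \<le> n"
  then have *: "(2::real) ^ n = 2 ^ m * 2 ^ (n - m)" by (simp flip: power_add)
  have e: "(2::real) ^ Suc n * (real k / 2 ^ m) = of_int (2 * (2 ^ (n - m) * int k))"
    unfolding power_Suc * by simp
  have "2 ^ Suc n * (real k / 2 ^ m) - (2 * real j + 1) = of_int (2 * (2 ^ (n - m) * int k) - (2 * int j + 1))"
    unfolding e by simp
  moreover have "2 * z - (2 * int j + 1) \<noteq> 0" for z by presburger
  ultimately show ?thesis unfolding schauder_def by (simp only: hat_of_int) simp
qed

lemma schauder_odd: "schauder n j (real (2 * k + 1) / 2 ^ Suc n) = (if j = k then 1 / (2 * sqrt (2 ^ n)) else 0)"
proof -
  have "2 ^ Suc n * (real (2 * k + 1) / 2 ^ Suc n) - (2 * real j + 1) = of_int (2 * (int k - int j))"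
    by simp
  then show ?thesis unfolding schauder_def by (simp only: hat_of_int) simp
qed

lemma schauder_midpoint:
  assumes "m < n"
  shows "schauder m j (real (2 * k + 1) / 2 ^ Suc n) = (schauder m j (real k / 2 ^ n) + schauder m j (real (Suc k) / 2 ^ n)) / 2"
proof -
  \<comment> \<open>Half the support of a tent of level \<open>m\<close> consists of
    \<open>p\<close> intervals of level \<open>n\<close>; \<open>q\<close> numbers the piece that
    contains the \<open>k\<close>-th of them, and on each piece the tent is affine.\<close>
  define p :: nat where "p = 2 ^ (n - Suc m)"
  have p: "p > 0" by (simp add: p_def)
  have pn: "(2::real) ^ n = 2 ^ Suc m * real p"
    using assms by (simp add: p_def flip: power_add power_Suc)
  define q where "q = k div p"
  obtain r where "k = q * p + r" "r < p"
    using div_mult_mod_eq[of k p] mod_less_divisor[OF p, of k] unfolding q_def by metis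
  then have qk: "q * p \<le> k" "k < q * p + p" by simp_all
  then have qr: "real q * real p \<le> real k" "real (Suc k) \<le> real q * real p + real p"
    by (metis of_nat_le_iff of_nat_mult, metis Suc_leI of_nat_le_iff of_nat_mult of_nat_add)
  define x where "x = 2 ^ Suc m * (real k / 2 ^ n) - (2 * real j + 1)"
  define y where "y = 2 ^ Suc m * (real (Suc k) / 2 ^ n) - (2 * real j + 1)"
  have xy: "x = real k / real p - (2 * real j + 1)" "y = real (Suc k) / real p - (2 * real j + 1)"
    unfolding x_def y_def pn by simp_all
  have "real k / real p \<in> {real q..real q + 1}" "real (Suc k) / real p \<in> {real q..real q + 1}"
    using qr p by (auto simp: field_simps)
  then have "hat ((x + y) / 2) = (hat x + hat y) / 2"
    unfolding xy by (intro hat_affine[of _ "int q - (2 * int j + 1)"]) auto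
  moreover have "2 ^ Suc m * (real (2 * k + 1) / 2 ^ Suc n) - (2 * real j + 1) = (x + y) / 2"
    unfolding x_def y_def by (simp add: field_simps)
  ultimately show ?thesis
    unfolding schauder_def x_def y_def by (simp only:) (simp add: add_divide_distrib)
qed

lemma brown_coeff_midpoint:
  assumes "i < 2 ^ n"
  shows "brown_coeff (real (2 * k + 1) / 2 ^ Suc n) i = (brown_coeff (real k / 2 ^ n) i + brown_coeff (real (Suc k) / 2 ^ n) i) / 2"
proof (cases "i = 0")
  case True
  then show ?thesis by (simp add: brown_coeff_def field_simps)
next
  case False
  have "floor_log i < n"
  proof -
    have "2 ^ floor_log i \<le> i" using False by (simp add: floor_log_exp2_le)
    then have "(2::nat) ^ floor_log i < 2 ^ n" using assms by linarith
    then show ?thesis by simp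
  qed
  then show ?thesis using False schauder_midpoint by (simp add: brown_coeff_def)
qed

text \<open>Parseval's identity for the Haar basis at dyadic times, which yields the Brownian
  covariance. When the grid is refined, old coefficients at an odd point are averages over its
  neighbours, and one new tent contributes, visible only if both points coincide.\<close>

lemma sum_brown_coeff_grid:
  assumes "k \<le> 2 ^ n" "l \<le> 2 ^ n"
  shows "(\<Sum>i<2 ^ n. brown_coeff (real k / 2 ^ n) i * brown_coeff (real l / 2 ^ n) i) = real (min k l) / 2 ^ n"
  using assms
proof (induction n arbitrary: k l)
  case 0
  then have "k \<in> {0, 1}" "l \<in> {0, 1}" by auto
  then show ?case by (auto simp: brown_coeff_def)
next
  case (Suc n)
  let ?c = "\<lambda>k i. brown_coeff (real k / 2 ^ n) i"
  have lev: "(\<Sum>i<2 ^ Suc n. brown_coeff s i * brown_coeff t i)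
    = (\<Sum>i<2 ^ n. brown_coeff s i * brown_coeff t i) + (\<Sum>j<2 ^ n. schauder n j s * schauder n j t)" for s t
    unfolding sum_levels by (simp add: brown_coeff_level)
  have ev: "real (2 * j) / 2 ^ Suc n = real j / 2 ^ n" for j by simp
  have IH: "j \<le> 2 ^ n \<Longrightarrow> j' \<le> 2 ^ n \<Longrightarrow> (\<Sum>i<2 ^ n. ?c j i * ?c j' i) = real (min j j') / 2 ^ n" for j j'
    by (rule Suc.IH)
  have odd: "(\<Sum>i<2 ^ n. brown_coeff (real (2 * j + 1) / 2 ^ Suc n) i * h i)
     = ((\<Sum>i<2 ^ n. ?c j i * h i) + (\<Sum>i<2 ^ n. ?c (Suc j) i * h i)) / 2" for j h
  proof -
    have "(\<Sum>i<2 ^ n. brown_coeff (real (2 * j + 1) / 2 ^ Suc n) i * h i) = (\<Sum>i<2 ^ n. (?c j i * h i + ?c (Suc j) i * h i) / 2)"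
      by (intro sum.cong refl, subst brown_coeff_midpoint) (auto simp: distrib_right)
    then show ?thesis by (simp add: sum.distrib sum_divide_distrib[symmetric])
  qed
  have min_odd: "real (min (2 * j + 1) (2 * j')) = real (min j j') + real (min (Suc j) j')" for j j' :: nat
    by (auto simp: min_def)
  have mixed: "(\<Sum>i<2 ^ Suc n. brown_coeff (real (2 * j + 1) / 2 ^ Suc n) i * brown_coeff (real (2 * j') / 2 ^ Suc n) i)
     = real (min (2 * j + 1) (2 * j')) / 2 ^ Suc n" if "2 * j + 1 \<le> 2 ^ Suc n" "2 * j' \<le> 2 ^ Suc n" for j j'
  proof -
    have b: "j \<le> 2 ^ n" "Suc j \<le> 2 ^ n" "j' \<le> 2 ^ n" using that by auto
    have "(\<Sum>i<2 ^ Suc n. brown_coeff (real (2 * j + 1) / 2 ^ Suc n) i * brown_coeff (real (2 * j') / 2 ^ Suc n) i)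
      = ((\<Sum>i<2 ^ n. ?c j i * ?c j' i) + (\<Sum>i<2 ^ n. ?c (Suc j) i * ?c j' i)) / 2"
      unfolding lev odd ev by (simp add: schauder_grid_coarse)
    also have "\<dots> = real (min (2 * j + 1) (2 * j')) / 2 ^ Suc n"
      unfolding IH[OF b(1,3)] IH[OF b(2,3)] min_odd by (simp add: field_simps)
    finally show ?thesis .
  qed
  consider k' l' where "k = 2 * k'" "l = 2 * l'" | k' l' where "k = 2 * k' + 1" "l = 2 * l'"
    | k' l' where "k = 2 * k'" "l = 2 * l' + 1" | k' l' where "k = 2 * k' + 1" "l = 2 * l' + 1"
    by (metis evenE oddE)
  then show ?case
  proof cases
    case 1
    then have b: "k' \<le> 2 ^ n" "l' \<le> 2 ^ n" using Suc.prems by auto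
    show ?thesis unfolding 1 lev ev IH[OF b] by (simp add: schauder_grid_coarse min_mult_distrib_left[symmetric] min_def)
  next
    case 2
    show ?thesis using mixed[of k' l'] Suc.prems unfolding 2 by blast
  next
    case 3
    show ?thesis using mixed[of l' k'] Suc.prems unfolding 3 by (simp add: mult.commute min.commute)
  next
    case 4
    have b: "k' \<le> 2 ^ n" "Suc k' \<le> 2 ^ n" "l' \<le> 2 ^ n" "Suc l' \<le> 2 ^ n" "k' < 2 ^ n" using Suc.prems 4 by auto
    have "(\<Sum>j<2 ^ n. schauder n j (real (2 * k' + 1) / 2 ^ Suc n) * schauder n j (real (2 * l' + 1) / 2 ^ Suc n))
      = (\<Sum>j<2 ^ n. if j = k' then (if k' = l' then 1 / (4 * 2 ^ n) else 0) else 0)"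
      unfolding schauder_odd by (intro sum.cong refl) (auto simp: real_sqrt_mult_self)
    also have "\<dots> = (if k' = l' then 1 / (4 * 2 ^ n) else 0)" using b by simp
    finally have s: "(\<Sum>j<2 ^ n. schauder n j (real (2 * k' + 1) / 2 ^ Suc n) * schauder n j (real (2 * l' + 1) / 2 ^ Suc n))
      = (if k' = l' then 1 / (4 * 2 ^ n) else 0)" .
    have odd': "(\<Sum>i<2 ^ n. h i * brown_coeff (real (2 * j + 1) / 2 ^ Suc n) i)
     = ((\<Sum>i<2 ^ n. h i * ?c j i) + (\<Sum>i<2 ^ n. h i * ?c (Suc j) i)) / 2" for j h
      using odd[of j h] by (simp only: mult.commute)
    \<comment> \<open>On the diagonal the four minima add up to 1 too little. After scaling, this is
      the square \<open>1 / (4 * 2 ^ n)\<close> of the peak of the new tent.\<close>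
    have e: "real (min (2 * k' + 1) (2 * l' + 1)) = (real (min k' l') + real (min k' (Suc l')) + (real (min (Suc k') l') + real (min (Suc k') (Suc l'))) + (if k' = l' then 1 else 0)) / 2"
      by (auto simp: min_def)
    have alg: "((A / c + B / c) / 2 + (C / c + D / c) / 2) / 2 + (if P then 1 / (4 * c) else 0)
        = ((A + B + (C + D) + (if P then 1 else 0)) / 2) / d" if "c > 0" "d = 2 * c" for A B C D c d :: real and P
      using that by (cases P) (simp_all add: field_simps)
    show ?thesis unfolding 4 lev s odd odd' IH[OF b(1,3)] IH[OF b(1,4)] IH[OF b(2,3)] IH[OF b(2,4)] e
      by (rule alg) simp_all
  qed
qed

section \<open>Independent standard normal coordinates\<close>

abbreviation gauss_seq :: "(nat \<Rightarrow> real) measure" where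
  "gauss_seq \<equiv> Pi\<^sub>M UNIV (\<lambda>_. std_normal_distribution)"

interpretation std_normal: prob_space std_normal_distribution
  using real_dist_normal_dist by (simp add: real_distribution_def)

interpretation gauss: prob_space gauss_seq
  by (rule prob_space_PiM) (rule std_normal.prob_space_axioms)

lemma gauss_component_measurable[measurable]: "(\<lambda>\<omega>. \<omega> i) \<in> borel_measurable gauss_seq"
proof -
  have "(\<lambda>\<omega>. \<omega> i) \<in> gauss_seq \<rightarrow>\<^sub>M std_normal_distribution" by (rule measurable_component_singleton) simp
  then show ?thesis by simp
qed

lemma gauss_PiM_component: "distr gauss_seq std_normal_distribution (\<lambda>\<omega>. \<omega> i) = std_normal_distribution"
proof -
  interpret product_prob_space "\<lambda>_. std_normal_distribution" "UNIV :: nat set" by unfold_locales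
  show ?thesis by (rule PiM_component) simp
qed

lemma gauss_component_distr: "distr gauss_seq borel (\<lambda>\<omega>. \<omega> i) = std_normal_distribution"
  using gauss_PiM_component[of i] by (metis (no_types, lifting) distr_cong real_distribution.events_eq_borel real_dist_normal_dist)

lemma gauss_indep: "gauss.indep_vars (\<lambda>_. borel) (\<lambda>i \<omega>. \<omega> i) UNIV"
proof -
  have "gauss.indep_vars (\<lambda>_. std_normal_distribution) (\<lambda>i \<omega>. \<omega> i) UNIV"
    by (subst gauss.indep_vars_iff_distr_eq_PiM)
      (auto simp: restrict_UNIV gauss_PiM_component distr_id2 intro!: PiM_cong measurable_component_singleton)
  then show ?thesis
    unfolding gauss.indep_vars_def by (simp add: real_distribution.events_eq_borel[OF real_dist_normal_dist])
qed

lemma gauss_char_component: "(CLINT \<omega>|gauss_seq. iexp (b * \<omega> i)) = exp (- (b\<^sup>2 / 2))"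
proof -
  have "(CLINT \<omega>|gauss_seq. iexp (b * \<omega> i)) = char (distr gauss_seq borel (\<lambda>\<omega>. \<omega> i)) b"
    unfolding char_def by (subst integral_distr) auto
  then show ?thesis
    by (simp add: gauss_component_distr char_std_normal_distribution)
qed

lemma gauss_char_sum:
  "(CLINT \<omega>|gauss_seq. iexp (\<Sum>i<m. b i * \<omega> i)) = exp (- ((\<Sum>i<m. (b i)\<^sup>2) / 2))"
proof -
  have ind: "gauss.indep_vars (\<lambda>_. borel) (\<lambda>i \<omega>. b i * \<omega> i) {..<m}"
    using gauss.indep_vars_compose2[OF gauss.indep_vars_subset[OF gauss_indep], of "{..<m}" "\<lambda>i x. b i * x" "\<lambda>_. borel"] by simp
  have "(CLINT \<omega>|gauss_seq. iexp (\<Sum>i<m. b i * \<omega> i)) = char (distr gauss_seq borel (\<lambda>\<omega>. \<Sum>i<m. b i * \<omega> i)) 1"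
    unfolding char_def by (subst integral_distr) auto
  also have "\<dots> = (\<Prod>i<m. char (distr gauss_seq borel (\<lambda>\<omega>. b i * \<omega> i)) 1)"
    by (rule gauss.char_distr_sum[OF ind])
  also have "\<dots> = (\<Prod>i<m. complex_of_real (exp (- ((b i)\<^sup>2 / 2))))"
  proof (intro prod.cong refl)
    fix i
    have "char (distr gauss_seq borel (\<lambda>\<omega>. b i * \<omega> i)) 1 = (CLINT \<omega>|gauss_seq. iexp (b i * \<omega> i))"
      unfolding char_def by (subst integral_distr) auto
    then show "char (distr gauss_seq borel (\<lambda>\<omega>. b i * \<omega> i)) 1 = exp (- ((b i)\<^sup>2 / 2))"
      by (simp only: gauss_char_component)
  qed
  also have "\<dots> = exp (- ((\<Sum>i<m. (b i)\<^sup>2) / 2))"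
  proof -
    have "(\<Sum>i<m. - ((b i)\<^sup>2 / 2)) = - ((\<Sum>i<m. (b i)\<^sup>2) / 2)"
      by (simp add: sum_negf sum_divide_distrib)
    then show ?thesis by (metis exp_sum finite_lessThan of_real_prod)
  qed
  finally show ?thesis .
qed

lemma gauss_fourth_moment:
  "integrable gauss_seq (\<lambda>\<omega>. (\<omega> i) ^ 4)" "integral\<^sup>L gauss_seq (\<lambda>\<omega>. (\<omega> i) ^ 4) = 3"
proof -
  have m: "(\<lambda>\<omega>. \<omega> i) \<in> gauss_seq \<rightarrow>\<^sub>M borel" by measurable
  have "integrable (distr gauss_seq borel (\<lambda>\<omega>. \<omega> i)) (\<lambda>x. x ^ 4)"
    unfolding gauss_component_distr by (rule integrable_std_normal_distribution_moment)
  then show "integrable gauss_seq (\<lambda>\<omega>. (\<omega> i) ^ 4)" by (subst (asm) integrable_distr_eq[OF m]) auto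
  have "integral\<^sup>L (distr gauss_seq borel (\<lambda>\<omega>. \<omega> i)) (\<lambda>x. x ^ 4) = 3"
    unfolding gauss_component_distr using std_normal_distribution_even_moments(1)[of 2]
    by (simp add: fact_numeral)
  then show "integral\<^sup>L gauss_seq (\<lambda>\<omega>. (\<omega> i) ^ 4) = 3" by (subst (asm) integral_distr[OF m]) auto
qed

section \<open>Uniform convergence of the Schauder series\<close>

definition brown_level :: "nat \<Rightarrow> real \<Rightarrow> (nat \<Rightarrow> real) \<Rightarrow> real" where
  "brown_level n t \<omega> = (\<Sum>j<2 ^ n. \<omega> (2 ^ n + j) * schauder n j t)"

text \<open>The fourth root of 2. Level \<open>n\<close> has \<open>q4 ^ (4 * n)\<close> Gaussian
  coefficients and tents of height \<open>1 / (2 * q4 ^ (2 * n))\<close>. Comparing the coefficients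
  with the threshold \<open>q4 ^ n\<close> through fourth moments gives a level bound of mean
  \<open>2 * (1 / q4) ^ n\<close>, which is summable.\<close>

definition q4 :: real where "q4 = sqrt (sqrt 2)"

definition brown_bound :: "nat \<Rightarrow> (nat \<Rightarrow> real) \<Rightarrow> real" where
  "brown_bound n \<omega> = (q4 ^ n + (\<Sum>j<2 ^ n. (\<omega> (2 ^ n + j)) ^ 4) / q4 ^ (3 * n)) / (2 * q4 ^ (2 * n))"

lemma q4: "q4 > 1" "2 ^ n = q4 ^ (4 * n)" "sqrt (2 ^ n) = q4 ^ (2 * n)"
proof -
  show g: "q4 > 1" by (simp add: q4_def)
  have "q4\<^sup>2 = sqrt 2" by (simp add: q4_def)
  moreover have "q4 ^ 4 = (q4\<^sup>2)\<^sup>2" by (simp flip: power_mult)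
  ultimately have "q4 ^ 4 = 2" by simp
  then show a: "2 ^ n = q4 ^ (4 * n)" by (simp add: power_mult)
  have "q4 ^ (4 * n) = (q4 ^ (2 * n))\<^sup>2" by (simp flip: power_mult add: mult.commute)
  then show "sqrt (2 ^ n) = q4 ^ (2 * n)" unfolding a using g by simp
qed

lemma abs_le_fourth_power:
  fixes x a :: real assumes a: "a > 0" shows "\<bar>x\<bar> \<le> a + x ^ 4 / a ^ 3"
proof (cases "\<bar>x\<bar> \<le> a")
  case True
  have "0 \<le> x ^ 4 / a ^ 3" using a by simp
  then show ?thesis using True by linarith
next
  case False
  have "\<bar>x\<bar> * a ^ 3 \<le> \<bar>x\<bar> * \<bar>x\<bar> ^ 3" using False a by (intro mult_left_mono power_mono) auto
  also have "\<dots> = x ^ 4" by (simp add: power_abs[symmetric] power4_eq_xxxx power3_eq_cube)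
  finally have "\<bar>x\<bar> \<le> x ^ 4 / a ^ 3" using a by (simp add: field_simps)
  then show ?thesis using a by linarith
qed

text \<open>The supports of the tents of one level do not overlap.\<close>

lemma sum_hat_le:
  assumes c: "\<And>j. j < m \<Longrightarrow> \<bar>w j\<bar> \<le> c" and c0: "0 \<le> c"
  shows "\<bar>\<Sum>j<m. w j * hat (x - (2 * real j + 1))\<bar> \<le> c"
proof (cases "\<exists>j<m. hat (x - (2 * real j + 1)) \<noteq> 0")
  case True
  then obtain i where i: "i < m" "hat (x - (2 * real i + 1)) \<noteq> 0" by blast
  have i1: "\<bar>x - (2 * real i + 1)\<bar> < 1" using i(2) by (auto simp: hat_def max_def split: if_splits)
  have z: "hat (x - (2 * real j + 1)) = 0" if "j \<noteq> i" for j
  proof -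
    have "\<bar>real j - real i\<bar> \<ge> 1" using that by linarith
    then have "\<bar>x - (2 * real j + 1)\<bar> \<ge> 1" using i1 by linarith
    then show ?thesis by (simp add: hat_def)
  qed
  have "(\<Sum>j<m. w j * hat (x - (2 * real j + 1))) = (\<Sum>j<m. if j = i then w i * hat (x - (2 * real i + 1)) else 0)"
    using z by (intro sum.cong) auto
  also have "\<dots> = w i * hat (x - (2 * real i + 1))" using i by simp
  finally have "\<bar>\<Sum>j<m. w j * hat (x - (2 * real j + 1))\<bar> = \<bar>w i\<bar> * hat (x - (2 * real i + 1))"
    by (simp add: abs_mult hat_nonneg)
  also have "\<dots> \<le> c * 1" using c[OF i(1)] c0 by (intro mult_mono) (auto simp: hat_nonneg hat_le_1)
  finally show ?thesis by simp
next
  case False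
  then have "(\<Sum>j<m. w j * hat (x - (2 * real j + 1))) = 0" by (intro sum.neutral) auto
  then show ?thesis using c0 by simp
qed

lemma brown_level_le: "\<bar>brown_level n t \<omega>\<bar> \<le> brown_bound n \<omega>"
proof -
  let ?S = "\<Sum>j<2 ^ n. (\<omega> (2 ^ n + j)) ^ 4"
  let ?c = "q4 ^ n + ?S / q4 ^ (3 * n)"
  have q: "q4 ^ n > 0" "q4 ^ (2 * n) > 0" using q4(1) by simp_all
  have S0: "0 \<le> ?S" by (intro sum_nonneg) auto
  have c0: "0 \<le> ?c" using q4(1) S0 by (intro add_nonneg_nonneg divide_nonneg_nonneg) auto
  have w: "\<bar>\<omega> (2 ^ n + j)\<bar> \<le> ?c" if j: "j < 2 ^ n" for j
  proof -
    have "\<bar>\<omega> (2 ^ n + j)\<bar> \<le> q4 ^ n + (\<omega> (2 ^ n + j)) ^ 4 / (q4 ^ n) ^ 3" by (rule abs_le_fourth_power[OF q(1)])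
    also have "\<dots> = q4 ^ n + (\<omega> (2 ^ n + j)) ^ 4 / q4 ^ (3 * n)" by (simp add: power_mult[symmetric] mult.commute)
    also have "\<dots> \<le> ?c"
      using j q4(1) by (intro add_left_mono divide_right_mono member_le_sum[where f="\<lambda>j. (\<omega> (2 ^ n + j)) ^ 4"]) auto
    finally show ?thesis .
  qed
  have "brown_level n t \<omega> = (\<Sum>j<2 ^ n. \<omega> (2 ^ n + j) * hat (2 ^ Suc n * t - (2 * real j + 1))) / (2 * q4 ^ (2 * n))"
    unfolding brown_level_def schauder_def q4(3)[symmetric] by (simp add: sum_divide_distrib)
  also have "\<bar>\<dots>\<bar> \<le> ?c / (2 * q4 ^ (2 * n))"
    unfolding abs_divide using sum_hat_le[of "2 ^ n" "\<lambda>j. \<omega> (2 ^ n + j)" ?c "2 ^ Suc n * t", OF w c0] q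
    by (simp add: divide_right_mono)
  finally show ?thesis by (simp add: brown_bound_def)
qed

lemma brown_bound_nonneg: "0 \<le> brown_bound n \<omega>"
  using brown_level_le[of n 0 \<omega>] by linarith

lemma brown_bound_measurable[measurable]: "brown_bound n \<in> borel_measurable gauss_seq"
  unfolding brown_bound_def by measurable

lemma brown_level_measurable[measurable]: "brown_level n t \<in> borel_measurable gauss_seq"
  unfolding brown_level_def by measurable

lemma brown_bound_integral:
  "integrable gauss_seq (brown_bound n)" "integral\<^sup>L gauss_seq (brown_bound n) = 2 * (1 / q4) ^ n"
proof -
  have i: "integrable gauss_seq (\<lambda>\<omega>. \<Sum>j<2 ^ n. (\<omega> (2 ^ n + j)) ^ 4)"
    by (intro Bochner_Integration.integrable_sum gauss_fourth_moment)
  have s: "integral\<^sup>L gauss_seq (\<lambda>\<omega>. \<Sum>j<2 ^ n. (\<omega> (2 ^ n + j)) ^ 4) = 3 * q4 ^ (4 * n)"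
    by (subst Bochner_Integration.integral_sum) (auto simp: gauss_fourth_moment q4(2)[symmetric])
  have q: "q4 > 0" using q4(1) by simp
  show "integrable gauss_seq (brown_bound n)" unfolding brown_bound_def using i by auto
  have "integral\<^sup>L gauss_seq (brown_bound n) = (q4 ^ n + 3 * q4 ^ (4 * n) / q4 ^ (3 * n)) / (2 * q4 ^ (2 * n))"
    unfolding brown_bound_def using i by (simp add: s gauss.prob_space)
  also have "\<dots> = 2 * (1 / q4) ^ n"
  proof -
    have "q4 ^ (4 * n) = q4 ^ (3 * n) * q4 ^ n" "q4 ^ (2 * n) = q4 ^ n * q4 ^ n" by (simp_all add: mult_2 flip: power_add)
    then show ?thesis using q by (simp add: field_simps)
  qed
  finally show "integral\<^sup>L gauss_seq (brown_bound n) = 2 * (1 / q4) ^ n" .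
qed

text \<open>Stated in \<open>ennreal\<close>, where the series always has a measurable value and a
  finite expectation shows that it is finite almost surely.\<close>

definition brown_good :: "(nat \<Rightarrow> real) \<Rightarrow> bool" where
  "brown_good \<omega> \<longleftrightarrow> (\<Sum>n. ennreal (brown_bound n \<omega>)) \<noteq> \<infinity>"

lemma brown_good_summable: "brown_good \<omega> \<Longrightarrow> summable (\<lambda>n. brown_bound n \<omega>)"
  by (auto simp: brown_good_def intro!: summable_suminf_not_top brown_bound_nonneg)

lemma AE_brown_good: "AE \<omega> in gauss_seq. brown_good \<omega>"
proof -
  have sm: "summable (\<lambda>n. 2 * (1 / q4) ^ n)" using q4(1) by (intro summable_mult summable_geometric) auto
  have "(\<integral>\<^sup>+\<omega>. (\<Sum>n. ennreal (brown_bound n \<omega>)) \<partial>gauss_seq) = (\<Sum>n. \<integral>\<^sup>+\<omega>. ennreal (brown_bound n \<omega>) \<partial>gauss_seq)"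
    by (rule nn_integral_suminf) measurable
  also have "\<dots> = (\<Sum>n. ennreal (2 * (1 / q4) ^ n))"
    by (simp add: nn_integral_eq_integral[OF brown_bound_integral(1)] brown_bound_nonneg brown_bound_integral(2))
  also have "\<dots> = ennreal (\<Sum>n. 2 * (1 / q4) ^ n)"
    using sm q4(1) by (intro suminf_ennreal2) auto
  finally have "(\<integral>\<^sup>+\<omega>. (\<Sum>n. ennreal (brown_bound n \<omega>)) \<partial>gauss_seq) \<noteq> \<infinity>" by simp
  then show ?thesis unfolding brown_good_def by (intro nn_integral_PInf_AE) auto
qed

text \<open>On the exceptional null set the path is set to 0, so that all paths are continuous and
  not only almost all.\<close>

definition brownian :: "real \<Rightarrow> (nat \<Rightarrow> real) \<Rightarrow> real" where
  "brownian t \<omega> = (if brown_good \<omega> then t * \<omega> 0 + (\<Sum>n. brown_level n t \<omega>) else 0)"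

lemma brownian_measurable[measurable]: "brownian t \<in> borel_measurable gauss_seq"
proof -
  have [measurable]: "Measurable.pred gauss_seq brown_good"
    unfolding brown_good_def by measurable
  have [measurable]: "(\<lambda>\<omega>. \<Sum>n. brown_level n t \<omega>) \<in> borel_measurable gauss_seq"
    by (rule borel_measurable_suminf) (rule brown_level_measurable)
  show ?thesis unfolding brownian_def by measurable
qed

lemma brownian_continuous: "continuous_on UNIV (\<lambda>t. brownian t \<omega>)"
proof (cases "brown_good \<omega>")
  case True
  have "uniform_limit UNIV (\<lambda>n t. \<Sum>i<n. brown_level i t \<omega>) (\<lambda>t. \<Sum>i. brown_level i t \<omega>) sequentially"
    using brown_level_le brown_good_summable[OF True] by (intro Weierstrass_m_test) auto
  moreover have "continuous_on UNIV (\<lambda>t. \<Sum>i<n. brown_level i t \<omega>)" for n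
    unfolding brown_level_def schauder_def hat_def by (intro continuous_intros) auto
  ultimately have "continuous_on UNIV (\<lambda>t. \<Sum>i. brown_level i t \<omega>)"
    by (intro uniform_limit_theorem[where F=sequentially]) auto
  then show ?thesis using True by (auto simp: brownian_def intro!: continuous_intros)
qed (simp add: brownian_def)

text \<open>Tents of level \<open>n\<close> or higher vanish at this point, so the series is a
  finite Gaussian sum and the joint law at dyadic times can be computed exactly.\<close>

lemma brownian_grid:
  assumes "brown_good \<omega>"
  shows "brownian (real k / 2 ^ n) \<omega> = (\<Sum>i<2 ^ n. brown_coeff (real k / 2 ^ n) i * \<omega> i)"
proof -
  let ?t = "real k / 2 ^ n"
  have z: "brown_level m ?t \<omega> = 0" if "m \<notin> {..<n}" for m
    using that by (simp add: brown_level_def schauder_grid_coarse)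
  have "(\<Sum>m. brown_level m ?t \<omega>) = (\<Sum>m<n. brown_level m ?t \<omega>)"
    by (rule suminf_finite) (use z in auto)
  moreover have "?t * \<omega> 0 + (\<Sum>m<l. brown_level m ?t \<omega>) = (\<Sum>i<2 ^ l. brown_coeff ?t i * \<omega> i)" for l
  proof (induction l)
    case 0 show ?case by (simp add: brown_coeff_def)
  next
    case (Suc l)
    then show ?case unfolding sum_levels
      by (simp add: brown_coeff_level brown_level_def mult.commute)
  qed
  ultimately show ?thesis using assms by (simp add: brownian_def)
qed

lemma brownian_char_grid:
  assumes k: "\<And>j. j < m \<Longrightarrow> k j \<le> 2 ^ n"
  shows "(CLINT \<omega>|gauss_seq. iexp (\<Sum>j<m. a j * brownian (real (k j) / 2 ^ n) \<omega>))
    = exp (- ((\<Sum>i<m. \<Sum>j<m. a i * a j * min (real (k i) / 2 ^ n) (real (k j) / 2 ^ n)) / 2))"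
proof -
  let ?c = "\<lambda>j i. brown_coeff (real (k j) / 2 ^ n) i"
  let ?b = "\<lambda>i. \<Sum>j<m. a j * ?c j i"
  have "(CLINT \<omega>|gauss_seq. iexp (\<Sum>j<m. a j * brownian (real (k j) / 2 ^ n) \<omega>))
      = (CLINT \<omega>|gauss_seq. iexp (\<Sum>i<2 ^ n. ?b i * \<omega> i))"
  proof (rule integral_cong_AE)
    show "AE \<omega> in gauss_seq. iexp (\<Sum>j<m. a j * brownian (real (k j) / 2 ^ n) \<omega>) = iexp (\<Sum>i<2 ^ n. ?b i * \<omega> i)"
      using AE_brown_good
    proof eventually_elim
      case (elim \<omega>)
      have "(\<Sum>j<m. a j * brownian (real (k j) / 2 ^ n) \<omega>) = (\<Sum>j<m. \<Sum>i<2 ^ n. a j * ?c j i * \<omega> i)"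
        using elim by (simp add: brownian_grid sum_distrib_left mult.assoc)
      also have "\<dots> = (\<Sum>i<2 ^ n. ?b i * \<omega> i)"
        by (subst sum.swap) (simp add: sum_distrib_right)
      finally show ?case by simp
    qed
  qed auto
  also have "\<dots> = exp (- ((\<Sum>i<2 ^ n. (?b i)\<^sup>2) / 2))" by (rule gauss_char_sum)
  also have "(\<Sum>i<2 ^ n. (?b i)\<^sup>2) = (\<Sum>i<2 ^ n. \<Sum>j<m. \<Sum>l<m. a j * a l * (?c j i * ?c l i))"
    by (simp add: power2_eq_square sum_product mult_ac)
  also have "\<dots> = (\<Sum>j<m. \<Sum>l<m. \<Sum>i<2 ^ n. a j * a l * (?c j i * ?c l i))"
    by (subst sum.swap, intro sum.cong refl, rule sum.swap)
  also have "\<dots> = (\<Sum>j<m. \<Sum>l<m. a j * a l * min (real (k j) / 2 ^ n) (real (k l) / 2 ^ n))"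
  proof (intro sum.cong refl)
    fix j l assume "j \<in> {..<m}" "l \<in> {..<m}"
    moreover have "real (min (k j) (k l)) / 2 ^ n = min (real (k j) / 2 ^ n) (real (k l) / 2 ^ n)"
      by (auto simp: min_def divide_simps)
    ultimately show "(\<Sum>i<2 ^ n. a j * a l * (?c j i * ?c l i)) = a j * a l * min (real (k j) / 2 ^ n) (real (k l) / 2 ^ n)"
      by (simp add: sum_distrib_left[symmetric] sum_brown_coeff_grid k del: of_nat_min)
  qed
  finally show ?thesis .
qed

theorem brownian_char:
  assumes ts: "\<And>j. j < m \<Longrightarrow> ts j \<in> {0..1}"
  shows "(CLINT \<omega>|gauss_seq. iexp (\<Sum>j<m. a j * brownian (ts j) \<omega>))
    = exp (- ((\<Sum>i<m. \<Sum>j<m. a i * a j * min (ts i) (ts j)) / 2))"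
proof -
  \<comment> \<open>\<open>d n t\<close> rounds \<open>t\<close> down to the grid of level
    \<open>n\<close>. Continuity of the paths and dominated convergence carry the formula from
    dyadic times to all of \<open>{0..1}\<close>.\<close>
  define d where "d = (\<lambda>(n::nat) (t::real). real (nat \<lfloor>2 ^ n * t\<rfloor>) / 2 ^ n)"
  have d: "(\<lambda>n. d n t) \<longlonglongrightarrow> t" if "t \<in> {0..1}" for t :: real
  proof (rule tendsto_sandwich[of "\<lambda>n. t - (1/2) ^ n" _ _ "\<lambda>_. t"])
    show "(\<lambda>n. t - (1/2) ^ n) \<longlonglongrightarrow> t"
      using tendsto_diff[OF tendsto_const LIMSEQ_realpow_zero[of "1/2"], of t] by simp
    have b: "t - (1/2) ^ n \<le> d n t \<and> d n t \<le> t" for n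
    proof -
      have "0 \<le> 2 ^ n * t" using that by simp
      then have "d n t = of_int \<lfloor>2 ^ n * t\<rfloor> / 2 ^ n" by (simp add: d_def)
      moreover have "of_int \<lfloor>2 ^ n * t\<rfloor> \<le> 2 ^ n * t" "2 ^ n * t - 1 \<le> of_int \<lfloor>2 ^ n * t\<rfloor>" by linarith+
      ultimately show ?thesis by (simp add: divide_le_eq le_divide_eq left_diff_distrib right_diff_distrib power_divide mult.commute)
    qed
    show "\<forall>\<^sub>F n in sequentially. t - (1/2) ^ n \<le> d n t" "\<forall>\<^sub>F n in sequentially. d n t \<le> t" using b by auto
  qed auto
  have kd: "nat \<lfloor>2 ^ n * t\<rfloor> \<le> 2 ^ n" if "t \<in> {0..1}" for t :: real and n :: nat
  proof -
    have "2 ^ n * t \<le> 2 ^ n" using that by simp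
    then have "\<lfloor>2 ^ n * t\<rfloor> \<le> 2 ^ n" by (metis floor_mono floor_of_int of_int_numeral of_int_power)
    then show ?thesis by (simp add: nat_le_iff)
  qed
  have "(\<lambda>n. CLINT \<omega>|gauss_seq. iexp (\<Sum>j<m. a j * brownian (d n (ts j)) \<omega>))
     \<longlonglongrightarrow> (CLINT \<omega>|gauss_seq. iexp (\<Sum>j<m. a j * brownian (ts j) \<omega>))"
  proof (rule integral_dominated_convergence[where w="\<lambda>_. 1"])
    show "AE \<omega> in gauss_seq. (\<lambda>n. iexp (\<Sum>j<m. a j * brownian (d n (ts j)) \<omega>)) \<longlonglongrightarrow> iexp (\<Sum>j<m. a j * brownian (ts j) \<omega>)"
    proof (intro AE_I2 isCont_tendsto_compose[OF isCont_iexp] tendsto_sum tendsto_mult tendsto_const)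
      fix \<omega> j assume "j \<in> {..<m}"
      then have "(\<lambda>n. d n (ts j)) \<longlonglongrightarrow> ts j" using d ts by blast
      then show "(\<lambda>n. brownian (d n (ts j)) \<omega>) \<longlonglongrightarrow> brownian (ts j) \<omega>"
        using brownian_continuous[of \<omega>] by (intro isCont_tendsto_compose[of _ "\<lambda>t. brownian t \<omega>"]) (auto simp: continuous_on_eq_continuous_at)
    qed
  qed auto
  moreover have "(CLINT \<omega>|gauss_seq. iexp (\<Sum>j<m. a j * brownian (d n (ts j)) \<omega>))
     = exp (- ((\<Sum>i<m. \<Sum>j<m. a i * a j * min (d n (ts i)) (d n (ts j))) / 2))" for n
    unfolding d_def by (rule brownian_char_grid) (use kd ts in auto)
  moreover have "(\<lambda>n. complex_of_real (exp (- ((\<Sum>i<m. \<Sum>j<m. a i * a j * min (d n (ts i)) (d n (ts j))) / 2))))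
     \<longlonglongrightarrow> complex_of_real (exp (- ((\<Sum>i<m. \<Sum>j<m. a i * a j * min (ts i) (ts j)) / 2)))"
    using d ts by (intro tendsto_intros) auto
  ultimately show ?thesis using LIMSEQ_unique by simp
qed

section \<open>A central limit theorem for triangular arrays\<close>

lemma exp_minus_le_quadratic:
  fixes a :: real assumes a: "a \<ge> 0" shows "\<bar>(1 - a) - exp (- a)\<bar> \<le> a\<^sup>2"
proof -
  have "1 - a \<le> exp (- a)" using exp_ge_add_one_self[of "-a"] by simp
  moreover have "exp (- a) \<le> 1 - a + a\<^sup>2"
  proof -
    have "1 \<le> (1 - a + a\<^sup>2) * (1 + a)" using a by (simp add: algebra_simps power2_eq_square)
    also have "\<dots> \<le> (1 - a + a\<^sup>2) * exp a"
    proof (intro mult_left_mono exp_ge_add_one_self)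
      have "0 \<le> (1 - a/2)\<^sup>2 + 3/4 * a\<^sup>2" by simp
      also have "\<dots> = 1 - a + a\<^sup>2" by (simp add: power2_eq_square algebra_simps)
      finally show "0 \<le> 1 - a + a\<^sup>2" .
    qed
    finally show ?thesis by (simp add: exp_minus field_simps)
  qed
  ultimately show ?thesis by (simp add: abs_le_iff)
qed

text \<open>Interpolation: with \<open>y = t * \<bar>x\<bar>\<close> the minimum is at most
  \<open>6 * min 1 y * x\<^sup>2\<close>, and \<open>min 1 y \<le> y powr (p - 2)\<close> because
  \<open>p - 2\<close> lies between 0 and 1. This converts the Taylor remainder of a characteristic
  function into a moment of order \<open>p\<close>.\<close>

lemma min_square_cube_le:
  fixes x p t :: real assumes p: "2 < p" "p \<le> 3" and t: "t > 0"
  shows "min (6 * x\<^sup>2) (t * \<bar>x\<bar> ^ 3) \<le> 6 * (t powr (p - 2) * \<bar>x\<bar> powr p)"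
proof (cases "x = 0")
  case False
  define y where "y = t * \<bar>x\<bar>"
  have y: "y > 0" using False t by (simp add: y_def)
  have e: "t powr (p - 2) * \<bar>x\<bar> powr p = y powr (p - 2) * x\<^sup>2"
  proof -
    have "\<bar>x\<bar> powr ((p - 2) + 2) = \<bar>x\<bar> powr (p - 2) * \<bar>x\<bar> powr 2" by (rule powr_add)
    moreover have "\<bar>x\<bar> powr 2 = x\<^sup>2" using False by (simp add: powr_realpow[of "\<bar>x\<bar>" 2, simplified])
    ultimately show ?thesis using t False by (simp add: y_def powr_mult)
  qed
  show ?thesis
  proof (cases "y \<le> 1")
    case True
    have "t * \<bar>x\<bar> ^ 3 = y powr 1 * x\<^sup>2" using y by (simp add: y_def power3_eq_cube power2_eq_square abs_mult_self_eq)
    also have "\<dots> \<le> y powr (p - 2) * x\<^sup>2" using y True p by (intro mult_right_mono powr_mono') auto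
    also have "\<dots> \<le> 6 * (y powr (p - 2) * x\<^sup>2)" by simp
    finally show ?thesis unfolding e by linarith
  next
    case False
    have "1 \<le> y powr (p - 2)" using False p by (intro ge_one_powr_ge_zero) auto
    then have "1 * x\<^sup>2 \<le> y powr (p - 2) * x\<^sup>2" by (intro mult_right_mono) auto
    then show ?thesis unfolding e by linarith
  qed
qed simp

text \<open>With \<open>a = v / (2 * N)\<close> the characteristic function is compared with
  \<open>1 - a\<close> and then with \<open>exp (- a)\<close>. Both bases have modulus at most 1, so
  taking \<open>N\<close>-th powers multiplies the error by at most \<open>N\<close>.\<close>

lemma char_power_error:
  assumes \<mu>: "real_distribution \<mu>" and N: "N > (0::nat)" and p: "2 < p" "p \<le> 3"
    and i1: "integrable \<mu> (\<lambda>x. x)" and i2: "integrable \<mu> (\<lambda>x. x\<^sup>2)" and ip: "integrable \<mu> (\<lambda>x. \<bar>x\<bar> powr p)"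
    and m0: "integral\<^sup>L \<mu> (\<lambda>x. x) = 0"
  defines "v \<equiv> integral\<^sup>L \<mu> (\<lambda>x. x\<^sup>2)"
  shows "cmod (char \<mu> (1 / sqrt (real N)) ^ N - of_real (exp (- v / 2)))
    \<le> real N powr (1 - p / 2) * integral\<^sup>L \<mu> (\<lambda>x. \<bar>x\<bar> powr p) + v\<^sup>2 / (4 * real N)"
proof -
  interpret real_distribution \<mu> by fact
  define t where "t = 1 / sqrt (real N)"
  define a where "a = v / (2 * real N)"
  have t: "t > 0" "t\<^sup>2 = 1 / real N" using N by (auto simp: t_def power_divide)
  have v0: "0 \<le> v" unfolding v_def by simp
  have a0: "0 \<le> a" using v0 N by (simp add: a_def)
  have ta: "t\<^sup>2 * v / 2 = a" using t by (simp add: a_def)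
  have im: "integrable \<mu> (\<lambda>x. min (6 * x\<^sup>2) (\<bar>t\<bar> * \<bar>x\<bar> ^ 3))"
    by (rule Bochner_Integration.integrable_bound[where f="\<lambda>x. 6 * x\<^sup>2"]) (use i2 in auto)
  have "cmod (char \<mu> t - of_real (1 - a)) \<le> (t\<^sup>2 / 6) * (LINT x|\<mu>. min (6 * x\<^sup>2) (\<bar>t\<bar> * \<bar>x\<bar> ^ 3))"
  proof -
    have "variance (\<lambda>x. x) = v" by (simp add: m0 v_def)
    from char_approx3[OF i1 m0 i2 this, of t] show ?thesis unfolding ta .
  qed
  also have "\<dots> \<le> (t\<^sup>2 / 6) * (LINT x|\<mu>. 6 * (t powr (p - 2) * \<bar>x\<bar> powr p))"
    using im ip min_square_cube_le[OF p t(1)] t(1) by (intro mult_left_mono integral_mono) auto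
  also have "\<dots> = t\<^sup>2 * t powr (p - 2) * (LINT x|\<mu>. \<bar>x\<bar> powr p)" using ip by simp
  finally have 1: "cmod (char \<mu> t - of_real (1 - a)) \<le> t\<^sup>2 * t powr (p - 2) * (LINT x|\<mu>. \<bar>x\<bar> powr p)" .
  have 2: "cmod (of_real (1 - a) - of_real (exp (- a))) \<le> a\<^sup>2"
    using exp_minus_le_quadratic[OF a0] by (metis norm_of_real of_real_diff)
  have "of_real (exp (- v / 2)) = (of_real (exp (- a)) :: complex) ^ N"
    using N by (simp add: a_def of_real_power[symmetric] exp_of_nat_mult[symmetric] del: of_real_power)
  then have "cmod (char \<mu> t ^ N - of_real (exp (- v / 2))) = cmod (char \<mu> t ^ N - of_real (exp (- a)) ^ N)" by simp
  also have "\<dots> \<le> real N * cmod (char \<mu> t - of_real (exp (- a)))"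
    using a0 by (intro norm_power_diff cmod_char_le_1) auto
  also have "\<dots> \<le> real N * (t\<^sup>2 * t powr (p - 2) * (LINT x|\<mu>. \<bar>x\<bar> powr p) + a\<^sup>2)"
    using norm_triangle_ineq[of "char \<mu> t - of_real (1 - a)" "of_real (1 - a) - of_real (exp (- a))"] 1 2
    by (intro mult_left_mono) (simp_all add: algebra_simps)
  also have "\<dots> = t powr (p - 2) * (LINT x|\<mu>. \<bar>x\<bar> powr p) + v\<^sup>2 / (4 * real N)"
    using N unfolding t(2) a_def by (simp add: field_simps power2_eq_square)
  also have "t powr (p - 2) = real N powr (1 - p / 2)"
  proof -
    have "t = real N powr (- 1 / 2)" using N by (simp add: t_def powr_minus_divide powr_half_sqrt)
    then show ?thesis by (simp add: powr_powr diff_divide_distrib)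
  qed
  finally show ?thesis by (simp add: t_def)
qed

text \<open>The common law may change from row to row, as it does for particles observed at time
  \<open>s N\<close>; the last assumption is Lyapunov's condition with exponent
  \<open>p\<close>.\<close>

theorem clt_triangular:
  fixes Y :: "nat \<Rightarrow> nat \<Rightarrow> 'a \<Rightarrow> real"
  assumes M: "prob_space M" and p: "2 < p" "p \<le> 3"
    and ind: "\<And>N. prob_space.indep_vars M (\<lambda>_. borel) (Y N) {1..N}"
    and dis: "\<And>N i. i \<in> {1..N} \<Longrightarrow> distr M borel (Y N i) = \<mu> N"
    and \<mu>: "\<And>N. real_distribution (\<mu> N)"
    and i1: "\<And>N. integrable (\<mu> N) (\<lambda>x. x)" and i2: "\<And>N. integrable (\<mu> N) (\<lambda>x. x\<^sup>2)"
    and ip: "\<And>N. integrable (\<mu> N) (\<lambda>x. \<bar>x\<bar> powr p)"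
    and m0: "\<And>N. integral\<^sup>L (\<mu> N) (\<lambda>x. x) = 0"
    and var: "(\<lambda>N. integral\<^sup>L (\<mu> N) (\<lambda>x. x\<^sup>2)) \<longlonglongrightarrow> v"
    and lyap: "(\<lambda>N. real N powr (1 - p / 2) * integral\<^sup>L (\<mu> N) (\<lambda>x. \<bar>x\<bar> powr p)) \<longlonglongrightarrow> 0"
  shows "(\<lambda>N. CLINT \<omega>|M. iexp ((\<Sum>i\<in>{1..N}. Y N i \<omega>) / sqrt (real N))) \<longlonglongrightarrow> exp (- v / 2)"
proof -
  interpret prob_space M by fact
  define w where "w = (\<lambda>N. integral\<^sup>L (\<mu> N) (\<lambda>x. x\<^sup>2))"
  have eq: "(CLINT \<omega>|M. iexp ((\<Sum>i\<in>{1..N}. Y N i \<omega>) / sqrt (real N))) = char (\<mu> N) (1 / sqrt (real N)) ^ N" for N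
  proof -
    have rv: "Y N i \<in> borel_measurable M" if "i \<in> {1..N}" for i
      using ind[of N] that unfolding indep_vars_def by blast
    have "(CLINT \<omega>|M. iexp ((\<Sum>i\<in>{1..N}. Y N i \<omega>) / sqrt (real N)))
       = char (distr M borel (\<lambda>\<omega>. \<Sum>i\<in>{1..N}. Y N i \<omega>)) (1 / sqrt (real N))"
      unfolding char_def using rv by (subst integral_distr) (auto intro!: borel_measurable_sum)
    also have "\<dots> = (\<Prod>i\<in>{1..N}. char (distr M borel (Y N i)) (1 / sqrt (real N)))"
      by (rule char_distr_sum[OF ind])
    also have "\<dots> = (\<Prod>i\<in>{1..N}. char (\<mu> N) (1 / sqrt (real N)))"
      by (intro prod.cong refl) (simp only: dis)
    also have "\<dots> = char (\<mu> N) (1 / sqrt (real N)) ^ N" by simp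
    finally show ?thesis .
  qed
  have "(\<lambda>N. char (\<mu> N) (1 / sqrt (real N)) ^ N - of_real (exp (- w N / 2))) \<longlonglongrightarrow> 0"
  proof (rule Lim_null_comparison)
    show "eventually (\<lambda>N. cmod (char (\<mu> N) (1 / sqrt (real N)) ^ N - of_real (exp (- w N / 2)))
      \<le> real N powr (1 - p / 2) * integral\<^sup>L (\<mu> N) (\<lambda>x. \<bar>x\<bar> powr p) + (w N)\<^sup>2 / (4 * real N)) sequentially"
      using eventually_gt_at_top[of 0] unfolding w_def
      by eventually_elim (rule char_power_error[OF \<mu> _ p i1 i2 ip m0])
    have "(\<lambda>N. (w N)\<^sup>2 / 4 * (1 / real N)) \<longlonglongrightarrow> v\<^sup>2 / 4 * 0"
      using var unfolding w_def by (intro tendsto_intros lim_1_over_n) auto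
    then have "(\<lambda>N. (w N)\<^sup>2 / (4 * real N)) \<longlonglongrightarrow> 0" by simp
    from tendsto_add[OF lyap this]
    show "(\<lambda>N. real N powr (1 - p / 2) * integral\<^sup>L (\<mu> N) (\<lambda>x. \<bar>x\<bar> powr p) + (w N)\<^sup>2 / (4 * real N)) \<longlonglongrightarrow> 0" by simp
  qed
  moreover have "(\<lambda>N. of_real (exp (- w N / 2))) \<longlonglongrightarrow> (of_real (exp (- v / 2)) :: complex)"
    using var unfolding w_def by (intro tendsto_intros) auto
  ultimately have "(\<lambda>N. (char (\<mu> N) (1 / sqrt (real N)) ^ N - of_real (exp (- w N / 2))) + of_real (exp (- w N / 2))) \<longlonglongrightarrow> 0 + of_real (exp (- v / 2))"
    by (rule tendsto_add)
  then show ?thesis unfolding eq by simp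
qed

section \<open>Exponential moments of Levy processes\<close>

lemma levy_prob_space: "levy_process M \<xi> \<Longrightarrow> prob_space M"
  and levy_measurable: "levy_process M \<xi> \<Longrightarrow> t \<ge> 0 \<Longrightarrow> \<xi> t \<in> borel_measurable M"
  and levy_zero: "levy_process M \<xi> \<Longrightarrow> \<omega> \<in> space M \<Longrightarrow> \<xi> 0 \<omega> = 0"
  and levy_cadlag: "levy_process M \<xi> \<Longrightarrow> \<omega> \<in> space M \<Longrightarrow> cadlag_halfline (\<lambda>t. \<xi> t \<omega>)"
  and levy_stationary: "levy_process M \<xi> \<Longrightarrow> 0 \<le> s \<Longrightarrow> 0 \<le> t \<Longrightarrow>
        distr M borel (\<lambda>\<omega>. \<xi> (s + t) \<omega> - \<xi> s \<omega>) = distr M borel (\<xi> t)"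
  and levy_indep_increments: "levy_process M \<xi> \<Longrightarrow> sorted_wrt (<) ts \<Longrightarrow> \<forall>t\<in>set ts. 0 \<le> t \<Longrightarrow>
        prob_space.indep_vars M (\<lambda>_. borel)
          (\<lambda>i \<omega>. \<xi> (ts ! Suc i) \<omega> - \<xi> (ts ! i) \<omega>) {..<length ts - 1}"
  unfolding levy_process_def by blast+

text \<open>Random variables are total functions, but \<open>\<xi> 0 = 0\<close> is known only on
  \<open>space M\<close>; this bridges the gap when a value of the process is rebuilt from
  increments.\<close>

lemma (in prob_space) indep_var_cong_space:
  assumes "indep_var S X T Y" "\<And>\<omega>. X \<omega> = X' \<omega>" "\<And>\<omega>. \<omega> \<in> space M \<Longrightarrow> Y \<omega> = Y' \<omega>"
  shows "indep_var S X' T Y'"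
proof -
  have "X = X'" using assms(2) by (rule ext)
  moreover have "Y \<in> M \<rightarrow>\<^sub>M T \<longleftrightarrow> Y' \<in> M \<rightarrow>\<^sub>M T" using assms(3) by (rule measurable_cong)
  moreover have "distr M T Y = distr M T Y'" using assms(3) by (intro distr_cong) auto
  moreover have "distr M (S \<Otimes>\<^sub>M T) (\<lambda>x. (X x, Y x)) = distr M (S \<Otimes>\<^sub>M T) (\<lambda>x. (X x, Y' x))"
    using assms(3) by (intro distr_cong) auto
  ultimately show ?thesis using assms(1) unfolding indep_var_distribution_eq by simp
qed

text \<open>Prefixing time 0 makes each \<open>\<xi> (r j)\<close> a partial sum of increments
  before \<open>r l\<close>, hence independent of the next increment. \<open>indep_var\<close> wants
  both variables of the same type, so the single increment is packed as a constant sequence.\<close>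

lemma levy_indep_history:
  fixes r :: "nat \<Rightarrow> real"
  assumes L: "levy_process M \<xi>" and r0: "0 < r 0" and r: "\<And>i. i < l \<Longrightarrow> r i < r (Suc i)" and R: "r l < R"
  shows "prob_space.indep_var M borel (\<lambda>\<omega> j::nat. \<xi> R \<omega> - \<xi> (r l) \<omega>)
    borel (\<lambda>\<omega> j. if j \<le> l then \<xi> (r j) \<omega> else 0)"
proof -
  interpret prob_space M using L by (rule levy_prob_space)
  define ts where "ts = 0 # map r [0..<Suc l] @ [R]"
  have len: "length ts = l + 3" by (simp add: ts_def)
  have ts0: "ts ! 0 = 0" by (simp add: ts_def)
  have tsj: "ts ! Suc j = r j" if "j \<le> l" for j
    using that by (simp add: ts_def nth_append del: upt_Suc)
  have tsR: "ts ! Suc (Suc l) = R" by (simp add: ts_def nth_append del: upt_Suc)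
  have "sorted_wrt (<) ts"
  proof (subst sorted_wrt_iff_nth_Suc_transp)
    show "transp ((<) :: real \<Rightarrow> _)" by (auto simp: transp_def)
    show "\<forall>i. Suc i < length ts \<longrightarrow> ts ! i < ts ! Suc i"
    proof (intro allI impI)
      fix i assume i: "Suc i < length ts"
      have "i = 0 \<or> (\<exists>j<l. i = Suc j) \<or> i = Suc l" using i len by (cases i) auto
      then consider "i = 0" | j where "i = Suc j" "j < l" | "i = Suc l" by blast
      then show "ts ! i < ts ! Suc i"
      proof cases
        case 1 then show ?thesis using ts0 tsj[of 0] r0 by simp
      next
        case 2 then show ?thesis using tsj[of j] tsj[of "Suc j"] r[of j] by simp
      next
        case 3 then show ?thesis using tsj[of l] tsR R by simp
      qed
    qed
  qed
  moreover have pos: "0 < r j" if "j \<le> l" for j using that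
  proof (induction j)
    case (Suc j) then show ?case using r[of j] by simp
  qed (rule r0)
  have "\<forall>t\<in>set ts. 0 \<le> t" using pos R less_trans[OF pos[of l] R] by (auto simp: ts_def less_imp_le)
  ultimately have ind: "indep_vars (\<lambda>_. borel) (\<lambda>i \<omega>. \<xi> (ts ! Suc i) \<omega> - \<xi> (ts ! i) \<omega>) {..<length ts - 1}"
    by (rule levy_indep_increments[OF L])
  define X where "X = (\<lambda>i \<omega>. \<xi> (ts ! Suc i) \<omega> - \<xi> (ts ! i) \<omega>)"
  have ind: "indep_vars (\<lambda>_. borel) X {..<l + 2}" using ind by (simp add: len X_def)
  have "indep_var (PiM {Suc l} (\<lambda>_. borel)) (\<lambda>\<omega>. restrict (\<lambda>i. X i \<omega>) {Suc l})
     (PiM {..<Suc l} (\<lambda>_. borel)) (\<lambda>\<omega>. restrict (\<lambda>i. X i \<omega>) {..<Suc l})"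
    by (rule indep_var_restrict[OF ind]) auto
  then have "indep_var borel ((\<lambda>x j. x (Suc l)) \<circ> (\<lambda>\<omega>. restrict (\<lambda>i. X i \<omega>) {Suc l}))
     borel ((\<lambda>x j. if j \<le> l then \<Sum>i<Suc j. x i else 0) \<circ> (\<lambda>\<omega>. restrict (\<lambda>i. X i \<omega>) {..<Suc l}))"
  proof (rule indep_var_compose)
    show "(\<lambda>x j. x (Suc l)) \<in> PiM {Suc l} (\<lambda>_. borel) \<rightarrow>\<^sub>M (borel :: (nat \<Rightarrow> real) measure)"
      by (intro measurable_coordinatewise_then_product measurable_component_singleton) simp
    show "(\<lambda>(x :: nat \<Rightarrow> real) j. if j \<le> l then \<Sum>i<Suc j. x i else 0) \<in> PiM {..<Suc l} (\<lambda>_. borel) \<rightarrow>\<^sub>M borel"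
    proof (rule measurable_coordinatewise_then_product)
      fix j show "(\<lambda>x :: nat \<Rightarrow> real. if j \<le> l then \<Sum>i<Suc j. x i else 0) \<in> borel_measurable (PiM {..<Suc l} (\<lambda>_. borel))"
      proof (cases "j \<le> l")
        case True
        then have "(\<lambda>x :: nat \<Rightarrow> real. \<Sum>i<Suc j. x i) \<in> borel_measurable (PiM {..<Suc l} (\<lambda>_. borel))"
          by (intro borel_measurable_sum measurable_component_singleton) auto
        then show ?thesis using True by simp
      qed simp
    qed
  qed
  moreover have "((\<lambda>x j. x (Suc l)) \<circ> (\<lambda>\<omega>. restrict (\<lambda>i. X i \<omega>) {Suc l})) \<omega> = (\<lambda>j. \<xi> R \<omega> - \<xi> (r l) \<omega>)" for \<omega>
    by (simp add: X_def tsR tsj)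
  moreover have "((\<lambda>x j. if j \<le> l then \<Sum>i<Suc j. x i else 0) \<circ> (\<lambda>\<omega>. restrict (\<lambda>i. X i \<omega>) {..<Suc l})) \<omega>
    = (\<lambda>j. if j \<le> l then \<xi> (r j) \<omega> else 0)" if "\<omega> \<in> space M" for \<omega>
  proof (rule ext)
    fix j
    note w = that
    have "(\<Sum>i<Suc j. X i \<omega>) = \<xi> (r j) \<omega>" if j: "j \<le> l"
    proof -
      have "(\<Sum>i<Suc j. X i \<omega>) = \<xi> (ts ! Suc j) \<omega> - \<xi> (ts ! 0) \<omega>"
        unfolding X_def by (rule sum_lessThan_telescope[of "\<lambda>n. \<xi> (ts ! n) \<omega>"])
      then show ?thesis using tsj[OF j] ts0 levy_zero[OF L w] by simp
    qed
    moreover have rs: "(\<Sum>i<Suc j. restrict (\<lambda>i. X i \<omega>) {..<Suc l} i) = (\<Sum>i<Suc j. X i \<omega>)" if "j \<le> l"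
      using that by (intro sum.cong) auto
    ultimately show "((\<lambda>x j. if j \<le> l then \<Sum>i<Suc j. x i else 0) \<circ> (\<lambda>\<omega>. restrict (\<lambda>i. X i \<omega>) {..<Suc l})) \<omega> j
      = (if j \<le> l then \<xi> (r j) \<omega> else 0)"
      using rs by (auto simp del: sum.lessThan_Suc)
  qed
  ultimately show ?thesis by (rule indep_var_cong_space)
qed

lemma (in prob_space) expectation_exp_pos:
  fixes X :: "'a \<Rightarrow> real"
  assumes "integrable M (\<lambda>\<omega>. exp (X \<omega>))"
  shows "0 < expectation (\<lambda>\<omega>. exp (X \<omega>))"
proof -
  have "expectation (\<lambda>\<omega>. exp (X \<omega>)) \<noteq> 0"
  proof
    assume "expectation (\<lambda>\<omega>. exp (X \<omega>)) = 0"
    then have "AE \<omega> in M. exp (X \<omega>) = 0"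
      using integral_nonneg_eq_0_iff_AE[OF assms] by simp
    then show False by simp
  qed
  moreover have "0 \<le> expectation (\<lambda>\<omega>. exp (X \<omega>))" by simp
  ultimately show ?thesis by linarith
qed

text \<open>Stated for the nonnegative integral, since at this point integrability is not yet
  available at times other than 1.\<close>

lemma levy_exp_mult:
  assumes L: "levy_process M \<xi>" and s: "0 \<le> s" and t: "0 \<le> t"
  shows "(\<integral>\<^sup>+\<omega>. ennreal (exp (u * \<xi> (s + t) \<omega>)) \<partial>M) = (\<integral>\<^sup>+\<omega>. ennreal (exp (u * \<xi> s \<omega>)) \<partial>M) * (\<integral>\<^sup>+\<omega>. ennreal (exp (u * \<xi> t \<omega>)) \<partial>M)"
proof -
  interpret prob_space M using L by (rule levy_prob_space)
  have zero: "(\<integral>\<^sup>+\<omega>. ennreal (exp (u * \<xi> 0 \<omega>)) \<partial>M) = 1"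
    by (simp add: levy_zero[OF L] emeasure_space_1 cong: nn_integral_cong)
  show ?thesis
  proof (cases "s = 0 \<or> t = 0")
    case True then show ?thesis using zero by auto
  next
    case False
    then have st: "0 < s" "0 < t" using s t by auto
    let ?ts = "[0, s, s + t]"
    have "indep_vars (\<lambda>_. borel) (\<lambda>i \<omega>. \<xi> (?ts ! Suc i) \<omega> - \<xi> (?ts ! i) \<omega>) {..<length ?ts - 1}"
      using st by (intro levy_indep_increments[OF L]) auto
    then have ind: "indep_vars (\<lambda>_. borel) (\<lambda>i \<omega>. ennreal (exp (u * (\<xi> (?ts ! Suc i) \<omega> - \<xi> (?ts ! i) \<omega>)))) {..<2}"
      using indep_vars_compose2[of "\<lambda>_. borel" "\<lambda>i \<omega>. \<xi> (?ts ! Suc i) \<omega> - \<xi> (?ts ! i) \<omega>" "{..<2}" "\<lambda>_ x. ennreal (exp (u * x))" "\<lambda>_. borel"]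
      by (simp add: numeral_2_eq_2)
    have two: "{..<2::nat} = {0, 1}" by auto
    have "(\<integral>\<^sup>+\<omega>. ennreal (exp (u * \<xi> (s + t) \<omega>)) \<partial>M) =
      (\<integral>\<^sup>+\<omega>. (\<Prod>i<2. ennreal (exp (u * (\<xi> (?ts ! Suc i) \<omega> - \<xi> (?ts ! i) \<omega>)))) \<partial>M)"
      by (intro nn_integral_cong) (simp add: two levy_zero[OF L] ennreal_mult[symmetric] exp_add[symmetric] algebra_simps)
    also have "\<dots> = (\<Prod>i<2. \<integral>\<^sup>+\<omega>. ennreal (exp (u * (\<xi> (?ts ! Suc i) \<omega> - \<xi> (?ts ! i) \<omega>))) \<partial>M)"
      by (rule indep_vars_nn_integral[OF _ ind]) auto
    also have "\<dots> = (\<integral>\<^sup>+\<omega>. ennreal (exp (u * \<xi> s \<omega>)) \<partial>M) * (\<integral>\<^sup>+\<omega>. ennreal (exp (u * (\<xi> (s + t) \<omega> - \<xi> s \<omega>))) \<partial>M)"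
      by (simp add: two levy_zero[OF L] cong: nn_integral_cong)
    also have "(\<integral>\<^sup>+\<omega>. ennreal (exp (u * (\<xi> (s + t) \<omega> - \<xi> s \<omega>))) \<partial>M) = (\<integral>\<^sup>+x. ennreal (exp (u * x)) \<partial>distr M borel (\<lambda>\<omega>. \<xi> (s + t) \<omega> - \<xi> s \<omega>))"
      using levy_measurable[OF L, of "s + t"] levy_measurable[OF L, of s] s t by (subst nn_integral_distr) auto
    also have "\<dots> = (\<integral>\<^sup>+\<omega>. ennreal (exp (u * \<xi> t \<omega>)) \<partial>M)"
      unfolding levy_stationary[OF L s t] using levy_measurable[OF L t] by (subst nn_integral_distr) auto
    finally show ?thesis .
  qed
qed

text \<open>Cauchy's multiplicative equation: the value at time 1 determines all rational times.
  Right-continuity with Fatou gives only an upper bound at real \<open>t\<close>; the lower bound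
  follows by splitting a rational time beyond \<open>t\<close> at \<open>t\<close> and using the
  upper bound for the remaining piece.\<close>

lemma levy_exp_moment_nn:
  assumes L: "levy_process M \<xi>" and mgf: "integrable M (\<lambda>\<omega>. exp (u * \<xi> 1 \<omega>))" and t: "t \<ge> 0"
  shows "(\<integral>\<^sup>+\<omega>. ennreal (exp (u * \<xi> t \<omega>)) \<partial>M) = ennreal (exp (t * cumulant M \<xi> u))"
proof -
  interpret prob_space M using L by (rule levy_prob_space)
  define c where "c = cumulant M \<xi> u"
  define m where "m = (\<lambda>t. \<integral>\<^sup>+\<omega>. ennreal (exp (u * \<xi> t \<omega>)) \<partial>M)"
  have mult: "m (s + t) = m s * m t" if "0 \<le> s" "0 \<le> t" for s t
    unfolding m_def using levy_exp_mult[OF L that] .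
  have m0: "m 0 = 1"
    unfolding m_def by (simp add: levy_zero[OF L] emeasure_space_1 cong: nn_integral_cong)
  have "0 < integral\<^sup>L M (\<lambda>\<omega>. exp (u * \<xi> 1 \<omega>))" by (rule expectation_exp_pos[OF mgf])
  then have "exp c = integral\<^sup>L M (\<lambda>\<omega>. exp (u * \<xi> 1 \<omega>))" by (simp add: c_def cumulant_def)
  then have m1: "m 1 = ennreal (exp c)"
    unfolding m_def using mgf by (simp add: nn_integral_eq_integral)
  have mk: "m (real k * t) = m t ^ k" if "0 \<le> t" for k t
  proof (induction k)
    case (Suc k)
    have "m (t + real k * t) = m t * m (real k * t)" using that by (intro mult) auto
    then show ?case using Suc by (simp add: distrib_right)
  qed (simp add: m0)
  have minv: "m (1 / real n) = ennreal (exp (c / real n))" if n: "n > 0" for n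
  proof -
    have p: "m (1 / real n) ^ n = ennreal (exp c)" using mk[of "1 / real n" n] n m1 by simp
    then have "m (1 / real n) \<noteq> \<top>" using n by (metis ennreal_neq_top power_eq_top_ennreal neq0_conv)
    then obtain x where x: "m (1 / real n) = ennreal x" "x \<ge> 0" by (cases "m (1 / real n)") auto
    have "x ^ n = exp c" using p x by (simp add: ennreal_power)
    also have "exp c = exp (c / real n) ^ n" using n by (simp add: exp_of_nat_mult[symmetric])
    finally have "x = exp (c / real n)" using x(2) n by (simp add: power_eq_iff_eq_base)
    then show ?thesis using x by simp
  qed
  have mrat: "m (real k / real n) = ennreal (exp (real k / real n * c))" if n: "n > 0" for k n
    using mk[of "1 / real n" k] minv[OF n] by (simp add: ennreal_power exp_of_nat_mult[symmetric])
  \<comment> \<open>Rational times strictly above \<open>t\<close>, because the paths are only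
    right-continuous.\<close>
  define q where "q = (\<lambda>t n. real (nat \<lfloor>t * real (Suc n)\<rfloor> + 1) / real (Suc n))"
  have q: "t < q t n" "q t n \<le> t + 1 / real (Suc n)" if "t \<ge> 0" for t n
  proof -
    have "0 \<le> t * real (Suc n)" using that by simp
    then have e: "real (nat \<lfloor>t * real (Suc n)\<rfloor> + 1) = of_int \<lfloor>t * real (Suc n)\<rfloor> + 1" by simp
    have "t * real (Suc n) < real (nat \<lfloor>t * real (Suc n)\<rfloor> + 1)" "real (nat \<lfloor>t * real (Suc n)\<rfloor> + 1) \<le> t * real (Suc n) + 1"
      unfolding e by linarith+
    then show "t < q t n" "q t n \<le> t + 1 / real (Suc n)"
      unfolding q_def by (simp_all add: pos_less_divide_eq pos_divide_le_eq distrib_right del: of_nat_Suc of_nat_add)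
  qed
  have qlim: "q t \<longlonglongrightarrow> t" if "t \<ge> 0" for t
  proof (rule tendsto_sandwich[of "\<lambda>_. t" _ _ "\<lambda>n. t + 1 / real (Suc n)"])
    show "\<forall>\<^sub>F n in sequentially. t \<le> q t n" "\<forall>\<^sub>F n in sequentially. q t n \<le> t + 1 / real (Suc n)"
      using q[OF that] by (auto intro!: always_eventually less_imp_le)
    show "(\<lambda>n. t + 1 / real (Suc n)) \<longlonglongrightarrow> t"
      using tendsto_add[OF tendsto_const LIMSEQ_Suc[OF lim_1_over_n], of t] by simp
  qed simp
  have mq: "m (q t n) = ennreal (exp (q t n * c))" for t n
    unfolding q_def by (rule mrat) simp
  have up: "m t \<le> ennreal (exp (t * c))" if t: "t \<ge> 0" for t
  proof -
    have lim: "(\<lambda>n. exp (u * \<xi> (q t n) \<omega>)) \<longlonglongrightarrow> exp (u * \<xi> t \<omega>)" if w: "\<omega> \<in> space M" for \<omega>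
    proof -
      have "((\<lambda>t. \<xi> t \<omega>) \<longlongrightarrow> \<xi> t \<omega>) (at_right t)"
        using levy_cadlag[OF L w] t unfolding cadlag_halfline_def by blast
      moreover have "filterlim (q t) (at_right t) sequentially"
        unfolding filterlim_at using qlim[OF t] q(1)[OF t] by (auto intro!: always_eventually simp: less_imp_neq[symmetric])
      ultimately have "(\<lambda>n. \<xi> (q t n) \<omega>) \<longlonglongrightarrow> \<xi> t \<omega>" by (rule filterlim_compose)
      then show ?thesis by (intro tendsto_intros)
    qed
    have qm: "(\<lambda>\<omega>. exp (u * \<xi> (q t n) \<omega>)) \<in> borel_measurable M" for n
      using levy_measurable[OF L, of "q t n"] q(1)[OF t, of n] t by simp
    have "m t = (\<integral>\<^sup>+\<omega>. liminf (\<lambda>n. ennreal (exp (u * \<xi> (q t n) \<omega>))) \<partial>M)"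
      unfolding m_def using lim
      by (intro nn_integral_cong lim_imp_Liminf[symmetric] tendsto_ennrealI) auto
    also have "\<dots> \<le> liminf (\<lambda>n. m (q t n))"
      unfolding m_def using qm by (intro nn_integral_liminf) auto
    also have "\<dots> = liminf (\<lambda>n. ennreal (exp (q t n * c)))" by (simp add: mq)
    also have "\<dots> = ennreal (exp (t * c))"
      using qlim[OF t] by (intro lim_imp_Liminf tendsto_ennrealI tendsto_intros) auto
    finally show ?thesis .
  qed
  have "ennreal (exp (t * c)) \<le> m t"
  proof -
    have d: "0 \<le> q t 0 - t" using q(1)[OF t, of 0] by simp
    have "ennreal (exp (q t 0 * c)) = m t * m (q t 0 - t)"
      using mult[OF t d] mq[of t 0] by simp
    also have "\<dots> \<le> m t * ennreal (exp ((q t 0 - t) * c))" by (intro mult_left_mono up d) simp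
    finally have "ennreal (exp (q t 0 * c)) * ennreal (exp (- ((q t 0 - t) * c)))
       \<le> m t * ennreal (exp ((q t 0 - t) * c)) * ennreal (exp (- ((q t 0 - t) * c)))" by (rule mult_right_mono) simp
    then show ?thesis
      by (simp add: mult.assoc ennreal_mult[symmetric] exp_add[symmetric] algebra_simps)
  qed
  then show ?thesis using up[OF t] by (simp add: m_def c_def antisym)
qed

lemma levy_exp_moment:
  assumes L: "levy_process M \<xi>" and mgf: "integrable M (\<lambda>\<omega>. exp (u * \<xi> 1 \<omega>))" and t: "t \<ge> 0"
  shows "integrable M (\<lambda>\<omega>. exp (u * \<xi> t \<omega>))" "integral\<^sup>L M (\<lambda>\<omega>. exp (u * \<xi> t \<omega>)) = exp (t * cumulant M \<xi> u)"
proof -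
  have m: "(\<lambda>\<omega>. exp (u * \<xi> t \<omega>)) \<in> borel_measurable M" using levy_measurable[OF L t] by simp
  show i: "integrable M (\<lambda>\<omega>. exp (u * \<xi> t \<omega>))"
    by (rule integrableI_nonneg[OF m]) (simp_all add: levy_exp_moment_nn[OF L mgf t])
  show "integral\<^sup>L M (\<lambda>\<omega>. exp (u * \<xi> t \<omega>)) = exp (t * cumulant M \<xi> u)"
    using levy_exp_moment_nn[OF L mgf t] nn_integral_eq_integral[OF i] by simp
qed

lemma levy_increment_exp_moment:
  assumes L: "levy_process M \<xi>" and mgf: "integrable M (\<lambda>\<omega>. exp (u * \<xi> 1 \<omega>))" and t: "0 \<le> s" "s \<le> t"
  shows "integrable M (\<lambda>\<omega>. exp (u * (\<xi> t \<omega> - \<xi> s \<omega>)))"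
    "integral\<^sup>L M (\<lambda>\<omega>. exp (u * (\<xi> t \<omega> - \<xi> s \<omega>))) = exp ((t - s) * cumulant M \<xi> u)"
proof -
  have d: "distr M borel (\<lambda>\<omega>. \<xi> t \<omega> - \<xi> s \<omega>) = distr M borel (\<xi> (t - s))"
    using levy_stationary[OF L t(1), of "t - s"] t by simp
  have m: "(\<lambda>\<omega>. \<xi> t \<omega> - \<xi> s \<omega>) \<in> borel_measurable M" "\<xi> (t - s) \<in> borel_measurable M"
    using levy_measurable[OF L, of t] levy_measurable[OF L, of s] levy_measurable[OF L, of "t - s"] t by auto
  have "integrable (distr M borel (\<xi> (t - s))) (\<lambda>x. exp (u * x))"
    using levy_exp_moment(1)[OF L mgf, of "t - s"] t m by (subst integrable_distr_eq) auto
  then show "integrable M (\<lambda>\<omega>. exp (u * (\<xi> t \<omega> - \<xi> s \<omega>)))"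
    unfolding d[symmetric] using m by (subst (asm) integrable_distr_eq) auto
  have "integral\<^sup>L (distr M borel (\<xi> (t - s))) (\<lambda>x. exp (u * x)) = exp ((t - s) * cumulant M \<xi> u)"
    using levy_exp_moment(2)[OF L mgf, of "t - s"] t m by (subst integral_distr) auto
  then show "integral\<^sup>L M (\<lambda>\<omega>. exp (u * (\<xi> t \<omega> - \<xi> s \<omega>))) = exp ((t - s) * cumulant M \<xi> u)"
    unfolding d[symmetric] using m by (subst (asm) integral_distr) auto
qed

lemma levy_indep_expectation:
  fixes r :: "nat \<Rightarrow> real" and g :: "(nat \<Rightarrow> real) \<Rightarrow> real"
  assumes L: "levy_process M \<xi>" and r0: "0 < r 0" and r: "\<And>i. i < l \<Longrightarrow> r i < r (Suc i)" and R: "r l < R"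
    and \<phi>: "\<phi> \<in> borel_measurable borel" and g: "g \<in> borel_measurable borel"
    and i\<phi>: "integrable M (\<lambda>\<omega>. \<phi> (\<xi> R \<omega> - \<xi> (r l) \<omega>))"
    and ig: "integrable M (\<lambda>\<omega>. g (\<lambda>j. if j \<le> l then \<xi> (r j) \<omega> else 0))"
  shows "integrable M (\<lambda>\<omega>. \<phi> (\<xi> R \<omega> - \<xi> (r l) \<omega>) * g (\<lambda>j. if j \<le> l then \<xi> (r j) \<omega> else 0))"
    "integral\<^sup>L M (\<lambda>\<omega>. \<phi> (\<xi> R \<omega> - \<xi> (r l) \<omega>) * g (\<lambda>j. if j \<le> l then \<xi> (r j) \<omega> else 0))
     = integral\<^sup>L M (\<lambda>\<omega>. \<phi> (\<xi> R \<omega> - \<xi> (r l) \<omega>)) * integral\<^sup>L M (\<lambda>\<omega>. g (\<lambda>j. if j \<le> l then \<xi> (r j) \<omega> else 0))"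
proof -
  interpret prob_space M using L by (rule levy_prob_space)
  have ind: "indep_var borel (\<lambda>\<omega> j::nat. \<xi> R \<omega> - \<xi> (r l) \<omega>) borel (\<lambda>\<omega> j. if j \<le> l then \<xi> (r j) \<omega> else 0)"
    by (rule levy_indep_history[where r=r, OF L r0 _ R]) (rule r)
  have "(\<lambda>x::nat \<Rightarrow> real. \<phi> (x 0)) \<in> borel_measurable borel"
    using \<phi> by (rule measurable_compose[rotated]) (rule borel_measurable_continuous_onI, rule continuous_on_product_coordinates)
  then have "indep_var borel ((\<lambda>x::nat \<Rightarrow> real. \<phi> (x 0)) \<circ> (\<lambda>\<omega> j::nat. \<xi> R \<omega> - \<xi> (r l) \<omega>))
     borel (g \<circ> (\<lambda>\<omega> j. if j \<le> l then \<xi> (r j) \<omega> else 0))"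
    using g by (rule indep_var_compose[OF ind])
  then have "indep_var borel (\<lambda>\<omega>. \<phi> (\<xi> R \<omega> - \<xi> (r l) \<omega>)) borel (\<lambda>\<omega>. g (\<lambda>j. if j \<le> l then \<xi> (r j) \<omega> else 0))"
    by (simp add: comp_def)
  from indep_var_integrable[OF this i\<phi> ig] indep_var_lebesgue_integral[OF this i\<phi> ig]
  show "integrable M (\<lambda>\<omega>. \<phi> (\<xi> R \<omega> - \<xi> (r l) \<omega>) * g (\<lambda>j. if j \<le> l then \<xi> (r j) \<omega> else 0))"
    "integral\<^sup>L M (\<lambda>\<omega>. \<phi> (\<xi> R \<omega> - \<xi> (r l) \<omega>) * g (\<lambda>j. if j \<le> l then \<xi> (r j) \<omega> else 0))
     = integral\<^sup>L M (\<lambda>\<omega>. \<phi> (\<xi> R \<omega> - \<xi> (r l) \<omega>)) * integral\<^sup>L M (\<lambda>\<omega>. g (\<lambda>j. if j \<le> l then \<xi> (r j) \<omega> else 0))"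
    by blast+
qed

lemma measurable_nat_fun_component: "(\<lambda>x::nat \<Rightarrow> real. x j) \<in> borel_measurable borel"
  by (rule borel_measurable_continuous_onI, rule continuous_on_product_coordinates)

text \<open>The martingale property in tested form: bounded functions of finitely many earlier
  values stand in for conditional expectations. The integrand factors into a centred function of the
  next increment and a function of the history, which are independent.\<close>

lemma levy_exp_martingale:
  fixes r :: "nat \<Rightarrow> real" and g :: "(nat \<Rightarrow> real) \<Rightarrow> real"
  assumes L: "levy_process M \<xi>" and mgf: "integrable M (\<lambda>\<omega>. exp (\<xi> 1 \<omega>))"
    and r0: "0 < r 0" and r: "\<And>i. i < l \<Longrightarrow> r i < r (Suc i)" and R: "r l < R"
    and g: "g \<in> borel_measurable borel" and B: "\<And>x. \<bar>g x\<bar> \<le> B"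
  defines "c \<equiv> cumulant M \<xi> 1"
  shows "integral\<^sup>L M (\<lambda>\<omega>. (exp (\<xi> R \<omega> - c * R) - exp (\<xi> (r l) \<omega> - c * r l)) * g (\<lambda>j. if j \<le> l then \<xi> (r j) \<omega> else 0)) = 0"
proof -
  interpret prob_space M using L by (rule levy_prob_space)
  have rl: "0 < r j" if "j \<le> l" for j using that
  proof (induction j)
    case (Suc j) then show ?case using r[of j] by simp
  qed (rule r0)
  have mgf1: "integrable M (\<lambda>\<omega>. exp (1 * \<xi> 1 \<omega>))" using mgf by simp
  define \<phi> where "\<phi> = (\<lambda>d. exp (d - c * (R - r l)) - 1)"
  define G where "G = (\<lambda>x::nat \<Rightarrow> real. exp (x l - c * r l) * g x)"
  have Gm: "G \<in> borel_measurable borel" unfolding G_def using g measurable_nat_fun_component[of l] by measurable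
  have H: "(\<lambda>\<omega> j. if j \<le> l then \<xi> (r j) \<omega> else 0) \<in> M \<rightarrow>\<^sub>M borel"
  proof (rule measurable_coordinatewise_then_product)
    fix j show "(\<lambda>\<omega>. if j \<le> l then \<xi> (r j) \<omega> else 0) \<in> borel_measurable M"
      using levy_measurable[OF L, of "r j"] rl[of j] by (cases "j \<le> l") auto
  qed
  have ie: "integrable M (\<lambda>\<omega>. exp (\<xi> (r l) \<omega>))"
    using levy_exp_moment(1)[OF L mgf1, of "r l"] rl[of l] by simp
  have iG: "integrable M (\<lambda>\<omega>. G (\<lambda>j. if j \<le> l then \<xi> (r j) \<omega> else 0))"
  proof (rule Bochner_Integration.integrable_bound[where f="\<lambda>\<omega>. B * exp (- c * r l) * exp (\<xi> (r l) \<omega>)"])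
    show "integrable M (\<lambda>\<omega>. B * exp (- c * r l) * exp (\<xi> (r l) \<omega>))" using ie by simp
    show "(\<lambda>\<omega>. G (\<lambda>j. if j \<le> l then \<xi> (r j) \<omega> else 0)) \<in> borel_measurable M" using measurable_compose[OF H Gm] .
    show "AE \<omega> in M. norm (G (\<lambda>j. if j \<le> l then \<xi> (r j) \<omega> else 0)) \<le> norm (B * exp (- c * r l) * exp (\<xi> (r l) \<omega>))"
    proof (rule AE_I2)
      fix \<omega>
      let ?x = "\<lambda>j. if j \<le> l then \<xi> (r j) \<omega> else 0"
      have "\<bar>g ?x\<bar> \<le> \<bar>B\<bar>" using B[of ?x] by linarith
      then have "exp (\<xi> (r l) \<omega> - c * r l) * \<bar>g ?x\<bar> \<le> exp (\<xi> (r l) \<omega> - c * r l) * \<bar>B\<bar>" by (intro mult_left_mono) auto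
      then show "norm (G ?x) \<le> norm (B * exp (- c * r l) * exp (\<xi> (r l) \<omega>))"
        by (simp add: G_def abs_mult exp_diff exp_minus field_simps)
    qed
  qed
  have inc: "integrable M (\<lambda>\<omega>. exp (\<xi> R \<omega> - \<xi> (r l) \<omega>))"
    "integral\<^sup>L M (\<lambda>\<omega>. exp (\<xi> R \<omega> - \<xi> (r l) \<omega>)) = exp ((R - r l) * c)"
    using levy_increment_exp_moment[OF L mgf1, of "r l" R] rl[of l] R by (simp_all add: c_def)
  have \<phi>e: "\<phi> (\<xi> R \<omega> - \<xi> (r l) \<omega>) = exp (- c * (R - r l)) * exp (\<xi> R \<omega> - \<xi> (r l) \<omega>) - 1" for \<omega>
    by (simp add: \<phi>_def exp_add[symmetric] algebra_simps)
  have i\<phi>: "integrable M (\<lambda>\<omega>. \<phi> (\<xi> R \<omega> - \<xi> (r l) \<omega>))" unfolding \<phi>e using inc(1) by simp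
  have "integral\<^sup>L M (\<lambda>\<omega>. \<phi> (\<xi> R \<omega> - \<xi> (r l) \<omega>)) = exp (- c * (R - r l)) * exp ((R - r l) * c) - 1"
    unfolding \<phi>e using inc by (simp add: prob_space)
  then have z: "integral\<^sup>L M (\<lambda>\<omega>. \<phi> (\<xi> R \<omega> - \<xi> (r l) \<omega>)) = 0" by (simp add: exp_add[symmetric] algebra_simps)
  have "(exp (\<xi> R \<omega> - c * R) - exp (\<xi> (r l) \<omega> - c * r l)) * g (\<lambda>j. if j \<le> l then \<xi> (r j) \<omega> else 0)
     = \<phi> (\<xi> R \<omega> - \<xi> (r l) \<omega>) * G (\<lambda>j. if j \<le> l then \<xi> (r j) \<omega> else 0)" for \<omega>
  proof -
    have "\<phi> (\<xi> R \<omega> - \<xi> (r l) \<omega>) * exp (\<xi> (r l) \<omega> - c * r l) = exp (\<xi> R \<omega> - c * R) - exp (\<xi> (r l) \<omega> - c * r l)"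
      by (simp add: \<phi>_def left_diff_distrib exp_add[symmetric] algebra_simps)
    then show ?thesis by (simp add: G_def mult.assoc[symmetric])
  qed
  moreover have "\<phi> \<in> borel_measurable borel" unfolding \<phi>_def by measurable
  ultimately show ?thesis
    using levy_indep_expectation(2)[OF L r0 r R _ Gm i\<phi> iG] z by simp
qed

text \<open>Split at the earlier time, the product is \<open>exp\<close> of an independent increment
  times \<open>exp (2 * \<xi> s)\<close>; this is how the cumulant at 2 enters the
  covariance.\<close>

lemma levy_exp_product:
  assumes L: "levy_process M \<xi>" and mgf: "\<And>u. integrable M (\<lambda>\<omega>. exp (u * \<xi> 1 \<omega>))"
    and s: "0 < s" "s \<le> t"
  shows "integrable M (\<lambda>\<omega>. exp (\<xi> s \<omega>) * exp (\<xi> t \<omega>))"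
    "integral\<^sup>L M (\<lambda>\<omega>. exp (\<xi> s \<omega>) * exp (\<xi> t \<omega>)) = exp (s * cumulant M \<xi> 2 + (t - s) * cumulant M \<xi> 1)"
proof -
  have e: "exp (\<xi> s \<omega>) * exp (\<xi> t \<omega>) = exp (\<xi> t \<omega> - \<xi> s \<omega>) * exp (2 * \<xi> s \<omega>)" for \<omega>
    by (simp add: exp_add[symmetric])
  have m2: "integrable M (\<lambda>\<omega>. exp (2 * \<xi> s \<omega>))" "integral\<^sup>L M (\<lambda>\<omega>. exp (2 * \<xi> s \<omega>)) = exp (s * cumulant M \<xi> 2)"
    using levy_exp_moment[OF L mgf, of s 2] s by auto
  have "integrable M (\<lambda>\<omega>. exp (\<xi> t \<omega> - \<xi> s \<omega>) * exp (2 * \<xi> s \<omega>)) \<and>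
    integral\<^sup>L M (\<lambda>\<omega>. exp (\<xi> t \<omega> - \<xi> s \<omega>) * exp (2 * \<xi> s \<omega>)) = exp ((t - s) * cumulant M \<xi> 1) * exp (s * cumulant M \<xi> 2)"
  proof (cases "s = t")
    case True then show ?thesis using m2 by simp
  next
    case False
    then have st: "s < t" using s by simp
    have m1: "integrable M (\<lambda>\<omega>. exp (\<xi> t \<omega> - \<xi> s \<omega>))" "integral\<^sup>L M (\<lambda>\<omega>. exp (\<xi> t \<omega> - \<xi> s \<omega>)) = exp ((t - s) * cumulant M \<xi> 1)"
      using levy_increment_exp_moment[OF L mgf[of 1], of s t] s by auto
    have g: "(\<lambda>x::nat \<Rightarrow> real. exp (2 * x 0)) \<in> borel_measurable borel"
      using measurable_nat_fun_component[of 0] by measurable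
    have ex: "exp \<in> borel_measurable (borel :: real measure)" by measurable
    show ?thesis
      using levy_indep_expectation[OF L, of "\<lambda>_. s" 0 t exp "\<lambda>x. exp (2 * x 0)", OF _ _ _ ex g] m1 m2 s st by simp
  qed
  then show "integrable M (\<lambda>\<omega>. exp (\<xi> s \<omega>) * exp (\<xi> t \<omega>))"
    "integral\<^sup>L M (\<lambda>\<omega>. exp (\<xi> s \<omega>) * exp (\<xi> t \<omega>)) = exp (s * cumulant M \<xi> 2 + (t - s) * cumulant M \<xi> 1)"
    unfolding e by (simp_all add: exp_add mult.commute)
qed

text \<open>Strictness is positivity of the variance of \<open>exp (\<xi> 1)\<close>: a zero
  variance would make \<open>\<xi> 1\<close> almost surely constant. The positivity of
  \<open>\<kappa>\<close> rests on this.\<close>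

lemma cumulant_2_gt:
  assumes P: "prob_space M" and mgf: "\<And>u. integrable M (\<lambda>\<omega>. exp (u * \<xi> 1 \<omega>))"
    and nonconst: "\<not> (\<exists>c. AE \<omega> in M. \<xi> 1 \<omega> = c)"
  shows "2 * cumulant M \<xi> 1 < cumulant M \<xi> 2"
proof -
  interpret prob_space M by fact
  define a where "a = integral\<^sup>L M (\<lambda>\<omega>. exp (\<xi> 1 \<omega>))"
  define b where "b = integral\<^sup>L M (\<lambda>\<omega>. exp (2 * \<xi> 1 \<omega>))"
  have i: "integrable M (\<lambda>\<omega>. exp (\<xi> 1 \<omega>))" "integrable M (\<lambda>\<omega>. exp (2 * \<xi> 1 \<omega>))" using mgf[of 1] mgf[of 2] by auto
  have a: "0 < a" using expectation_exp_pos[OF i(1)] by (simp add: a_def)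
  have b: "0 < b" using expectation_exp_pos[OF i(2)] by (simp add: b_def)
  have e: "(exp (\<xi> 1 \<omega>) - a)\<^sup>2 = exp (2 * \<xi> 1 \<omega>) - 2 * a * exp (\<xi> 1 \<omega>) + a\<^sup>2" for \<omega>
    by (simp add: power2_eq_square exp_double algebra_simps)
  have isq: "integrable M (\<lambda>\<omega>. (exp (\<xi> 1 \<omega>) - a)\<^sup>2)" unfolding e using i by simp
  have "integral\<^sup>L M (\<lambda>\<omega>. (exp (\<xi> 1 \<omega>) - a)\<^sup>2) = b - a\<^sup>2"
    unfolding e using i by (simp add: a_def[symmetric] b_def[symmetric] prob_space power2_eq_square)
  moreover have "integral\<^sup>L M (\<lambda>\<omega>. (exp (\<xi> 1 \<omega>) - a)\<^sup>2) \<noteq> 0"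
  proof
    assume "integral\<^sup>L M (\<lambda>\<omega>. (exp (\<xi> 1 \<omega>) - a)\<^sup>2) = 0"
    then have "AE \<omega> in M. (exp (\<xi> 1 \<omega>) - a)\<^sup>2 = 0"
      using integral_nonneg_eq_0_iff_AE[OF isq] by simp
    then have "AE \<omega> in M. \<xi> 1 \<omega> = ln a"
      by eventually_elim (metis ln_exp right_minus_eq zero_eq_power2)
    then show False using nonconst by blast
  qed
  moreover have "0 \<le> integral\<^sup>L M (\<lambda>\<omega>. (exp (\<xi> 1 \<omega>) - a)\<^sup>2)" by simp
  ultimately have "a\<^sup>2 < b" by linarith
  then have "ln (a\<^sup>2) < ln b" using a b by (subst ln_less_cancel_iff) auto
  then show ?thesis using a by (simp add: cumulant_def a_def b_def ln_realpow)
qed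

text \<open>A dominating function independent of \<open>h\<close>, for differentiation under the
  expectation. The factor \<open>\<bar>x\<bar> * exp \<bar>x\<bar>\<close> is absorbed into
  \<open>exp (2 * \<bar>x\<bar>)\<close>, and \<open>2 * x + 2 * \<bar>x\<bar>\<close> is either
  \<open>4 * x\<close> or 0.\<close>

lemma exp_difference_quotient_bound:
  fixes h x :: real
  assumes h: "h \<noteq> 0" "\<bar>h\<bar> \<le> 1"
  shows "\<bar>(exp ((2 + h) * x) - exp (2 * x)) / h\<bar> \<le> exp (4 * x) + 1"
proof -
  have m: "\<bar>exp y - 1\<bar> \<le> \<bar>y\<bar> * exp \<bar>y\<bar>" for y :: real
  proof -
    have "exp y - 1 \<le> y * exp y"
    proof -
      have "(1 - y) * exp y \<le> exp (- y) * exp y" using exp_ge_add_one_self[of "-y"] by (intro mult_right_mono) auto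
      then show ?thesis by (simp add: exp_add[symmetric] algebra_simps)
    qed
    moreover have "y \<le> exp y - 1" using exp_ge_add_one_self[of y] by linarith
    moreover have "y * exp y \<le> \<bar>y\<bar> * exp \<bar>y\<bar>" by (intro mult_mono) auto
    moreover have "\<bar>y\<bar> * 1 \<le> \<bar>y\<bar> * exp \<bar>y\<bar>" by (intro mult_left_mono) auto
    ultimately show ?thesis by (simp add: abs_le_iff)
  qed
  have hx: "\<bar>h * x\<bar> \<le> \<bar>x\<bar>" using h by (simp add: abs_mult mult_left_le_one_le)
  have "exp ((2 + h) * x) - exp (2 * x) = exp (2 * x) * (exp (h * x) - 1)"
    by (simp add: distrib_right exp_add algebra_simps)
  then have "\<bar>(exp ((2 + h) * x) - exp (2 * x)) / h\<bar> = exp (2 * x) * (\<bar>exp (h * x) - 1\<bar> / \<bar>h\<bar>)"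
    by (simp add: abs_mult)
  also have "\<dots> \<le> exp (2 * x) * (\<bar>x\<bar> * exp \<bar>x\<bar>)"
  proof (intro mult_left_mono)
    have "\<bar>exp (h * x) - 1\<bar> \<le> \<bar>h * x\<bar> * exp \<bar>h * x\<bar>" by (rule m)
    also have "\<dots> \<le> \<bar>h * x\<bar> * exp \<bar>x\<bar>" using hx by (intro mult_left_mono) auto
    finally show "\<bar>exp (h * x) - 1\<bar> / \<bar>h\<bar> \<le> \<bar>x\<bar> * exp \<bar>x\<bar>" using h by (simp add: field_simps abs_mult)
  qed simp
  also have "\<dots> \<le> exp (2 * x) * (exp \<bar>x\<bar> * exp \<bar>x\<bar>)"
  proof (intro mult_left_mono mult_right_mono)
    show "\<bar>x\<bar> \<le> exp \<bar>x\<bar>" using exp_ge_add_one_self[of "\<bar>x\<bar>"] by linarith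
  qed auto
  also have "\<dots> = exp (2 * x + 2 * \<bar>x\<bar>)" by (simp add: exp_add[symmetric])
  also have "\<dots> \<le> exp (4 * x) + 1"
  proof (cases "x \<ge> 0")
    case True then show ?thesis by simp
  qed simp
  finally show ?thesis .
qed

text \<open>\<open>deriv\<close> denotes some value even where no derivative exists, so
  differentiability at 2 has to be established before the growth hypothesis can be
  exploited.\<close>

lemma cumulant_DERIV_2:
  assumes P: "prob_space M" and mgf: "\<And>u. integrable M (\<lambda>\<omega>. exp (u * \<xi> 1 \<omega>))" and m: "\<xi> 1 \<in> borel_measurable M"
  shows "\<exists>D. (cumulant M \<xi> has_real_derivative D) (at 2)"
proof -
  interpret prob_space M by fact
  define F where "F = (\<lambda>u. integral\<^sup>L M (\<lambda>\<omega>. exp (u * \<xi> 1 \<omega>)))"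
  have "((\<lambda>h. (F (2 + h) - F 2) / h) \<longlongrightarrow> integral\<^sup>L M (\<lambda>\<omega>. \<xi> 1 \<omega> * exp (2 * \<xi> 1 \<omega>))) (at 0)"
  proof (subst tendsto_at_iff_sequentially, intro allI impI)
    fix X :: "nat \<Rightarrow> real" assume X: "\<forall>i. X i \<in> UNIV - {0}" "X \<longlonglongrightarrow> 0"
    have "eventually (\<lambda>n. \<bar>X n\<bar> < 1) sequentially" using tendstoD[OF X(2), of 1] by simp
    then obtain n0 where n0: "\<And>n. n \<ge> n0 \<Longrightarrow> \<bar>X n\<bar> < 1" by (auto simp: eventually_sequentially)
    have e: "(F (2 + h) - F 2) / h = integral\<^sup>L M (\<lambda>\<omega>. (exp ((2 + h) * \<xi> 1 \<omega>) - exp (2 * \<xi> 1 \<omega>)) / h)" for h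
      unfolding F_def using mgf[of "2 + h"] mgf[of 2] by simp
    have "(\<lambda>n. integral\<^sup>L M (\<lambda>\<omega>. (exp ((2 + X (n + n0)) * \<xi> 1 \<omega>) - exp (2 * \<xi> 1 \<omega>)) / X (n + n0)))
        \<longlonglongrightarrow> integral\<^sup>L M (\<lambda>\<omega>. \<xi> 1 \<omega> * exp (2 * \<xi> 1 \<omega>))"
    proof (rule integral_dominated_convergence[where w="\<lambda>\<omega>. exp (4 * \<xi> 1 \<omega>) + 1"])
      show "AE \<omega> in M. (\<lambda>n. (exp ((2 + X (n + n0)) * \<xi> 1 \<omega>) - exp (2 * \<xi> 1 \<omega>)) / X (n + n0)) \<longlonglongrightarrow> \<xi> 1 \<omega> * exp (2 * \<xi> 1 \<omega>)"
      proof (rule AE_I2)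
        fix \<omega>
        have "((\<lambda>u. exp (u * \<xi> 1 \<omega>)) has_real_derivative \<xi> 1 \<omega> * exp (2 * \<xi> 1 \<omega>)) (at 2)"
          by (auto intro!: derivative_eq_intros)
        then have d: "((\<lambda>h. (exp ((2 + h) * \<xi> 1 \<omega>) - exp (2 * \<xi> 1 \<omega>)) / h) \<longlongrightarrow> \<xi> 1 \<omega> * exp (2 * \<xi> 1 \<omega>)) (at 0)"
          by (simp add: DERIV_def)
        have "filterlim (\<lambda>n. X (n + n0)) (at 0) sequentially"
          unfolding filterlim_at using X LIMSEQ_ignore_initial_segment[OF X(2)] by auto
        from filterlim_compose[OF d this]
        show "(\<lambda>n. (exp ((2 + X (n + n0)) * \<xi> 1 \<omega>) - exp (2 * \<xi> 1 \<omega>)) / X (n + n0)) \<longlonglongrightarrow> \<xi> 1 \<omega> * exp (2 * \<xi> 1 \<omega>)" .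
      qed
      show "integrable M (\<lambda>\<omega>. exp (4 * \<xi> 1 \<omega>) + 1)" using mgf[of 4] by simp
      show "AE \<omega> in M. norm ((exp ((2 + X (n + n0)) * \<xi> 1 \<omega>) - exp (2 * \<xi> 1 \<omega>)) / X (n + n0)) \<le> exp (4 * \<xi> 1 \<omega>) + 1" for n
        using exp_difference_quotient_bound[of "X (n + n0)"] X(1) n0[of "n + n0"] by (auto simp del: abs_divide)
    qed (use m in measurable)
    then have "(\<lambda>n. (F (2 + X (n + n0)) - F 2) / X (n + n0)) \<longlonglongrightarrow> integral\<^sup>L M (\<lambda>\<omega>. \<xi> 1 \<omega> * exp (2 * \<xi> 1 \<omega>))"
      unfolding e .
    then show "((\<lambda>h. (F (2 + h) - F 2) / h) \<circ> X) \<longlonglongrightarrow> integral\<^sup>L M (\<lambda>\<omega>. \<xi> 1 \<omega> * exp (2 * \<xi> 1 \<omega>))"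
      unfolding comp_def by (rule LIMSEQ_offset)
  qed
  then have "(F has_real_derivative integral\<^sup>L M (\<lambda>\<omega>. \<xi> 1 \<omega> * exp (2 * \<xi> 1 \<omega>))) (at 2)" by (simp add: DERIV_def)
  moreover have "0 < F 2" unfolding F_def by (rule expectation_exp_pos[OF mgf])
  ultimately have "((\<lambda>u. ln (F u)) has_real_derivative (inverse (F 2) * integral\<^sup>L M (\<lambda>\<omega>. \<xi> 1 \<omega> * exp (2 * \<xi> 1 \<omega>)))) (at 2)"
    by (auto intro!: derivative_eq_intros simp: divide_inverse mult.commute)
  moreover have "(\<lambda>u. ln (F u)) = cumulant M \<xi>" by (rule ext) (simp add: F_def cumulant_def)
  ultimately show ?thesis by auto
qed

text \<open>The exponent \<open>p > 2\<close> of the Lyapunov condition: as \<open>p \<down> 2\<close>, \<open>(\<psi> p - p/2 \<psi> 2) / (p/2 - 1)\<close> tends to \<open>2 \<psi>' 2 - \<psi> 2\<close>.\<close>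

lemma lyapunov_exponent_exists:
  assumes d: "(f has_real_derivative D) (at 2)" and lam: "2 * D - f 2 < lam"
  obtains p where "2 < p" "p \<le> 3" "f p - p / 2 * f 2 < (p / 2 - 1) * lam"
proof -
  have "((\<lambda>h. (f (2 + h) - f 2) / h) \<longlongrightarrow> D) (at_right 0)"
    using d by (auto simp: DERIV_def intro: filterlim_at_split[THEN iffD1, THEN conjunct2])
  then have "eventually (\<lambda>h. (f (2 + h) - f 2) / h < (lam + f 2) / 2) (at_right 0)"
    using lam by (intro order_tendstoD(2)) auto
  moreover have "eventually (\<lambda>h. h \<in> {0<..<1}) (at_right (0::real))" by (rule eventually_at_right_real) simp
  ultimately have "eventually (\<lambda>h. (f (2 + h) - f 2) / h < (lam + f 2) / 2 \<and> h \<in> {0<..<1}) (at_right 0)"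
    by (rule eventually_conj)
  then obtain h where h: "(f (2 + h) - f 2) / h < (lam + f 2) / 2" "0 < h" "h < 1"
    using eventually_happens' [of "at_right (0::real)"] by fastforce
  show ?thesis
  proof (rule that[of "2 + h"])
    have "f (2 + h) - f 2 < (lam + f 2) / 2 * h" using h by (simp add: divide_less_eq)
    then show "f (2 + h) - (2 + h) / 2 * f 2 < ((2 + h) / 2 - 1) * lam" by (simp add: field_simps)
  qed (use h in auto)
qed

section \<open>Maximal inequalities and Gaussian variables\<close>

text \<open>The excess \<open>max 0 (\<bar>x\<bar> - \<epsilon>)\<close> is a convex function of a martingale, hence its expectation increases. It is used in
  place of a power because the particle system has no uniformly bounded moments of order above 2.\<close>

lemma (in prob_space) martingale_maximal_inequality:
  fixes Y :: "nat \<Rightarrow> 'a \<Rightarrow> real"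
  assumes int: "\<And>j. j \<le> n \<Longrightarrow> integrable M (Y j)" and e: "\<epsilon> > 0"
    and mart: "\<And>l g. l \<le> n \<Longrightarrow> g \<in> borel_measurable borel \<Longrightarrow> (\<And>x. \<bar>g x\<bar> \<le> 1) \<Longrightarrow>
      expectation (\<lambda>\<omega>. (Y n \<omega> - Y l \<omega>) * g (\<lambda>j. if j \<le> l then Y j \<omega> else 0)) = 0"
  shows "prob {\<omega> \<in> space M. \<exists>j\<le>n. 2 * \<epsilon> < \<bar>Y j \<omega>\<bar>} \<le> expectation (\<lambda>\<omega>. max 0 (\<bar>Y n \<omega>\<bar> - \<epsilon>)) / \<epsilon>"
proof -
  \<comment> \<open>\<open>F l\<close> says that \<open>l\<close> is the first index of exceedance,
    read off from the history up to \<open>l\<close>; \<open>g l\<close> is the sign of the value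
    there, an admissible test function of modulus at most 1.\<close>
  define F where "F = (\<lambda>l (v :: nat \<Rightarrow> real). 2 * \<epsilon> < \<bar>v l\<bar> \<and> (\<forall>j<l. \<bar>v j\<bar> \<le> 2 * \<epsilon>))"
  define g where "g = (\<lambda>l (v :: nat \<Rightarrow> real). if F l v then sgn (v l) else 0)"
  define h where "h = (\<lambda>l \<omega> j. if j \<le> l then Y j \<omega> else 0)"
  have [measurable]: "(\<lambda>x::nat \<Rightarrow> real. x j) \<in> borel_measurable borel" for j by (rule measurable_nat_fun_component)
  have gm: "g l \<in> borel_measurable borel" for l
    unfolding g_def F_def by measurable
  have gb: "\<bar>g l x\<bar> \<le> 1" for l x by (simp add: g_def sgn_if)
  have [measurable]: "Y j \<in> borel_measurable M" if "j \<le> n" for j using int[OF that] by simp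
  have hm: "h l \<in> M \<rightarrow>\<^sub>M borel" if "l \<le> n" for l
    unfolding h_def
  proof (rule measurable_coordinatewise_then_product)
    fix j show "(\<lambda>\<omega>. if j \<le> l then Y j \<omega> else 0) \<in> borel_measurable M"
      using that int[of j] by (cases "j \<le> l") auto
  qed
  have Fh: "F l (h l \<omega>) \<longleftrightarrow> 2 * \<epsilon> < \<bar>Y l \<omega>\<bar> \<and> (\<forall>j<l. \<bar>Y j \<omega>\<bar> \<le> 2 * \<epsilon>)" for l \<omega>
    by (simp add: F_def h_def)
  define B where "B = {\<omega> \<in> space M. \<exists>j\<le>n. 2 * \<epsilon> < \<bar>Y j \<omega>\<bar>}"
  have Bs: "B \<in> sets M"
  proof -
    have "B = (\<Union>j\<in>{..n}. {\<omega> \<in> space M. 2 * \<epsilon> < \<bar>Y j \<omega>\<bar>})" by (auto simp: B_def)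
    also have "\<dots> \<in> sets M"
    proof (intro sets.finite_UN ballI)
      fix j assume "j \<in> {..n}"
      then have [measurable]: "Y j \<in> borel_measurable M" using int[of j] by simp
      show "{\<omega> \<in> space M. 2 * \<epsilon> < \<bar>Y j \<omega>\<bar>} \<in> sets M" by measurable
    qed simp
    finally show ?thesis .
  qed
  have igY: "integrable M (\<lambda>\<omega>. (Y n \<omega> - Y l \<omega>) * g l (h l \<omega>))" if l: "l \<le> n" for l
  proof (rule Bochner_Integration.integrable_bound[where f="\<lambda>\<omega>. Y n \<omega> - Y l \<omega>"])
    show "integrable M (\<lambda>\<omega>. Y n \<omega> - Y l \<omega>)" using int l by auto
    show "(\<lambda>\<omega>. (Y n \<omega> - Y l \<omega>) * g l (h l \<omega>)) \<in> borel_measurable M"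
      using int[of n] int[OF l] measurable_compose[OF hm[OF l] gm[of l]] by auto
    show "AE \<omega> in M. norm ((Y n \<omega> - Y l \<omega>) * g l (h l \<omega>)) \<le> norm (Y n \<omega> - Y l \<omega>)"
    proof (rule AE_I2)
      fix \<omega> show "norm ((Y n \<omega> - Y l \<omega>) * g l (h l \<omega>)) \<le> norm (Y n \<omega> - Y l \<omega>)"
        using mult_left_mono[OF gb[of l "h l \<omega>"], of "\<bar>Y n \<omega> - Y l \<omega>\<bar>"] by (simp add: abs_mult)
    qed
  qed
  \<comment> \<open>If the first exceedance is at \<open>l\<close>, the sum reduces to
    \<open>Y n * sgn (Y l) - \<bar>Y l\<bar>\<close>, which is below
    \<open>\<bar>Y n\<bar> - 2 * \<epsilon>\<close>; one \<epsilon> pays for the indicator. In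
    expectation the sum vanishes by the martingale property.\<close>
  have pt: "\<epsilon> * indicator B \<omega> + (\<Sum>l\<le>n. (Y n \<omega> - Y l \<omega>) * g l (h l \<omega>)) \<le> max 0 (\<bar>Y n \<omega>\<bar> - \<epsilon>)"
    if w: "\<omega> \<in> space M" for \<omega>
  proof (cases "\<exists>j\<le>n. 2 * \<epsilon> < \<bar>Y j \<omega>\<bar>")
    case True
    define l where "l = (LEAST j. 2 * \<epsilon> < \<bar>Y j \<omega>\<bar>)"
    have l: "2 * \<epsilon> < \<bar>Y l \<omega>\<bar>" "l \<le> n" unfolding l_def using True by (auto intro: LeastI Least_le order_trans)
    have lmin: "\<bar>Y j \<omega>\<bar> \<le> 2 * \<epsilon>" if "j < l" for j using that not_less_Least unfolding l_def by force
    have "g j (h j \<omega>) = 0" if "j \<noteq> l" for j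
    proof -
      have "\<not> F j (h j \<omega>)" unfolding Fh using that l(1) lmin by (metis linorder_neqE_nat not_less)
      then show ?thesis by (simp add: g_def)
    qed
    then have "(\<Sum>j\<le>n. (Y n \<omega> - Y j \<omega>) * g j (h j \<omega>)) = (\<Sum>j\<le>n. if j = l then (Y n \<omega> - Y l \<omega>) * g l (h l \<omega>) else 0)"
      by (intro sum.cong) auto
    also have "\<dots> = (Y n \<omega> - Y l \<omega>) * g l (h l \<omega>)" using l by simp
    also have "g l (h l \<omega>) = sgn (Y l \<omega>)" using l lmin by (simp add: g_def Fh) (simp add: h_def)
    also have "(Y n \<omega> - Y l \<omega>) * sgn (Y l \<omega>) = Y n \<omega> * sgn (Y l \<omega>) - \<bar>Y l \<omega>\<bar>" by (simp add: left_diff_distrib abs_sgn)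
    finally have s: "(\<Sum>j\<le>n. (Y n \<omega> - Y j \<omega>) * g j (h j \<omega>)) = Y n \<omega> * sgn (Y l \<omega>) - \<bar>Y l \<omega>\<bar>" .
    have "Y n \<omega> * sgn (Y l \<omega>) \<le> \<bar>Y n \<omega>\<bar>" by (simp add: sgn_if abs_ge_self abs_ge_minus_self)
    moreover have "indicator B \<omega> = (1::real)" using True w by (simp add: B_def)
    ultimately show ?thesis using l(1) s e by simp
  next
    case False
    then have "g j (h j \<omega>) = 0" if "j \<le> n" for j using that by (auto simp: g_def Fh)
    then have "(\<Sum>l\<le>n. (Y n \<omega> - Y l \<omega>) * g l (h l \<omega>)) = 0" by simp
    then show ?thesis using False by (simp add: B_def)
  qed
  have iB: "integrable M (indicator B :: 'a \<Rightarrow> real)" using Bs by (simp add: emeasure_eq_measure)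
  have im: "integrable M (\<lambda>\<omega>. max 0 (\<bar>Y n \<omega>\<bar> - \<epsilon>))" using int[of n] by simp
  have isum: "integrable M (\<lambda>\<omega>. \<Sum>l\<le>n. (Y n \<omega> - Y l \<omega>) * g l (h l \<omega>))"
    using igY by (intro Bochner_Integration.integrable_sum) auto
  have "\<epsilon> * prob B = expectation (\<lambda>\<omega>. \<epsilon> * indicator B \<omega> + (\<Sum>l\<le>n. (Y n \<omega> - Y l \<omega>) * g l (h l \<omega>)))"
  proof -
    have "expectation (\<lambda>\<omega>. \<Sum>l\<le>n. (Y n \<omega> - Y l \<omega>) * g l (h l \<omega>)) = (\<Sum>l\<le>n. expectation (\<lambda>\<omega>. (Y n \<omega> - Y l \<omega>) * g l (h l \<omega>)))"
      using igY by (intro Bochner_Integration.integral_sum) auto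
    also have "\<dots> = 0" unfolding h_def using mart[OF _ gm gb] by simp
    finally have z: "expectation (\<lambda>\<omega>. \<Sum>l\<le>n. (Y n \<omega> - Y l \<omega>) * g l (h l \<omega>)) = 0" .
    from isum have "expectation (\<lambda>\<omega>. \<epsilon> * indicator B \<omega> + (\<Sum>l\<le>n. (Y n \<omega> - Y l \<omega>) * g l (h l \<omega>)))
       = expectation (\<lambda>\<omega>. \<epsilon> * indicator B \<omega>) + expectation (\<lambda>\<omega>. \<Sum>l\<le>n. (Y n \<omega> - Y l \<omega>) * g l (h l \<omega>))"
      using iB by (intro Bochner_Integration.integral_add) auto
    then show ?thesis using z Bs by simp
  qed
  also have "\<dots> \<le> expectation (\<lambda>\<omega>. max 0 (\<bar>Y n \<omega>\<bar> - \<epsilon>))"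
    using iB im pt isum by (intro integral_mono Bochner_Integration.integrable_add) auto
  finally show ?thesis using e unfolding B_def[symmetric] by (simp add: field_simps)
qed

text \<open>Fubini's theorem as freezing of the second variable: it lets one particle move while the
  others are held fixed.\<close>

lemma (in prob_space) indep_var_expectation_zero:
  fixes h :: "'b \<times> 'b \<Rightarrow> real"
  assumes ind: "indep_var S A T B" and h: "h \<in> borel_measurable (S \<Otimes>\<^sub>M T)"
    and int: "integrable M (\<lambda>\<omega>. h (A \<omega>, B \<omega>))"
    and z: "\<And>b. b \<in> space T \<Longrightarrow> integral\<^sup>L M (\<lambda>\<omega>. h (A \<omega>, b)) = 0"
  shows "integral\<^sup>L M (\<lambda>\<omega>. h (A \<omega>, B \<omega>)) = 0"
proof -
  have [measurable]: "A \<in> M \<rightarrow>\<^sub>M S" "B \<in> M \<rightarrow>\<^sub>M T"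
    and d: "distr M S A \<Otimes>\<^sub>M distr M T B = distr M (S \<Otimes>\<^sub>M T) (\<lambda>x. (A x, B x))"
    using ind unfolding indep_var_distribution_eq by auto
  interpret A: prob_space "distr M S A" by (rule prob_space_distr) measurable
  interpret B: prob_space "distr M T B" by (rule prob_space_distr) measurable
  interpret pair_prob_space "distr M S A" "distr M T B" ..
  have m: "h \<in> borel_measurable (distr M S A \<Otimes>\<^sub>M distr M T B)" using h by simp
  have i: "integrable (distr M S A \<Otimes>\<^sub>M distr M T B) (case_prod (\<lambda>a b. h (a, b)))"
    unfolding d using int h by (subst integrable_distr_eq) (auto simp: case_prod_beta')
  have "integral\<^sup>L M (\<lambda>\<omega>. h (A \<omega>, B \<omega>)) = integral\<^sup>L (distr M S A \<Otimes>\<^sub>M distr M T B) (case_prod (\<lambda>a b. h (a, b)))"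
    unfolding d using h by (subst integral_distr) (auto simp: case_prod_beta')
  also have "\<dots> = (\<integral>b. (\<integral>a. h (a, b) \<partial>distr M S A) \<partial>distr M T B)"
    using integral_snd[OF i] by simp
  also have "\<dots> = (\<integral>b. 0 \<partial>distr M T B)"
  proof (intro Bochner_Integration.integral_cong refl)
    fix b assume b: "b \<in> space (distr M T B)"
    then have "(\<lambda>a. h (a, b)) \<in> borel_measurable S" using measurable_Pair1[OF h, of b] by simp
    then show "(\<integral>a. h (a, b) \<partial>distr M S A) = 0" using z b by (subst integral_distr) auto
  qed
  finally show ?thesis by simp
qed

text \<open>A strict inequality at \<open>t < v\<close> persists on a right neighbourhood, which
  contains the next point of every sufficiently fine dyadic grid. The endpoint \<open>v\<close> has
  no such neighbourhood in the interval, but it lies on every grid.\<close>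

lemma right_continuous_exceed_dyadic:
  fixes x :: "real \<Rightarrow> real"
  assumes uv: "u < v" and rc: "\<And>t. t \<in> {u..<v} \<Longrightarrow> (x \<longlongrightarrow> x t) (at_right t)"
    and t: "t \<in> {u..v}" "c < \<bar>x t - x u\<bar>"
  shows "\<exists>q::nat. \<exists>j\<le>2 ^ q. c < \<bar>x (u + (v - u) * real j / 2 ^ q) - x u\<bar>"
proof (cases "t = v")
  case True
  then show ?thesis using t by (intro exI[of _ 0] exI[of _ 1]) simp
next
  case False
  then have tm: "t \<in> {u..<v}" using t by auto
  have "((\<lambda>s. \<bar>x s - x u\<bar>) \<longlongrightarrow> \<bar>x t - x u\<bar>) (at_right t)" by (intro tendsto_intros rc tm)
  then have "eventually (\<lambda>s. c < \<bar>x s - x u\<bar>) (at_right t)" using t(2) by (rule order_tendstoD(1))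
  then obtain b where b: "b > t" "\<And>s. s > t \<Longrightarrow> s < b \<Longrightarrow> c < \<bar>x s - x u\<bar>"
    unfolding eventually_at_right_field by auto
  define d where "d = min b v - t"
  have d: "d > 0" using b tm by (simp add: d_def)
  obtain q where q: "(v - u) / d < 2 ^ q" using real_arch_pow[of 2 "(v - u) / d"] by auto
  define y where "y = (t - u) * 2 ^ q / (v - u)"
  define j where "j = nat (\<lfloor>y\<rfloor> + 1)"
  have y0: "0 \<le> y" using tm uv by (simp add: y_def)
  have j: "y < real j" "real j \<le> y + 1" unfolding j_def using y0 by linarith+
  have tt: "t = u + (v - u) * y / 2 ^ q" using uv by (simp add: y_def)
  define s where "s = u + (v - u) * real j / 2 ^ q"
  have "(v - u) / 2 ^ q < d" using q d by (simp add: field_simps)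
  moreover have "s \<le> t + (v - u) / 2 ^ q"
  proof -
    have "(v - u) * real j / 2 ^ q \<le> (v - u) * (y + 1) / 2 ^ q" using j uv by (intro divide_right_mono mult_left_mono) auto
    then show ?thesis by (simp add: s_def tt distrib_left add_divide_distrib)
  qed
  ultimately have s: "s < b" "s < v" by (auto simp: d_def)
  have ts: "t < s" unfolding s_def tt using j uv by (simp add: divide_strict_right_mono)
  have "(v - u) * (real j / 2 ^ q) < (v - u) * 1" using s(2) by (simp add: s_def)
  then have "real j / 2 ^ q < 1" using uv by (subst (asm) mult_less_cancel_left_pos) auto
  then have "real j < 2 ^ q" by simp
  then have "j \<le> 2 ^ q" by (metis less_imp_le of_nat_less_numeral_power_cancel_iff of_nat_numeral of_nat_power of_nat_less_iff)
  then show ?thesis using b(2)[OF ts s(1)] unfolding s_def by blast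
qed

text \<open>Exceedances on successive dyadic grids form an increasing sequence of events, so their
  union inherits the bound \<open>K\<close>. This union is a measurable exceptional set covering
  uncountably many times.\<close>

lemma (in prob_space) right_continuous_maximal_inequality:
  fixes W :: "real \<Rightarrow> 'a \<Rightarrow> real"
  assumes uv: "u < v" and e: "\<epsilon> > 0"
    and m: "\<And>t. t \<in> {u..v} \<Longrightarrow> W t \<in> borel_measurable M"
    and rc: "\<And>\<omega> t. \<omega> \<in> space M \<Longrightarrow> t \<in> {u..<v} \<Longrightarrow> ((\<lambda>t. W t \<omega>) \<longlongrightarrow> W t \<omega>) (at_right t)"
    and bound: "\<And>q. prob {\<omega> \<in> space M. \<exists>j\<le>2 ^ q. 2 * \<epsilon> < \<bar>W (u + (v - u) * real j / 2 ^ q) \<omega> - W u \<omega>\<bar>} \<le> K"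
  shows "\<exists>A\<in>sets M. prob A \<le> K \<and> (\<forall>\<omega>\<in>space M - A. \<forall>t\<in>{u..v}. \<bar>W t \<omega> - W u \<omega>\<bar> \<le> 2 * \<epsilon>)"
proof -
  define D where "D = (\<lambda>q. {\<omega> \<in> space M. \<exists>j\<le>(2::nat) ^ q. 2 * \<epsilon> < \<bar>W (u + (v - u) * real j / 2 ^ q) \<omega> - W u \<omega>\<bar>})"
  have gm: "u + (v - u) * real j / 2 ^ q \<in> {u..v}" if "j \<le> 2 ^ q" for j q
  proof -
    have "real j \<le> 2 ^ q" using that by (metis of_nat_le_iff of_nat_numeral of_nat_power)
    then have "(v - u) * (real j / 2 ^ q) \<le> (v - u) * 1" using uv by (intro mult_left_mono) auto
    then show ?thesis using uv by auto
  qed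
  have Ds: "D q \<in> sets M" for q
  proof -
    have "D q = (\<Union>j\<in>{..2 ^ q}. {\<omega> \<in> space M. 2 * \<epsilon> < \<bar>W (u + (v - u) * real j / 2 ^ q) \<omega> - W u \<omega>\<bar>})" by (auto simp: D_def)
    also have "\<dots> \<in> sets M"
    proof (intro sets.finite_UN ballI)
      fix j assume "j \<in> {..(2::nat) ^ q}"
      then have [measurable]: "W (u + (v - u) * real j / 2 ^ q) \<in> borel_measurable M" using m gm by blast
      have [measurable]: "W u \<in> borel_measurable M" using m uv by simp
      show "{\<omega> \<in> space M. 2 * \<epsilon> < \<bar>W (u + (v - u) * real j / 2 ^ q) \<omega> - W u \<omega>\<bar>} \<in> sets M" by measurable
    qed simp
    finally show ?thesis .
  qed
  have "incseq D"
  proof (rule incseq_SucI, rule subsetI)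
    fix q \<omega> assume "\<omega> \<in> D q"
    then obtain j where j: "\<omega> \<in> space M" "j \<le> 2 ^ q" "2 * \<epsilon> < \<bar>W (u + (v - u) * real j / 2 ^ q) \<omega> - W u \<omega>\<bar>" by (auto simp: D_def)
    have "(v - u) * real (2 * j) / 2 ^ Suc q = (v - u) * real j / 2 ^ q" by simp
    then have "2 * \<epsilon> < \<bar>W (u + (v - u) * real (2 * j) / 2 ^ Suc q) \<omega> - W u \<omega>\<bar>" using j(3) by simp
    moreover have "2 * j \<le> 2 ^ Suc q" using j(2) by simp
    ultimately show "\<omega> \<in> D (Suc q)" using j(1) unfolding D_def by blast
  qed
  then have "(\<lambda>q. prob (D q)) \<longlonglongrightarrow> prob (\<Union>q. D q)"
    using Ds by (intro finite_Lim_measure_incseq) auto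
  moreover have "prob (D q) \<le> K" for q using bound[of q] by (simp add: D_def)
  ultimately have "prob (\<Union>q. D q) \<le> K" by (intro LIMSEQ_le_const2) auto
  moreover have "\<bar>W t \<omega> - W u \<omega>\<bar> \<le> 2 * \<epsilon>" if w: "\<omega> \<in> space M - (\<Union>q. D q)" and t: "t \<in> {u..v}" for \<omega> t
  proof (rule ccontr)
    assume "\<not> \<bar>W t \<omega> - W u \<omega>\<bar> \<le> 2 * \<epsilon>"
    then have "\<exists>q::nat. \<exists>j\<le>2 ^ q. 2 * \<epsilon> < \<bar>W (u + (v - u) * real j / 2 ^ q) \<omega> - W u \<omega>\<bar>"
      using w by (intro right_continuous_exceed_dyadic[OF uv rc t]) auto
    then show False using w by (auto simp: D_def)
  qed
  moreover have "(\<Union>q. D q) \<in> sets M" using Ds by blast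
  ultimately show ?thesis by blast
qed

section \<open>Gaussian laws recognised by their characteristic functions\<close>

lemma gauss_second_moment:
  "integrable gauss_seq (\<lambda>\<omega>. (\<omega> i)\<^sup>2)" "integral\<^sup>L gauss_seq (\<lambda>\<omega>. (\<omega> i)\<^sup>2) = 1"
proof -
  have m: "(\<lambda>\<omega>. \<omega> i) \<in> gauss_seq \<rightarrow>\<^sub>M borel" by measurable
  have "integrable (distr gauss_seq borel (\<lambda>\<omega>. \<omega> i)) (\<lambda>x. x\<^sup>2)"
    unfolding gauss_component_distr by (rule integrable_std_normal_distribution_moment)
  then show "integrable gauss_seq (\<lambda>\<omega>. (\<omega> i)\<^sup>2)" by (subst (asm) integrable_distr_eq[OF m]) auto
  have "integral\<^sup>L (distr gauss_seq borel (\<lambda>\<omega>. \<omega> i)) (\<lambda>x. x\<^sup>2) = 1"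
    unfolding gauss_component_distr using std_normal_distribution_even_moments(1)[of 1]
    by (simp add: fact_numeral)
  then show "integral\<^sup>L gauss_seq (\<lambda>\<omega>. (\<omega> i)\<^sup>2) = 1" by (subst (asm) integral_distr[OF m]) auto
qed

context prob_space
begin

context
  fixes Z :: "'a \<Rightarrow> real" and v :: real
  assumes Z: "Z \<in> borel_measurable M" and v: "v \<ge> 0"
    and ch: "\<And>u. (CLINT \<omega>|M. iexp (u * Z \<omega>)) = exp (- (u\<^sup>2 * v / 2))"
begin

text \<open>By Levy's uniqueness theorem \<open>Z\<close> has the law of a scaled coordinate of
  \<open>gauss_seq\<close>, so that its moments and, for \<open>v > 0\<close>, its density come from
  the standard normal law.\<close>

lemma gaussian_char_distr: "distr M borel Z = distr gauss_seq borel (\<lambda>\<omega>. sqrt v * \<omega> 0)"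
proof (rule Levy_uniqueness)
  show "real_distribution (distr M borel Z)" using Z by simp
  show "real_distribution (distr gauss_seq borel (\<lambda>\<omega>. sqrt v * \<omega> 0))" by (rule gauss.real_distribution_distr) simp
  show "char (distr M borel Z) = char (distr gauss_seq borel (\<lambda>\<omega>. sqrt v * \<omega> 0))"
  proof
    fix u
    have "char (distr M borel Z) u = exp (- (u\<^sup>2 * v / 2))"
      unfolding char_def using Z ch[of u] by (subst integral_distr) auto
    moreover have "char (distr gauss_seq borel (\<lambda>\<omega>. sqrt v * \<omega> 0)) u = (CLINT \<omega>|gauss_seq. iexp ((u * sqrt v) * \<omega> 0))"
      unfolding char_def by (subst integral_distr) (auto simp: mult.assoc)
    moreover have "\<dots> = exp (- (u\<^sup>2 * v / 2))"
      unfolding gauss_char_component using v by (simp add: power_mult_distrib)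
    ultimately show "char (distr M borel Z) u = char (distr gauss_seq borel (\<lambda>\<omega>. sqrt v * \<omega> 0)) u" by simp
  qed
qed

lemma gaussian_char_integral:
  assumes h: "h \<in> borel_measurable borel"
  shows "integrable M (\<lambda>\<omega>. h (Z \<omega>) :: real) \<longleftrightarrow> integrable gauss_seq (\<lambda>\<omega>. h (sqrt v * \<omega> 0))"
    "integral\<^sup>L M (\<lambda>\<omega>. h (Z \<omega>)) = integral\<^sup>L gauss_seq (\<lambda>\<omega>. h (sqrt v * \<omega> 0))"
proof -
  have "integrable M (\<lambda>\<omega>. h (Z \<omega>)) \<longleftrightarrow> integrable (distr M borel Z) h"
    using integrable_distr_eq[OF Z h] by simp
  also have "\<dots> \<longleftrightarrow> integrable gauss_seq (\<lambda>\<omega>. h (sqrt v * \<omega> 0))"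
    unfolding gaussian_char_distr using h by (subst integrable_distr_eq) auto
  finally show "integrable M (\<lambda>\<omega>. h (Z \<omega>)) \<longleftrightarrow> integrable gauss_seq (\<lambda>\<omega>. h (sqrt v * \<omega> 0))" .
  have "integral\<^sup>L M (\<lambda>\<omega>. h (Z \<omega>)) = integral\<^sup>L (distr M borel Z) h"
    using integral_distr[OF Z h] by simp
  also have "\<dots> = integral\<^sup>L gauss_seq (\<lambda>\<omega>. h (sqrt v * \<omega> 0))"
    unfolding gaussian_char_distr using h by (subst integral_distr) auto
  finally show "integral\<^sup>L M (\<lambda>\<omega>. h (Z \<omega>)) = integral\<^sup>L gauss_seq (\<lambda>\<omega>. h (sqrt v * \<omega> 0))" .
qed

lemma gaussian_char_moments:
  "integrable M (\<lambda>\<omega>. (Z \<omega>)\<^sup>2)" "integral\<^sup>L M (\<lambda>\<omega>. (Z \<omega>)\<^sup>2) = v"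
  "integrable M (\<lambda>\<omega>. (Z \<omega>) ^ 4)" "integral\<^sup>L M (\<lambda>\<omega>. (Z \<omega>) ^ 4) = 3 * v\<^sup>2"
proof -
  have v4: "sqrt v ^ 4 = v\<^sup>2" using v by (metis real_sqrt_pow2 power_mult numeral_Bit0 mult_2_right mult_2)
  show "integrable M (\<lambda>\<omega>. (Z \<omega>)\<^sup>2)" "integral\<^sup>L M (\<lambda>\<omega>. (Z \<omega>)\<^sup>2) = v"
    using gaussian_char_integral[of "\<lambda>x. x\<^sup>2"] gauss_second_moment[of 0] v by (simp_all add: power_mult_distrib)
  show "integrable M (\<lambda>\<omega>. (Z \<omega>) ^ 4)" "integral\<^sup>L M (\<lambda>\<omega>. (Z \<omega>) ^ 4) = 3 * v\<^sup>2"
    using gaussian_char_integral[of "\<lambda>x. x ^ 4"] gauss_fourth_moment[of 0] v4 by (simp_all add: power_mult_distrib)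
qed

lemma gaussian_char_imp_gaussian_rv: "gaussian_rv M Z 0 v"
proof (cases "v = 0")
  case True
  then have "integral\<^sup>L M (\<lambda>\<omega>. (Z \<omega>)\<^sup>2) = 0" using gaussian_char_moments(2) by simp
  then have "AE \<omega> in M. (Z \<omega>)\<^sup>2 = 0"
    using integral_nonneg_eq_0_iff_AE[OF gaussian_char_moments(1)] by simp
  then show ?thesis using True Z by (simp add: gaussian_rv_def)
next
  case False
  then have v0: "v > 0" using v by simp
  have "distr gauss_seq lborel (\<lambda>\<omega>. \<omega> 0) = distr gauss_seq borel (\<lambda>\<omega>. \<omega> 0)" by (rule distr_cong) auto
  then have "distributed gauss_seq lborel (\<lambda>\<omega>. \<omega> 0) std_normal_density"
    by (simp add: distributed_def gauss_component_distr)
  from gauss.normal_density_affine[OF this, of "sqrt v" 0]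
  have "distributed gauss_seq lborel (\<lambda>\<omega>. sqrt v * \<omega> 0) (normal_density 0 (sqrt v))" using v0 by simp
  then have "distr gauss_seq lborel (\<lambda>\<omega>. sqrt v * \<omega> 0) = density lborel (normal_density 0 (sqrt v))"
    by (simp add: distributed_def)
  moreover have "distr gauss_seq lborel (\<lambda>\<omega>. sqrt v * \<omega> 0) = distr gauss_seq borel (\<lambda>\<omega>. sqrt v * \<omega> 0)" by (rule distr_cong) auto
  moreover have "distr M lborel Z = distr M borel Z" by (rule distr_cong) auto
  ultimately have "distr M lborel Z = density lborel (normal_density 0 (sqrt v))" using gaussian_char_distr by simp
  then have "distributed M lborel Z (normal_density 0 (sqrt v))" using Z by (simp add: distributed_def)
  then show ?thesis using v0 by (simp add: gaussian_rv_def)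
qed

end

text \<open>One complex limit of \<open>iexp\<close> thus gives the real limits for every phase
  \<open>c\<close>, as the trigonometric polynomials require.\<close>

lemma expectation_cos_eq:
  assumes Z: "Z \<in> borel_measurable M"
  shows "expectation (\<lambda>\<omega>. cos (Z \<omega> + c)) = Re ((CLINT \<omega>|M. iexp (Z \<omega>)) * iexp c)"
proof -
  have i: "integrable M (\<lambda>\<omega>. iexp (Z \<omega>))" using Z by (intro integrable_iexp) auto
  have e: "cos (Z \<omega> + c) = Re (iexp (Z \<omega>) * iexp c)" for \<omega>
    by (simp add: cis_conv_exp[symmetric] cis_mult)
  have "expectation (\<lambda>\<omega>. cos (Z \<omega> + c)) = Re (CLINT \<omega>|M. iexp (Z \<omega>) * iexp c)"
    unfolding e using i by (subst integral_Re) auto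
  then show ?thesis using i by simp
qed

end

text \<open>Weak convergence handles bounded functions only, so the excess is cut at
  \<open>R\<close>; what lies above is paid for by the second moment, which is bounded in
  \<open>N\<close>.\<close>

lemma excess_le_truncated:
  fixes z \<epsilon> R :: real assumes "\<epsilon> > 0" "R > 0"
  shows "max 0 (\<bar>z\<bar> - \<epsilon>) \<le> min (max 0 (\<bar>z\<bar> - \<epsilon>)) R + z\<^sup>2 / R"
proof (cases "max 0 (\<bar>z\<bar> - \<epsilon>) \<le> R")
  case True
  moreover have "0 \<le> z\<^sup>2 / R" using assms by simp
  ultimately show ?thesis by (simp add: min_absorb1)
next
  case False
  then have "R \<le> \<bar>z\<bar>" using assms by auto
  then have "\<bar>z\<bar> * R \<le> \<bar>z\<bar> * \<bar>z\<bar>" by (intro mult_left_mono) auto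
  then have "\<bar>z\<bar> \<le> z\<^sup>2 / R" using assms by (simp add: le_divide_eq power2_eq_square)
  then show ?thesis using assms False by linarith
qed

text \<open>The fourth power is what turns a Gaussian limit of variance of order \<open>h\<close>
  into a bound of order \<open>h\<^sup>2\<close>.\<close>

lemma excess_le_fourth_power:
  fixes z \<epsilon> R :: real assumes e: "\<epsilon> > 0"
  shows "min (max 0 (\<bar>z\<bar> - \<epsilon>)) R \<le> z ^ 4 / \<epsilon> ^ 3"
proof (cases "\<bar>z\<bar> \<le> \<epsilon>")
  case True
  have "0 \<le> z ^ 4 / \<epsilon> ^ 3" using e by simp
  moreover have "min (max 0 (\<bar>z\<bar> - \<epsilon>)) R \<le> 0" using True by (simp add: min_le_iff_disj)
  ultimately show ?thesis by linarith
next
  case False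
  then show ?thesis using abs_le_fourth_power[OF e, of z] by linarith
qed

section \<open>The particle system\<close>

lemma (in prob_space) indep_sum_second_moment:
  fixes X :: "'i \<Rightarrow> 'a \<Rightarrow> real"
  assumes "finite I" "indep_vars (\<lambda>_. borel) X I"
    and "\<And>i. i \<in> I \<Longrightarrow> integrable M (X i)" "\<And>i. i \<in> I \<Longrightarrow> expectation (X i) = 0"
    and "\<And>i. i \<in> I \<Longrightarrow> integrable M (\<lambda>\<omega>. (X i \<omega>)\<^sup>2)"
  shows "integrable M (\<lambda>\<omega>. (\<Sum>i\<in>I. X i \<omega>)\<^sup>2) \<and> expectation (\<lambda>\<omega>. (\<Sum>i\<in>I. X i \<omega>)\<^sup>2) = (\<Sum>i\<in>I. expectation (\<lambda>\<omega>. (X i \<omega>)\<^sup>2))"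
  using assms
proof (induction I rule: finite_induct)
  case (insert j I)
  have IH: "integrable M (\<lambda>\<omega>. (\<Sum>i\<in>I. X i \<omega>)\<^sup>2)" "expectation (\<lambda>\<omega>. (\<Sum>i\<in>I. X i \<omega>)\<^sup>2) = (\<Sum>i\<in>I. expectation (\<lambda>\<omega>. (X i \<omega>)\<^sup>2))"
    using insert.IH[OF indep_vars_subset[OF insert.prems(1)]] insert.prems by auto
  have ind: "indep_var borel (X j) borel (\<lambda>\<omega>. \<Sum>i\<in>I. X i \<omega>)"
    by (rule indep_vars_sum[OF insert.hyps insert.prems(1)])
  have isum: "integrable M (\<lambda>\<omega>. \<Sum>i\<in>I. X i \<omega>)" using insert.prems by auto
  have ij: "integrable M (X j)" "expectation (X j) = 0" "integrable M (\<lambda>\<omega>. (X j \<omega>)\<^sup>2)" using insert.prems by auto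
  have p: "integrable M (\<lambda>\<omega>. X j \<omega> * (\<Sum>i\<in>I. X i \<omega>))" "expectation (\<lambda>\<omega>. X j \<omega> * (\<Sum>i\<in>I. X i \<omega>)) = 0"
    using indep_var_integrable[OF ind ij(1) isum] indep_var_lebesgue_integral[OF ind ij(1) isum] ij(2) by auto
  have e: "(\<Sum>i\<in>insert j I. X i \<omega>)\<^sup>2 = (X j \<omega>)\<^sup>2 + 2 * (X j \<omega> * (\<Sum>i\<in>I. X i \<omega>)) + (\<Sum>i\<in>I. X i \<omega>)\<^sup>2" for \<omega>
    using insert.hyps by (simp add: power2_sum)
  show ?case unfolding e using p ij(3) IH insert.hyps by simp
qed simp

lemma abs_sum_powr_le:
  fixes u y :: "nat \<Rightarrow> real"
  assumes p: "p \<ge> 0"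
  shows "\<bar>\<Sum>j<m. u j * y j\<bar> powr p \<le> real m powr p * (\<Sum>j<m. \<bar>u j\<bar> powr p * \<bar>y j\<bar> powr p)"
proof (cases "m = 0")
  case False
  define a where "a = (MAX j\<in>{..<m}. \<bar>u j * y j\<bar>)"
  have fin: "finite ((\<lambda>j. \<bar>u j * y j\<bar>) ` {..<m})" "(\<lambda>j. \<bar>u j * y j\<bar>) ` {..<m} \<noteq> {}" using False by auto
  obtain i where i: "i < m" "a = \<bar>u i * y i\<bar>" unfolding a_def using Max_in[OF fin] by auto
  have "\<bar>\<Sum>j<m. u j * y j\<bar> \<le> (\<Sum>j<m. \<bar>u j * y j\<bar>)" by (rule sum_abs)
  also have "\<dots> \<le> (\<Sum>j<m. a)" unfolding a_def using fin by (intro sum_mono Max_ge) auto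
  finally have "\<bar>\<Sum>j<m. u j * y j\<bar> \<le> real m * a" by simp
  then have "\<bar>\<Sum>j<m. u j * y j\<bar> powr p \<le> (real m * a) powr p" using p by (intro powr_mono2) auto
  also have "\<dots> = real m powr p * (\<bar>u i\<bar> powr p * \<bar>y i\<bar> powr p)" unfolding i(2) abs_mult by (simp add: powr_mult)
  also have "\<dots> \<le> real m powr p * (\<Sum>j<m. \<bar>u j\<bar> powr p * \<bar>y j\<bar> powr p)"
    using i by (intro mult_left_mono member_le_sum[where f="\<lambda>j. \<bar>u j\<bar> powr p * \<bar>y j\<bar> powr p"]) auto
  finally show ?thesis .
qed simp

lemma abs_diff_one_powr_le:
  fixes x p :: real assumes "x \<ge> 0" "p \<ge> 0" shows "\<bar>x - 1\<bar> powr p \<le> x powr p + 1"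
proof -
  have "\<bar>x - 1\<bar> powr p \<le> (max x 1) powr p" using assms by (intro powr_mono2) auto
  also have "\<dots> \<le> x powr p + 1" by (cases "x \<le> 1") (auto simp: max_def)
  finally show ?thesis .
qed

locale levy_particles =
  fixes M0 :: "'b measure" and \<xi> :: "real \<Rightarrow> 'b \<Rightarrow> real"
    and M :: "'a measure" and \<xi>s :: "nat \<Rightarrow> real \<Rightarrow> 'a \<Rightarrow> real"
  assumes levy: "levy_process M0 \<xi>"
    and mgf: "\<And>u. integrable M0 (\<lambda>\<omega>. exp (u * \<xi> 1 \<omega>))"
    and nonconst: "\<not> (\<exists>c. AE \<omega> in M0. \<xi> 1 \<omega> = c)"
    and Mprob: "prob_space M"
    and copies: "\<And>i. i \<ge> 1 \<Longrightarrow> levy_process M (\<xi>s i) \<and> path_law M (\<xi>s i) = path_law M0 \<xi>"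
    and indep: "prob_space.indep_vars M (\<lambda>_. Pi\<^sub>M {0..} (\<lambda>_. borel))
                  (\<lambda>i \<omega>. restrict (\<lambda>t. \<xi>s i t \<omega>) {0..}) {1..}"
begin

interpretation prob_space M by (rule Mprob)

abbreviation "\<psi> \<equiv> cumulant M0 \<xi>"

text \<open>Half the exponential growth rate of the second moment of the mean-one martingale
  \<open>exp (\<xi> t - \<psi> 1 * t)\<close>.\<close>

definition \<kappa> :: real where "\<kappa> = \<psi> 2 / 2 - \<psi> 1"

lemma \<kappa>_pos: "\<kappa> > 0"
  using cumulant_2_gt[where \<xi>=\<xi>, OF levy_prob_space[OF levy] mgf nonconst] by (simp add: \<kappa>_def)

abbreviation path_space :: "(real \<Rightarrow> real) measure" where "path_space \<equiv> Pi\<^sub>M {0..} (\<lambda>_. borel)"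

abbreviation path :: "nat \<Rightarrow> 'a \<Rightarrow> real \<Rightarrow> real" where "path i \<omega> \<equiv> restrict (\<lambda>t. \<xi>s i t \<omega>) {0..}"

lemma copy_levy: "i \<ge> 1 \<Longrightarrow> levy_process M (\<xi>s i)"
  using copies by blast

lemma path_measurable: "i \<ge> 1 \<Longrightarrow> path i \<in> M \<rightarrow>\<^sub>M path_space"
  using levy_measurable[OF copy_levy] by (intro measurable_restrict) auto

lemma path_distr: "i \<ge> 1 \<Longrightarrow> distr M path_space (path i) = path_law M0 \<xi>"
  using copies unfolding path_law_def by blast

lemma path_component[measurable]: "t \<ge> 0 \<Longrightarrow> (\<lambda>p. p t) \<in> path_space \<rightarrow>\<^sub>M borel"
  by (intro measurable_component_singleton) auto

text \<open>The copies share with the reference process only their path law, so distributional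
  identities between particles pass through measurable functionals of a path.\<close>

lemma path_functional_distr:
  assumes "i \<ge> 1" "H \<in> path_space \<rightarrow>\<^sub>M borel"
  shows "distr M borel (\<lambda>\<omega>. H (path i \<omega>)) = distr (path_law M0 \<xi>) borel H"
  using distr_distr[OF assms(2) path_measurable[OF assms(1)]] unfolding path_distr[OF assms(1)] comp_def by simp

lemma copy_distr_1: assumes "i \<ge> 1" shows "distr M borel (\<xi>s i 1) = distr M0 borel (\<xi> 1)"
proof -
  have "(\<lambda>\<omega>. restrict (\<lambda>t. \<xi> t \<omega>) {0..}) \<in> M0 \<rightarrow>\<^sub>M path_space"
    using levy_measurable[OF levy] by (intro measurable_restrict) auto
  then have "distr (path_law M0 \<xi>) borel (\<lambda>p. p 1) = distr M0 borel (\<xi> 1)"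
    unfolding path_law_def by (subst distr_distr) (auto simp: comp_def)
  moreover have "distr M borel (\<xi>s i 1) = distr (path_law M0 \<xi>) borel (\<lambda>p. p 1)"
    using path_functional_distr[OF assms, of "\<lambda>p. p 1"] by simp
  ultimately show ?thesis by simp
qed

lemma copy_mgf:
  assumes i: "i \<ge> 1"
  shows "integrable M (\<lambda>\<omega>. exp (u * \<xi>s i 1 \<omega>))" "cumulant M (\<xi>s i) u = \<psi> u"
proof -
  have m: "\<xi>s i 1 \<in> borel_measurable M" "\<xi> 1 \<in> borel_measurable M0"
    using levy_measurable[OF copy_levy[OF i]] levy_measurable[OF levy] by auto
  have "integrable (distr M0 borel (\<xi> 1)) (\<lambda>x. exp (u * x))"
    using mgf[of u] m by (subst integrable_distr_eq) auto
  then show "integrable M (\<lambda>\<omega>. exp (u * \<xi>s i 1 \<omega>))"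
    unfolding copy_distr_1[OF i, symmetric] using m by (subst (asm) integrable_distr_eq) auto
  have "integral\<^sup>L M (\<lambda>\<omega>. exp (u * \<xi>s i 1 \<omega>)) = integral\<^sup>L (distr M borel (\<xi>s i 1)) (\<lambda>x. exp (u * x))"
    using m by (subst integral_distr) auto
  also have "\<dots> = integral\<^sup>L M0 (\<lambda>\<omega>. exp (u * \<xi> 1 \<omega>))"
    unfolding copy_distr_1[OF i] using m by (subst integral_distr) auto
  finally show "cumulant M (\<xi>s i) u = \<psi> u" by (simp add: cumulant_def)
qed

definition expo :: "nat \<Rightarrow> real \<Rightarrow> 'a \<Rightarrow> real" where
  "expo i r \<omega> = exp (\<xi>s i r \<omega> - \<psi> 1 * r)"

lemma expo_measurable: "i \<ge> 1 \<Longrightarrow> r \<ge> 0 \<Longrightarrow> expo i r \<in> borel_measurable M"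
  unfolding expo_def using levy_measurable[OF copy_levy, of i r] by simp

lemma expo_moment:
  assumes i: "i \<ge> 1" and r: "r \<ge> 0"
  shows "integrable M (\<lambda>\<omega>. expo i r \<omega> powr p)" "expectation (\<lambda>\<omega>. expo i r \<omega> powr p) = exp (r * (\<psi> p - p * \<psi> 1))"
proof -
  have e: "expo i r \<omega> powr p = exp (- (p * \<psi> 1 * r)) * exp (p * \<xi>s i r \<omega>)" for \<omega>
    by (simp add: expo_def powr_def exp_add[symmetric] algebra_simps)
  note m = levy_exp_moment[OF copy_levy[OF i] copy_mgf(1)[OF i] r, of p]
  show "integrable M (\<lambda>\<omega>. expo i r \<omega> powr p)" unfolding e using m by simp
  show "expectation (\<lambda>\<omega>. expo i r \<omega> powr p) = exp (r * (\<psi> p - p * \<psi> 1))"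
  proof -
    have "expectation (\<lambda>\<omega>. exp (- (p * \<psi> 1 * r)) * exp (p * \<xi>s i r \<omega>)) = exp (- (p * \<psi> 1 * r)) * exp (r * \<psi> p)"
      using m by (simp add: copy_mgf(2)[OF i])
    also have "\<dots> = exp (r * (\<psi> p - p * \<psi> 1))" unfolding exp_add[symmetric] by (simp add: algebra_simps)
    finally show ?thesis unfolding e .
  qed
qed

lemma expo_mean:
  assumes i: "i \<ge> 1" and r: "r \<ge> 0"
  shows "integrable M (expo i r)" "expectation (expo i r) = 1"
proof -
  have "expo i r \<omega> powr 1 = expo i r \<omega>" for \<omega> by (simp add: expo_def)
  then show "integrable M (expo i r)" "expectation (expo i r) = 1" using expo_moment[OF i r, of 1] by simp_all
qed

lemma expo_product:
  assumes i: "i \<ge> 1" and r: "0 < r" "0 < r'"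
  shows "integrable M (\<lambda>\<omega>. expo i r \<omega> * expo i r' \<omega>)" "expectation (\<lambda>\<omega>. expo i r \<omega> * expo i r' \<omega>) = exp (2 * \<kappa> * min r r')"
proof -
  have *: "integrable M (\<lambda>\<omega>. expo i r \<omega> * expo i r' \<omega>) \<and> expectation (\<lambda>\<omega>. expo i r \<omega> * expo i r' \<omega>) = exp (2 * \<kappa> * r)"
    if r: "0 < r" "r \<le> r'" for r r'
  proof -
    have e: "expo i r \<omega> * expo i r' \<omega> = exp (- \<psi> 1 * (r + r')) * (exp (\<xi>s i r \<omega>) * exp (\<xi>s i r' \<omega>))" for \<omega>
      by (simp add: expo_def exp_add[symmetric] algebra_simps)
    note m = levy_exp_product[OF copy_levy[OF i] copy_mgf(1)[OF i] r]
    have "expectation (\<lambda>\<omega>. exp (- \<psi> 1 * (r + r')) * (exp (\<xi>s i r \<omega>) * exp (\<xi>s i r' \<omega>)))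
        = exp (- \<psi> 1 * (r + r')) * exp (r * \<psi> 2 + (r' - r) * \<psi> 1)"
      using m by (simp add: copy_mgf(2)[OF i])
    also have "\<dots> = exp (2 * \<kappa> * r)" unfolding exp_add[symmetric] by (simp add: \<kappa>_def algebra_simps)
    finally show ?thesis unfolding e using m(1) by simp
  qed
  show "integrable M (\<lambda>\<omega>. expo i r \<omega> * expo i r' \<omega>)" "expectation (\<lambda>\<omega>. expo i r \<omega> * expo i r' \<omega>) = exp (2 * \<kappa> * min r r')"
    using *[of r r'] *[of r' r] r by (cases "r \<le> r'"; simp add: min_def mult.commute)+
qed

text \<open>The factor \<open>exp (- \<kappa> * \<sigma>)\<close> compensates the growth of the
  standard deviation up to time \<sigma>, so that covariances stay bounded as \<sigma>
  grows.\<close>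

definition pert :: "real \<Rightarrow> nat \<Rightarrow> real \<Rightarrow> 'a \<Rightarrow> real" where
  "pert \<sigma> i t \<omega> = exp (- \<kappa> * \<sigma>) * (expo i (\<sigma> + t) \<omega> - 1)"

lemma pert_mean:
  assumes "i \<ge> 1" "\<sigma> + t \<ge> 0"
  shows "integrable M (pert \<sigma> i t)" "expectation (pert \<sigma> i t) = 0"
  unfolding pert_def using expo_mean[OF assms] by (simp_all add: prob_space)

lemma pert_product:
  assumes i: "i \<ge> 1" and t: "\<sigma> + t > 0" "\<sigma> + t' > 0"
  shows "integrable M (\<lambda>\<omega>. pert \<sigma> i t \<omega> * pert \<sigma> i t' \<omega>)"
    "expectation (\<lambda>\<omega>. pert \<sigma> i t \<omega> * pert \<sigma> i t' \<omega>) = exp (2 * \<kappa> * min t t') - exp (- 2 * \<kappa> * \<sigma>)"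
proof -
  have e: "pert \<sigma> i t \<omega> * pert \<sigma> i t' \<omega> = exp (- 2 * \<kappa> * \<sigma>) * (expo i (\<sigma> + t) \<omega> * expo i (\<sigma> + t') \<omega> - expo i (\<sigma> + t) \<omega> - expo i (\<sigma> + t') \<omega> + 1)" for \<omega>
  proof -
    have "exp (- 2 * \<kappa> * \<sigma>) = exp (- \<kappa> * \<sigma>) * exp (- \<kappa> * \<sigma>)" unfolding exp_add[symmetric] by simp
    then show ?thesis unfolding pert_def by (simp only:) (simp add: left_diff_distrib right_diff_distrib distrib_left mult_ac)
  qed
  note m = expo_product[OF i t] expo_mean[OF i less_imp_le[OF t(1)]] expo_mean[OF i less_imp_le[OF t(2)]]
  show "integrable M (\<lambda>\<omega>. pert \<sigma> i t \<omega> * pert \<sigma> i t' \<omega>)" unfolding e using m by simp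
  have "expectation (\<lambda>\<omega>. pert \<sigma> i t \<omega> * pert \<sigma> i t' \<omega>) = exp (- 2 * \<kappa> * \<sigma>) * (exp (2 * \<kappa> * min (\<sigma> + t) (\<sigma> + t')) - 1)"
    unfolding e using m by (simp add: prob_space)
  also have "min (\<sigma> + t) (\<sigma> + t') = \<sigma> + min t t'" by (simp add: min_def)
  finally show "expectation (\<lambda>\<omega>. pert \<sigma> i t \<omega> * pert \<sigma> i t' \<omega>) = exp (2 * \<kappa> * min t t') - exp (- 2 * \<kappa> * \<sigma>)"
    by (simp add: right_diff_distrib exp_add[symmetric] algebra_simps)
qed

text \<open>By the choice of \<open>\<kappa>\<close> the terms in \<open>\<psi> 1\<close> cancel
  from the growth rate in \<sigma>, which becomes \<open>\<psi> p - p / 2 * \<psi> 2\<close>, the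
  quantity of the Lyapunov condition.\<close>

lemma pert_moment:
  assumes i: "i \<ge> 1" and t: "\<sigma> + t \<ge> 0" and p: "p \<ge> 0"
  shows "integrable M (\<lambda>\<omega>. \<bar>pert \<sigma> i t \<omega>\<bar> powr p)"
    "expectation (\<lambda>\<omega>. \<bar>pert \<sigma> i t \<omega>\<bar> powr p) \<le> exp (\<sigma> * (\<psi> p - p / 2 * \<psi> 2)) * exp (t * (\<psi> p - p * \<psi> 1)) + exp (- p * \<kappa> * \<sigma>)"
proof -
  have b: "\<bar>pert \<sigma> i t \<omega>\<bar> powr p \<le> exp (- p * \<kappa> * \<sigma>) * (expo i (\<sigma> + t) \<omega> powr p + 1)" for \<omega>
  proof -
    have "\<bar>pert \<sigma> i t \<omega>\<bar> powr p = exp (- p * \<kappa> * \<sigma>) * \<bar>expo i (\<sigma> + t) \<omega> - 1\<bar> powr p"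
      by (simp add: pert_def abs_mult powr_mult exp_powr_real mult_ac)
    also have "\<dots> \<le> exp (- p * \<kappa> * \<sigma>) * (expo i (\<sigma> + t) \<omega> powr p + 1)"
      using p by (intro mult_left_mono abs_diff_one_powr_le) (auto simp: expo_def)
    finally show ?thesis .
  qed
  note m = expo_moment[OF i t, of p]
  have ib: "integrable M (\<lambda>\<omega>. exp (- p * \<kappa> * \<sigma>) * (expo i (\<sigma> + t) \<omega> powr p + 1))" using m by simp
  have [measurable]: "expo i (\<sigma> + t) \<in> borel_measurable M" by (rule expo_measurable[OF i t])
  show int: "integrable M (\<lambda>\<omega>. \<bar>pert \<sigma> i t \<omega>\<bar> powr p)"
  proof (rule Bochner_Integration.integrable_bound[OF ib])
    show "(\<lambda>\<omega>. \<bar>pert \<sigma> i t \<omega>\<bar> powr p) \<in> borel_measurable M" unfolding pert_def by measurable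
    show "AE \<omega> in M. norm (\<bar>pert \<sigma> i t \<omega>\<bar> powr p) \<le> norm (exp (- p * \<kappa> * \<sigma>) * (expo i (\<sigma> + t) \<omega> powr p + 1))"
    proof (rule AE_I2)
      fix \<omega> show "norm (\<bar>pert \<sigma> i t \<omega>\<bar> powr p) \<le> norm (exp (- p * \<kappa> * \<sigma>) * (expo i (\<sigma> + t) \<omega> powr p + 1))"
        unfolding real_norm_def abs_of_nonneg[OF powr_ge_zero] by (rule order_trans[OF b abs_ge_self])
    qed
  qed
  have "expectation (\<lambda>\<omega>. \<bar>pert \<sigma> i t \<omega>\<bar> powr p) \<le> expectation (\<lambda>\<omega>. exp (- p * \<kappa> * \<sigma>) * (expo i (\<sigma> + t) \<omega> powr p + 1))"
    using b by (intro integral_mono int ib)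
  also have "\<dots> = exp (- p * \<kappa> * \<sigma>) * (exp ((\<sigma> + t) * (\<psi> p - p * \<psi> 1)) + 1)" using m by (simp add: prob_space)
  also have "\<dots> = exp (\<sigma> * (\<psi> p - p / 2 * \<psi> 2)) * exp (t * (\<psi> p - p * \<psi> 1)) + exp (- p * \<kappa> * \<sigma>)"
  proof -
    have "- p * \<kappa> * \<sigma> + (\<sigma> + t) * (\<psi> p - p * \<psi> 1) = \<sigma> * (\<psi> p - p / 2 * \<psi> 2) + t * (\<psi> p - p * \<psi> 1)"
      by (simp add: \<kappa>_def algebra_simps)
    then show ?thesis unfolding distrib_left exp_add[symmetric] by simp
  qed
  finally show "expectation (\<lambda>\<omega>. \<bar>pert \<sigma> i t \<omega>\<bar> powr p) \<le> exp (\<sigma> * (\<psi> p - p / 2 * \<psi> 2)) * exp (t * (\<psi> p - p * \<psi> 1)) + exp (- p * \<kappa> * \<sigma>)" .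
qed

text \<open>A linear combination of \<open>pert\<close> values written as a functional of a single
  path, so that equality in law and independence of the paths carry over to it.\<close>

definition path_comb :: "real \<Rightarrow> nat \<Rightarrow> (nat \<Rightarrow> real) \<Rightarrow> (nat \<Rightarrow> real) \<Rightarrow> (real \<Rightarrow> real) \<Rightarrow> real" where
  "path_comb \<sigma> m u ts p = (\<Sum>j<m. u j * (exp (- \<kappa> * \<sigma>) * (exp (p (\<sigma> + ts j) - \<psi> 1 * (\<sigma> + ts j)) - 1)))"

lemma path_comb_measurable:
  assumes "\<And>j. j < m \<Longrightarrow> \<sigma> + ts j \<ge> 0"
  shows "path_comb \<sigma> m u ts \<in> path_space \<rightarrow>\<^sub>M borel"
  unfolding path_comb_def
proof (rule borel_measurable_sum)
  fix j assume "j \<in> {..<m}"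
  then have [measurable]: "(\<lambda>p. p (\<sigma> + ts j)) \<in> path_space \<rightarrow>\<^sub>M borel" using assms by (intro path_component) auto
  show "(\<lambda>p. u j * (exp (- \<kappa> * \<sigma>) * (exp (p (\<sigma> + ts j) - \<psi> 1 * (\<sigma> + ts j)) - 1))) \<in> borel_measurable path_space"
    by measurable
qed

lemma path_comb_path:
  assumes "\<And>j. j < m \<Longrightarrow> \<sigma> + ts j \<ge> 0"
  shows "path_comb \<sigma> m u ts (path i \<omega>) = (\<Sum>j<m. u j * pert \<sigma> i (ts j) \<omega>)"
  unfolding path_comb_def pert_def expo_def using assms by (intro sum.cong) auto

lemma pert_comb_indep:
  fixes m :: nat
  assumes "\<And>j. j < m \<Longrightarrow> \<sigma> + ts j \<ge> 0"
  shows "indep_vars (\<lambda>_. borel) (\<lambda>i \<omega>. \<Sum>j<m. u j * pert \<sigma> i (ts j) \<omega>) {1..N}"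
proof -
  have "indep_vars (\<lambda>_. path_space) path {1..N}"
    using indep by (rule indep_vars_subset) auto
  then have "indep_vars (\<lambda>_. borel) (\<lambda>i \<omega>. path_comb \<sigma> m u ts (path i \<omega>)) {1..N}"
    using path_comb_measurable[OF assms] by (rule indep_vars_compose2)
  then show ?thesis by (simp add: path_comb_path[OF assms])
qed

lemma pert_comb_second_moment:
  assumes i: "i \<ge> 1" and t: "\<And>j. j < m \<Longrightarrow> \<sigma> + ts j > 0"
  shows "integrable M (\<lambda>\<omega>. (\<Sum>j<m. u j * pert \<sigma> i (ts j) \<omega>)\<^sup>2)"
    "expectation (\<lambda>\<omega>. (\<Sum>j<m. u j * pert \<sigma> i (ts j) \<omega>)\<^sup>2)
       = (\<Sum>j<m. \<Sum>l<m. u j * u l * (exp (2 * \<kappa> * min (ts j) (ts l)) - exp (- 2 * \<kappa> * \<sigma>)))"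
proof -
  have e: "(\<Sum>j<m. u j * pert \<sigma> i (ts j) \<omega>)\<^sup>2 = (\<Sum>j<m. \<Sum>l<m. u j * u l * (pert \<sigma> i (ts j) \<omega> * pert \<sigma> i (ts l) \<omega>))" for \<omega>
    by (simp add: power2_eq_square sum_product mult_ac)
  have int: "integrable M (\<lambda>\<omega>. u j * u l * (pert \<sigma> i (ts j) \<omega> * pert \<sigma> i (ts l) \<omega>))" if "j < m" "l < m" for j l
    using pert_product(1)[OF i t t] that by simp
  show "integrable M (\<lambda>\<omega>. (\<Sum>j<m. u j * pert \<sigma> i (ts j) \<omega>)\<^sup>2)"
    unfolding e using int by (intro Bochner_Integration.integrable_sum) auto
  have "expectation (\<lambda>\<omega>. \<Sum>j<m. \<Sum>l<m. u j * u l * (pert \<sigma> i (ts j) \<omega> * pert \<sigma> i (ts l) \<omega>))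
      = (\<Sum>j<m. \<Sum>l<m. expectation (\<lambda>\<omega>. u j * u l * (pert \<sigma> i (ts j) \<omega> * pert \<sigma> i (ts l) \<omega>)))"
  proof (subst Bochner_Integration.integral_sum)
    show "integrable M (\<lambda>\<omega>. \<Sum>l<m. u j * u l * (pert \<sigma> i (ts j) \<omega> * pert \<sigma> i (ts l) \<omega>))" if "j \<in> {..<m}" for j
      using int that by (intro Bochner_Integration.integrable_sum) auto
    show "(\<Sum>j<m. expectation (\<lambda>\<omega>. \<Sum>l<m. u j * u l * (pert \<sigma> i (ts j) \<omega> * pert \<sigma> i (ts l) \<omega>)))
      = (\<Sum>j<m. \<Sum>l<m. expectation (\<lambda>\<omega>. u j * u l * (pert \<sigma> i (ts j) \<omega> * pert \<sigma> i (ts l) \<omega>)))"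
      using int by (intro sum.cong refl Bochner_Integration.integral_sum) auto
  qed
  also have "\<dots> = (\<Sum>j<m. \<Sum>l<m. u j * u l * (exp (2 * \<kappa> * min (ts j) (ts l)) - exp (- 2 * \<kappa> * \<sigma>)))"
    using pert_product(2)[OF i t t] by (intro sum.cong refl) simp
  finally show "expectation (\<lambda>\<omega>. (\<Sum>j<m. u j * pert \<sigma> i (ts j) \<omega>)\<^sup>2)
       = (\<Sum>j<m. \<Sum>l<m. u j * u l * (exp (2 * \<kappa> * min (ts j) (ts l)) - exp (- 2 * \<kappa> * \<sigma>)))" unfolding e .
qed

definition W :: "real \<Rightarrow> nat \<Rightarrow> real \<Rightarrow> 'a \<Rightarrow> real" where
  "W \<sigma> N t \<omega> = (\<Sum>i\<in>{1..N}. pert \<sigma> i t \<omega>) / sqrt (real N)"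

lemma W_measurable: "\<sigma> + t \<ge> 0 \<Longrightarrow> W \<sigma> N t \<in> borel_measurable M"
  unfolding W_def using pert_mean(1) by (intro borel_measurable_divide borel_measurable_sum) auto

lemma W_integrable: "\<sigma> + t \<ge> 0 \<Longrightarrow> integrable M (W \<sigma> N t)"
  unfolding W_def using pert_mean(1) by (intro integrable_divide Bochner_Integration.integrable_sum) auto

lemma W_comb: "(\<Sum>j<m. u j * W \<sigma> N (ts j) \<omega>) = (\<Sum>i\<in>{1..N}. \<Sum>j<m. u j * pert \<sigma> i (ts j) \<omega>) / sqrt (real N)"
  unfolding W_def by (subst sum.swap) (simp add: sum_divide_distrib sum_distrib_left)

lemma W_comb_second_moment:
  fixes m :: nat
  assumes t: "\<And>j. j < m \<Longrightarrow> \<sigma> + ts j > 0" and N: "N > 0"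
  shows "integrable M (\<lambda>\<omega>. (\<Sum>j<m. u j * W \<sigma> N (ts j) \<omega>)\<^sup>2)"
    "expectation (\<lambda>\<omega>. (\<Sum>j<m. u j * W \<sigma> N (ts j) \<omega>)\<^sup>2)
      = (\<Sum>j<m. \<Sum>l<m. u j * u l * (exp (2 * \<kappa> * min (ts j) (ts l)) - exp (- 2 * \<kappa> * \<sigma>)))"
proof -
  have t0: "\<sigma> + ts j \<ge> 0" if "j < m" for j using t[OF that] by simp
  have e: "(\<Sum>j<m. u j * W \<sigma> N (ts j) \<omega>)\<^sup>2 = (\<Sum>i\<in>{1..N}. \<Sum>j<m. u j * pert \<sigma> i (ts j) \<omega>)\<^sup>2 / real N" for \<omega>
    unfolding W_comb by (simp add: power_divide)
  have i: "integrable M (\<lambda>\<omega>. \<Sum>j<m. u j * pert \<sigma> i (ts j) \<omega>)" "expectation (\<lambda>\<omega>. \<Sum>j<m. u j * pert \<sigma> i (ts j) \<omega>) = 0"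
    if "i \<ge> 1" for i
    using pert_mean[OF that t0] by (auto simp: Bochner_Integration.integral_sum intro!: Bochner_Integration.integrable_sum)
  have ic: "indep_vars (\<lambda>_. borel) (\<lambda>i \<omega>. \<Sum>j<m. u j * pert \<sigma> i (ts j) \<omega>) {1..N}"
    by (rule pert_comb_indep[OF t0])
  have i2: "integrable M (\<lambda>\<omega>. (\<Sum>j<m. u j * pert \<sigma> i (ts j) \<omega>)\<^sup>2)" if "i \<ge> 1" for i
    by (rule pert_comb_second_moment(1)[OF that t])
  have s: "integrable M (\<lambda>\<omega>. (\<Sum>i\<in>{1..N}. \<Sum>j<m. u j * pert \<sigma> i (ts j) \<omega>)\<^sup>2)"
    "expectation (\<lambda>\<omega>. (\<Sum>i\<in>{1..N}. \<Sum>j<m. u j * pert \<sigma> i (ts j) \<omega>)\<^sup>2)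
      = (\<Sum>i\<in>{1..N}. expectation (\<lambda>\<omega>. (\<Sum>j<m. u j * pert \<sigma> i (ts j) \<omega>)\<^sup>2))"
    using indep_sum_second_moment[OF _ ic] i i2 by auto
  show "integrable M (\<lambda>\<omega>. (\<Sum>j<m. u j * W \<sigma> N (ts j) \<omega>)\<^sup>2)" unfolding e using s by simp
  show "expectation (\<lambda>\<omega>. (\<Sum>j<m. u j * W \<sigma> N (ts j) \<omega>)\<^sup>2)
      = (\<Sum>j<m. \<Sum>l<m. u j * u l * (exp (2 * \<kappa> * min (ts j) (ts l)) - exp (- 2 * \<kappa> * \<sigma>)))"
    unfolding e using s N by (simp add: pert_comb_second_moment(2)[OF _ t])
qed

lemma W_second_moment:
  assumes t: "\<sigma> + t > 0"
  shows "integrable M (\<lambda>\<omega>. (W \<sigma> N t \<omega>)\<^sup>2)"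
    "N > 0 \<Longrightarrow> expectation (\<lambda>\<omega>. (W \<sigma> N t \<omega>)\<^sup>2) = exp (2 * \<kappa> * t) - exp (- 2 * \<kappa> * \<sigma>)"
proof -
  show "integrable M (\<lambda>\<omega>. (W \<sigma> N t \<omega>)\<^sup>2)"
    using W_comb_second_moment(1)[of "Suc 0" \<sigma> "\<lambda>_. t" N "\<lambda>_. 1"] t by (cases "N = 0") (auto simp: W_def)
  show "N > 0 \<Longrightarrow> expectation (\<lambda>\<omega>. (W \<sigma> N t \<omega>)\<^sup>2) = exp (2 * \<kappa> * t) - exp (- 2 * \<kappa> * \<sigma>)"
    using W_comb_second_moment(2)[of "Suc 0" \<sigma> "\<lambda>_. t" N "\<lambda>_. 1"] t by simp
qed

lemma W_increment_second_moment:
  assumes t: "\<sigma> + t > 0" "t \<le> t'" and N: "N > 0"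
  shows "integrable M (\<lambda>\<omega>. (W \<sigma> N t' \<omega> - W \<sigma> N t \<omega>)\<^sup>2)"
    "expectation (\<lambda>\<omega>. (W \<sigma> N t' \<omega> - W \<sigma> N t \<omega>)\<^sup>2) = exp (2 * \<kappa> * t') - exp (2 * \<kappa> * t)"
proof -
  let ?ts = "\<lambda>j::nat. if j = 0 then t' else t" and ?u = "\<lambda>j::nat. if j = 0 then 1 else (-1::real)"
  have pos: "\<sigma> + ?ts j > 0" for j using t by auto
  show "integrable M (\<lambda>\<omega>. (W \<sigma> N t' \<omega> - W \<sigma> N t \<omega>)\<^sup>2)"
    "expectation (\<lambda>\<omega>. (W \<sigma> N t' \<omega> - W \<sigma> N t \<omega>)\<^sup>2) = exp (2 * \<kappa> * t') - exp (2 * \<kappa> * t)"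
    using W_comb_second_moment[of 2 \<sigma> ?ts N ?u, OF pos N] t by (simp_all add: numeral_2_eq_2 min_absorb1 min_absorb2)
qed

text \<open>The Cramer-Wold form of the central limit theorem for \<open>W\<close>. The coefficients
  depend on \<open>N\<close> because the process is later divided by standard deviations that
  do.\<close>

theorem W_char_tendsto:
  fixes m :: nat
  assumes s_pos: "\<And>N j. j < m \<Longrightarrow> s N + ts j > 0" and s_nonneg: "\<And>N. s N \<ge> 0"
    and s_lim: "filterlim s at_top sequentially"
    and lam: "eventually (\<lambda>N. lam * s N \<le> ln (real N)) sequentially"
    and p: "2 < p" "p \<le> 3" "\<psi> p - p / 2 * \<psi> 2 < (p / 2 - 1) * lam"
    and u: "\<And>j. j < m \<Longrightarrow> (\<lambda>N. u N j) \<longlonglongrightarrow> v j"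
  shows "(\<lambda>N. CLINT \<omega>|M. iexp (\<Sum>j<m. u N j * W (s N) N (ts j) \<omega>))
    \<longlonglongrightarrow> exp (- (\<Sum>j<m. \<Sum>l<m. v j * v l * exp (2 * \<kappa> * min (ts j) (ts l))) / 2)"
proof -
  define Y where "Y = (\<lambda>N i \<omega>. \<Sum>j<m. u N j * pert (s N) i (ts j) \<omega>)"
  define \<mu> where "\<mu> = (\<lambda>N. distr (path_law M0 \<xi>) borel (path_comb (s N) m (u N) ts))"
  have s0: "s N + ts j \<ge> 0" if "j < m" for N j using s_pos[OF that] by (rule less_imp_le)
  have dis: "distr M borel (Y N i) = \<mu> N" if "i \<ge> 1" for N i
    using path_functional_distr[OF that path_comb_measurable, of m "s N" ts "u N"] s0
    by (simp add: Y_def \<mu>_def path_comb_path)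
  have Ym: "Y N i \<in> borel_measurable M" if "i \<ge> 1" for N i
    unfolding Y_def using pert_mean(1)[OF that s0] by (intro borel_measurable_sum) auto
  \<comment> \<open>Particle 1 represents the common law \<open>\<mu> N\<close> of each row, also of
    the empty row \<open>N = 0\<close>.\<close>
  have one: "(1::nat) \<ge> 1" by simp
  have trI: "integrable (\<mu> N) h \<longleftrightarrow> integrable M (\<lambda>\<omega>. h (Y N 1 \<omega>))" if "h \<in> borel_measurable borel" for h :: "real \<Rightarrow> real" and N
    unfolding dis[OF one, symmetric] using that Ym[OF one] by (subst integrable_distr_eq) auto
  have tr: "integral\<^sup>L (\<mu> N) h = expectation (\<lambda>\<omega>. h (Y N 1 \<omega>))" if "h \<in> borel_measurable borel" for h :: "real \<Rightarrow> real" and N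
    unfolding dis[OF one, symmetric] using that Ym[OF one] by (subst integral_distr) auto
  have Y1: "integrable M (Y N 1)" "expectation (Y N 1) = 0" for N
    unfolding Y_def using pert_mean[OF one s0] by (auto simp: Bochner_Integration.integral_sum intro!: Bochner_Integration.integrable_sum)
  have Y2: "integrable M (\<lambda>\<omega>. (Y N 1 \<omega>)\<^sup>2)" "expectation (\<lambda>\<omega>. (Y N 1 \<omega>)\<^sup>2) = (\<Sum>j<m. \<Sum>l<m. u N j * u N l * (exp (2 * \<kappa> * min (ts j) (ts l)) - exp (- 2 * \<kappa> * s N)))" for N
    unfolding Y_def using pert_comb_second_moment[OF one s_pos] by auto
  define K where "K = (\<lambda>N. real m powr p * (\<Sum>j<m. \<bar>u N j\<bar> powr p * (exp (s N * (\<psi> p - p / 2 * \<psi> 2)) * exp (ts j * (\<psi> p - p * \<psi> 1)) + exp (- p * \<kappa> * s N))))"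
  have p0: "p \<ge> 0" using p by simp
  have ipm: "integrable M (\<lambda>\<omega>. real m powr p * (\<Sum>j<m. \<bar>u N j\<bar> powr p * \<bar>pert (s N) 1 (ts j) \<omega>\<bar> powr p))" for N
    using pert_moment(1)[OF one s0 p0] by (intro integrable_mult_right Bochner_Integration.integrable_sum) auto
  have Yp: "integrable M (\<lambda>\<omega>. \<bar>Y N 1 \<omega>\<bar> powr p)" for N
  proof (rule Bochner_Integration.integrable_bound[OF ipm[of N]])
    show "(\<lambda>\<omega>. \<bar>Y N 1 \<omega>\<bar> powr p) \<in> borel_measurable M" using Ym[OF one, of N] by measurable
    show "AE \<omega> in M. norm (\<bar>Y N 1 \<omega>\<bar> powr p) \<le> norm (real m powr p * (\<Sum>j<m. \<bar>u N j\<bar> powr p * \<bar>pert (s N) 1 (ts j) \<omega>\<bar> powr p))"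
    proof (rule AE_I2)
      fix \<omega> show "norm (\<bar>Y N 1 \<omega>\<bar> powr p) \<le> norm (real m powr p * (\<Sum>j<m. \<bar>u N j\<bar> powr p * \<bar>pert (s N) 1 (ts j) \<omega>\<bar> powr p))"
        unfolding Y_def real_norm_def abs_of_nonneg[OF powr_ge_zero]
        by (rule order_trans[OF abs_sum_powr_le[OF p0] abs_ge_self])
    qed
  qed
  have YK: "expectation (\<lambda>\<omega>. \<bar>Y N 1 \<omega>\<bar> powr p) \<le> K N" for N
  proof -
    have "expectation (\<lambda>\<omega>. \<bar>Y N 1 \<omega>\<bar> powr p) \<le> expectation (\<lambda>\<omega>. real m powr p * (\<Sum>j<m. \<bar>u N j\<bar> powr p * \<bar>pert (s N) 1 (ts j) \<omega>\<bar> powr p))"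
      using Yp ipm abs_sum_powr_le[OF p0] unfolding Y_def by (intro integral_mono) auto
    also have "\<dots> = real m powr p * (\<Sum>j<m. \<bar>u N j\<bar> powr p * expectation (\<lambda>\<omega>. \<bar>pert (s N) 1 (ts j) \<omega>\<bar> powr p))"
      using pert_moment(1)[OF one s0 p0] by (simp add: Bochner_Integration.integral_sum)
    also have "\<dots> \<le> K N"
      unfolding K_def using pert_moment(2)[OF one s0 p0] by (intro mult_left_mono sum_mono) auto
    finally show ?thesis .
  qed
  have pow0: "(\<lambda>N. real N powr (1 - p / 2)) \<longlonglongrightarrow> 0"
    using p by (intro tendsto_neg_powr filterlim_real_sequentially) auto
  have lim1: "(\<lambda>N. real N powr (1 - p / 2) * exp (s N * (\<psi> p - p / 2 * \<psi> 2))) \<longlonglongrightarrow> 0"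
  proof (rule tendsto_sandwich[OF _ _ tendsto_const])
    \<comment> \<open>The slack in the choice of \<open>p\<close>: together with
      \<open>lam * s N \<le> ln N\<close> it bounds the dominant product by
      \<open>exp (- (\<delta> * s N))\<close>.\<close>
    define \<delta> where "\<delta> = (p / 2 - 1) * lam - (\<psi> p - p / 2 * \<psi> 2)"
    have d: "\<delta> > 0" using p by (simp add: \<delta>_def)
    show "(\<lambda>N. exp (- (\<delta> * s N))) \<longlonglongrightarrow> 0"
      by (intro filterlim_compose[OF exp_at_bot] filterlim_uminus_at_bot_at_top[THEN filterlim_compose] filterlim_tendsto_pos_mult_at_top[OF tendsto_const d s_lim])
    show "\<forall>\<^sub>F N in sequentially. real N powr (1 - p / 2) * exp (s N * (\<psi> p - p / 2 * \<psi> 2)) \<le> exp (- (\<delta> * s N))"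
      using lam eventually_gt_at_top[of 0]
    proof eventually_elim
      case (elim N)
      have "(p / 2 - 1) * (lam * s N) \<le> (p / 2 - 1) * ln (real N)" using elim p by (intro mult_left_mono) auto
      then have "(1 - p / 2) * ln (real N) + s N * (\<psi> p - p / 2 * \<psi> 2) \<le> - (\<delta> * s N)"
        by (simp add: \<delta>_def algebra_simps)
      then show ?case using elim by (simp add: powr_def exp_add[symmetric])
    qed
  qed auto
  have lim2: "(\<lambda>N. real N powr (1 - p / 2) * exp (- p * \<kappa> * s N)) \<longlonglongrightarrow> 0"
  proof (rule tendsto_sandwich[OF _ _ tendsto_const pow0])
    show "\<forall>\<^sub>F N in sequentially. real N powr (1 - p / 2) * exp (- p * \<kappa> * s N) \<le> real N powr (1 - p / 2)"
      using s_nonneg p0 \<kappa>_pos by (intro always_eventually allI mult_right_le_one_le) auto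
  qed auto
  have "(\<lambda>N. real m powr p * (\<Sum>j<m. \<bar>u N j\<bar> powr p * (real N powr (1 - p / 2) * exp (s N * (\<psi> p - p / 2 * \<psi> 2)) * exp (ts j * (\<psi> p - p * \<psi> 1)) + real N powr (1 - p / 2) * exp (- p * \<kappa> * s N))))
    \<longlonglongrightarrow> real m powr p * (\<Sum>j<m. \<bar>v j\<bar> powr p * (0 * exp (ts j * (\<psi> p - p * \<psi> 1)) + 0))"
    using p u by (intro tendsto_mult tendsto_sum tendsto_add lim1 lim2 tendsto_const tendsto_powr' tendsto_rabs) auto
  then have limK: "(\<lambda>N. real N powr (1 - p / 2) * K N) \<longlonglongrightarrow> 0"
    by (simp add: K_def sum_distrib_left distrib_left mult_ac)
  have "(\<lambda>N. CLINT \<omega>|M. iexp ((\<Sum>i\<in>{1..N}. Y N i \<omega>) / sqrt (real N))) \<longlonglongrightarrow> exp (- (\<Sum>j<m. \<Sum>l<m. v j * v l * exp (2 * \<kappa> * min (ts j) (ts l))) / 2)"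
  proof (rule clt_triangular[OF Mprob p(1,2)])
    show "indep_vars (\<lambda>_. borel) (Y N) {1..N}" for N unfolding Y_def by (rule pert_comb_indep[OF s0])
    show "distr M borel (Y N i) = \<mu> N" if "i \<in> {1..N}" for N i using dis that by simp
    show "real_distribution (\<mu> N)" for N
      unfolding dis[OF one, symmetric] using Ym[OF one] by simp
    show "integrable (\<mu> N) (\<lambda>x. x)" for N using trI[of "\<lambda>x. x" N] Y1(1)[of N] by simp
    show "integrable (\<mu> N) (\<lambda>x. x\<^sup>2)" for N using trI[of "\<lambda>x. x\<^sup>2" N] Y2(1)[of N] by simp
    show "integrable (\<mu> N) (\<lambda>x. \<bar>x\<bar> powr p)" for N using trI[of "\<lambda>x. \<bar>x\<bar> powr p" N] Yp[of N] by simp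
    show "integral\<^sup>L (\<mu> N) (\<lambda>x. x) = 0" for N using tr[of "\<lambda>x. x" N] Y1(2)[of N] by simp
    have "(\<lambda>N. exp (- 2 * \<kappa> * s N)) \<longlonglongrightarrow> 0"
    proof -
      have "(\<lambda>N. exp (- (2 * \<kappa> * s N))) \<longlonglongrightarrow> 0" using \<kappa>_pos
        by (intro filterlim_compose[OF exp_at_bot] filterlim_uminus_at_bot_at_top[THEN filterlim_compose] filterlim_tendsto_pos_mult_at_top[OF tendsto_const _ s_lim]) auto
      then show ?thesis by simp
    qed
    then have "(\<lambda>N. \<Sum>j<m. \<Sum>l<m. u N j * u N l * (exp (2 * \<kappa> * min (ts j) (ts l)) - exp (- 2 * \<kappa> * s N)))
      \<longlonglongrightarrow> (\<Sum>j<m. \<Sum>l<m. v j * v l * (exp (2 * \<kappa> * min (ts j) (ts l)) - 0))"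
      using u by (intro tendsto_sum tendsto_mult tendsto_diff tendsto_const) auto
    then show "(\<lambda>N. integral\<^sup>L (\<mu> N) (\<lambda>x. x\<^sup>2)) \<longlonglongrightarrow> (\<Sum>j<m. \<Sum>l<m. v j * v l * exp (2 * \<kappa> * min (ts j) (ts l)))"
      using tr[of "\<lambda>x. x\<^sup>2"] unfolding Y2(2)[symmetric] by simp
    show "(\<lambda>N. real N powr (1 - p / 2) * integral\<^sup>L (\<mu> N) (\<lambda>x. \<bar>x\<bar> powr p)) \<longlonglongrightarrow> 0"
    proof (rule tendsto_sandwich[OF _ _ tendsto_const limK])
      show "\<forall>\<^sub>F N in sequentially. real N powr (1 - p / 2) * integral\<^sup>L (\<mu> N) (\<lambda>x. \<bar>x\<bar> powr p) \<le> real N powr (1 - p / 2) * K N"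
        using YK tr[of "\<lambda>x. \<bar>x\<bar> powr p"] by (intro always_eventually allI mult_left_mono) auto
    qed auto
  qed
  then show ?thesis by (simp add: Y_def W_comb)
qed

end

context levy_particles begin

interpretation prob_space M by (rule Mprob)

text \<open>The observed history consists of sums over all particles, so the test function involves
  every one of them. With the others frozen by independence it becomes a bounded function of the
  history of particle \<open>i0\<close> alone, and the one-particle martingale property
  applies.\<close>

lemma expo_orthogonal:
  fixes r :: "nat \<Rightarrow> real" and g :: "(nat \<Rightarrow> real) \<Rightarrow> real" and c :: real
  assumes i0: "i0 \<in> {1..N}" and r0: "0 < r 0" and r: "\<And>j. j < l \<Longrightarrow> r j < r (Suc j)" and R: "r l < R"
    and g: "g \<in> borel_measurable borel" and gB: "\<And>x. \<bar>g x\<bar> \<le> B"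
  defines "H \<equiv> \<lambda>\<omega> j. if j \<le> l then c * (\<Sum>i\<in>{1..N}. expo i (r j) \<omega> - expo i (r 0) \<omega>) else 0"
  shows "integrable M (\<lambda>\<omega>. (expo i0 R \<omega> - expo i0 (r l) \<omega>) * g (H \<omega>))"
    "expectation (\<lambda>\<omega>. (expo i0 R \<omega> - expo i0 (r l) \<omega>) * g (H \<omega>)) = 0"
proof -
  have i1: "i0 \<ge> 1" using i0 by simp
  have rpos: "0 < r j" if "j \<le> l" for j using that
  proof (induction j)
    case (Suc j) then show ?case using r[of j] by simp
  qed (rule r0)
  have Rpos: "0 < R" using rpos[of l] R by simp
  have comp[measurable]: "(\<lambda>x::nat \<Rightarrow> real. x j) \<in> borel_measurable borel" for j by (rule measurable_nat_fun_component)
  have Hm: "H \<in> M \<rightarrow>\<^sub>M borel"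
    unfolding H_def
  proof (rule measurable_coordinatewise_then_product)
    fix j
    show "(\<lambda>\<omega>. if j \<le> l then c * (\<Sum>i\<in>{1..N}. expo i (r j) \<omega> - expo i (r 0) \<omega>) else 0) \<in> borel_measurable M"
    proof (cases "j \<le> l")
      case True
      then have "(\<lambda>\<omega>. c * (\<Sum>i\<in>{1..N}. expo i (r j) \<omega> - expo i (r 0) \<omega>)) \<in> borel_measurable M"
        using rpos[OF True] r0 by (intro borel_measurable_times borel_measurable_sum borel_measurable_diff expo_measurable) auto
      then show ?thesis using True by simp
    qed simp
  qed
  have em: "integrable M (expo i0 R)" "integrable M (expo i0 (r l))"
    using expo_mean(1)[OF i1] Rpos rpos[of l] by auto
  show int: "integrable M (\<lambda>\<omega>. (expo i0 R \<omega> - expo i0 (r l) \<omega>) * g (H \<omega>))"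
  proof (rule Bochner_Integration.integrable_bound[where f="\<lambda>\<omega>. B * (expo i0 R \<omega> - expo i0 (r l) \<omega>)"])
    show "integrable M (\<lambda>\<omega>. B * (expo i0 R \<omega> - expo i0 (r l) \<omega>))" using em by simp
    show "(\<lambda>\<omega>. (expo i0 R \<omega> - expo i0 (r l) \<omega>) * g (H \<omega>)) \<in> borel_measurable M"
      using em measurable_compose[OF Hm g] by simp
    show "AE \<omega> in M. norm ((expo i0 R \<omega> - expo i0 (r l) \<omega>) * g (H \<omega>)) \<le> norm (B * (expo i0 R \<omega> - expo i0 (r l) \<omega>))"
    proof (rule AE_I2)
      fix \<omega>
      have "\<bar>g (H \<omega>)\<bar> \<le> \<bar>B\<bar>" using gB[of "H \<omega>"] by linarith
      then have "\<bar>expo i0 R \<omega> - expo i0 (r l) \<omega>\<bar> * \<bar>g (H \<omega>)\<bar> \<le> \<bar>expo i0 R \<omega> - expo i0 (r l) \<omega>\<bar> * \<bar>B\<bar>" by (intro mult_left_mono) auto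
      then show "norm ((expo i0 R \<omega> - expo i0 (r l) \<omega>) * g (H \<omega>)) \<le> norm (B * (expo i0 R \<omega> - expo i0 (r l) \<omega>))"
        by (simp add: abs_mult mult.commute)
    qed
  qed
  define I where "I = {1..N} - {i0}"
  \<comment> \<open>Index \<open>Suc l\<close> carries the terminal time \<open>R\<close>, so that
    one sequence holds both the history and the future value of the particle.\<close>
  define rr where "rr = (\<lambda>j. if j \<le> l then r j else R)"
  have rr: "0 \<le> rr j" for j using rpos Rpos by (auto simp: rr_def less_imp_le)
  define A where "A = (\<lambda>\<omega> j. \<xi>s i0 (rr j) \<omega>)"
  define C where "C = (\<lambda>\<omega> j. if j \<le> l then \<Sum>i\<in>I. expo i (r j) \<omega> - expo i (r 0) \<omega> else 0)"
  have ind: "indep_var borel A borel C"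
  proof -
    have "indep_vars (\<lambda>_. path_space) path {1..N}" using indep by (rule indep_vars_subset) auto
    then have "indep_var (PiM {i0} (\<lambda>_. path_space)) (\<lambda>\<omega>. restrict (\<lambda>i. path i \<omega>) {i0}) (PiM I (\<lambda>_. path_space)) (\<lambda>\<omega>. restrict (\<lambda>i. path i \<omega>) I)"
      by (rule indep_var_restrict) (use i0 in \<open>auto simp: I_def\<close>)
    then have "indep_var borel ((\<lambda>x j. x i0 (rr j)) \<circ> (\<lambda>\<omega>. restrict (\<lambda>i. path i \<omega>) {i0}))
      borel ((\<lambda>x j. if j \<le> l then \<Sum>i\<in>I. exp (x i (r j) - \<psi> 1 * r j) - exp (x i (r 0) - \<psi> 1 * r 0) else 0) \<circ> (\<lambda>\<omega>. restrict (\<lambda>i. path i \<omega>) I))"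
    proof (rule indep_var_compose)
      have c: "(\<lambda>x. x i t) \<in> PiM K (\<lambda>_. path_space) \<rightarrow>\<^sub>M borel" if "i \<in> K" "t \<ge> 0" for i K and t :: real
        using measurable_compose[OF measurable_component_singleton[OF that(1)] path_component[OF that(2)]] .
      show "(\<lambda>x j. x i0 (rr j)) \<in> PiM {i0} (\<lambda>_. path_space) \<rightarrow>\<^sub>M borel"
        using rr by (intro measurable_coordinatewise_then_product c) auto
      show "(\<lambda>x j. if j \<le> l then \<Sum>i\<in>I. exp (x i (r j) - \<psi> 1 * r j) - exp (x i (r 0) - \<psi> 1 * r 0) else 0) \<in> PiM I (\<lambda>_. path_space) \<rightarrow>\<^sub>M borel"
      proof (rule measurable_coordinatewise_then_product)
        fix j
        show "(\<lambda>x. if j \<le> l then \<Sum>i\<in>I. exp (x i (r j) - \<psi> 1 * r j) - exp (x i (r 0) - \<psi> 1 * r 0) else 0) \<in> borel_measurable (PiM I (\<lambda>_. path_space))"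
        proof (cases "j \<le> l")
          case True
          have "(\<lambda>x. \<Sum>i\<in>I. exp (x i (r j) - \<psi> 1 * r j) - exp (x i (r 0) - \<psi> 1 * r 0)) \<in> borel_measurable (PiM I (\<lambda>_. path_space))"
          proof (rule borel_measurable_sum)
            fix i assume "i \<in> I"
            then have [measurable]: "(\<lambda>x. x i (r j)) \<in> PiM I (\<lambda>_. path_space) \<rightarrow>\<^sub>M borel" "(\<lambda>x. x i (r 0)) \<in> PiM I (\<lambda>_. path_space) \<rightarrow>\<^sub>M borel"
              using rpos[OF True] r0 by (auto intro!: c)
            show "(\<lambda>x. exp (x i (r j) - \<psi> 1 * r j) - exp (x i (r 0) - \<psi> 1 * r 0)) \<in> borel_measurable (PiM I (\<lambda>_. path_space))" by measurable
          qed
          then show ?thesis using True by simp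
        qed simp
      qed
    qed
    moreover have "((\<lambda>x j. x i0 (rr j)) \<circ> (\<lambda>\<omega>. restrict (\<lambda>i. path i \<omega>) {i0})) = A"
      using rr by (simp add: fun_eq_iff A_def)
    moreover have "((\<lambda>x j. if j \<le> l then \<Sum>i\<in>I. exp (x i (r j) - \<psi> 1 * r j) - exp (x i (r 0) - \<psi> 1 * r 0) else 0) \<circ> (\<lambda>\<omega>. restrict (\<lambda>i. path i \<omega>) I)) = C"
      using rpos r0 by (auto simp: fun_eq_iff C_def expo_def less_imp_le intro!: sum.cong)
    ultimately show ?thesis by simp
  qed
  \<comment> \<open>\<open>G\<close> rebuilds the observed history from the path values
    \<open>a\<close> of particle \<open>i0\<close> and the contribution \<open>b\<close> of all the
    others.\<close>
  define G where "G = (\<lambda>(a :: nat \<Rightarrow> real) (b :: nat \<Rightarrow> real) j. if j \<le> l then c * (exp (a j - \<psi> 1 * r j) - exp (a 0 - \<psi> 1 * r 0) + b j) else 0)"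
  define h where "h = (\<lambda>x. (exp (fst x (Suc l) - \<psi> 1 * R) - exp (fst x l - \<psi> 1 * r l)) * g (G (fst x) (snd x)))"
  have fs[measurable]: "(\<lambda>x::(nat \<Rightarrow> real) \<times> (nat \<Rightarrow> real). fst x j) \<in> borel_measurable (borel \<Otimes>\<^sub>M borel)"
    "(\<lambda>x::(nat \<Rightarrow> real) \<times> (nat \<Rightarrow> real). snd x j) \<in> borel_measurable (borel \<Otimes>\<^sub>M borel)" for j
    using measurable_compose[OF measurable_fst comp] measurable_compose[OF measurable_snd comp] by auto
  have Gm: "(\<lambda>x. G (fst x) (snd x)) \<in> (borel \<Otimes>\<^sub>M borel) \<rightarrow>\<^sub>M borel"
    unfolding G_def by (rule measurable_coordinatewise_then_product) measurable
  have hm: "h \<in> borel_measurable (borel \<Otimes>\<^sub>M borel)"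
    unfolding h_def using measurable_compose[OF Gm g] by measurable
  have Isum: "(\<Sum>i\<in>{1..N}. f i) = f i0 + (\<Sum>i\<in>I. f i)" for f :: "nat \<Rightarrow> real"
    unfolding I_def using i0 by (subst sum.remove[of _ i0]) auto
  have hAC: "h (A \<omega>, C \<omega>) = (expo i0 R \<omega> - expo i0 (r l) \<omega>) * g (H \<omega>)" for \<omega>
  proof -
    have "G (A \<omega>) (C \<omega>) = H \<omega>"
      unfolding G_def H_def A_def C_def Isum by (auto simp: fun_eq_iff expo_def rr_def)
    then show ?thesis by (simp add: h_def A_def rr_def expo_def)
  qed
  have "expectation (\<lambda>\<omega>. h (A \<omega>, C \<omega>)) = 0"
  proof (rule indep_var_expectation_zero[OF ind hm])
    show "integrable M (\<lambda>\<omega>. h (A \<omega>, C \<omega>))" unfolding hAC by (rule int)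
    fix b :: "nat \<Rightarrow> real" assume "b \<in> space borel"
    have gG: "(\<lambda>a. g (G a b)) \<in> borel_measurable borel"
    proof (rule measurable_compose[OF _ g])
      show "(\<lambda>a. G a b) \<in> borel \<rightarrow>\<^sub>M borel"
        unfolding G_def by (rule measurable_coordinatewise_then_product) measurable
    qed
    have mg: "integrable M (\<lambda>\<omega>. exp (\<xi>s i0 1 \<omega>))" using copy_mgf(1)[OF i1, of 1] by simp
    have "expectation (\<lambda>\<omega>. (exp (\<xi>s i0 R \<omega> - cumulant M (\<xi>s i0) 1 * R) - exp (\<xi>s i0 (r l) \<omega> - cumulant M (\<xi>s i0) 1 * r l))
        * g (G (\<lambda>j. if j \<le> l then \<xi>s i0 (r j) \<omega> else 0) b)) = 0"
      by (rule levy_exp_martingale[OF copy_levy[OF i1] mg r0 r R gG gB])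
    moreover have "h (A \<omega>, b) = (exp (\<xi>s i0 R \<omega> - cumulant M (\<xi>s i0) 1 * R) - exp (\<xi>s i0 (r l) \<omega> - cumulant M (\<xi>s i0) 1 * r l))
        * g (G (\<lambda>j. if j \<le> l then \<xi>s i0 (r j) \<omega> else 0) b)" for \<omega>
    proof -
      have "G (A \<omega>) b = G (\<lambda>j. if j \<le> l then \<xi>s i0 (r j) \<omega> else 0) b"
        by (auto simp: G_def A_def rr_def fun_eq_iff)
      then show ?thesis by (simp add: h_def A_def rr_def copy_mgf(2)[OF i1])
    qed
    ultimately show "expectation (\<lambda>\<omega>. h (A \<omega>, b)) = 0" by simp
  qed
  then show "expectation (\<lambda>\<omega>. (expo i0 R \<omega> - expo i0 (r l) \<omega>) * g (H \<omega>)) = 0" unfolding hAC .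
qed

lemma W_diff: "W \<sigma> N t \<omega> - W \<sigma> N t' \<omega> = exp (- \<kappa> * \<sigma>) / sqrt (real N) * (\<Sum>i\<in>{1..N}. expo i (\<sigma> + t) \<omega> - expo i (\<sigma> + t') \<omega>)"
  unfolding W_def pert_def diff_divide_distrib[symmetric] sum_subtractf[symmetric]
  by (simp add: sum_distrib_left[symmetric] right_diff_distrib[symmetric] mult.commute)

lemma W_right_continuous:
  assumes w: "\<omega> \<in> space M" and t: "\<sigma> + t \<ge> 0"
  shows "((\<lambda>t. W \<sigma> N t \<omega>) \<longlongrightarrow> W \<sigma> N t \<omega>) (at_right t)"
proof -
  have "((\<lambda>t. \<xi>s i (\<sigma> + t) \<omega>) \<longlongrightarrow> \<xi>s i (\<sigma> + t) \<omega>) (at_right t)" if "i \<ge> 1" for i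
  proof -
    have "((\<lambda>t. \<xi>s i t \<omega>) \<longlongrightarrow> \<xi>s i (\<sigma> + t) \<omega>) (at_right (\<sigma> + t))"
      using levy_cadlag[OF copy_levy[OF that] w] t unfolding cadlag_halfline_def by blast
    moreover have "filterlim (\<lambda>u. \<sigma> + u) (at_right (\<sigma> + t)) (at_right t)"
      unfolding filterlim_at by (auto intro!: tendsto_eq_intros eventually_at_rightI[of t "t + 1"])
    ultimately show ?thesis by (rule filterlim_compose)
  qed
  then show ?thesis
    unfolding W_def pert_def expo_def divide_inverse
    by (intro tendsto_mult tendsto_sum tendsto_const tendsto_diff tendsto_exp tendsto_add tendsto_ident_at) auto
qed

lemma W_left_limit:
  assumes w: "\<omega> \<in> space M" and t: "\<sigma> + t > 0"
  shows "\<exists>l. ((\<lambda>t. W \<sigma> N t \<omega>) \<longlongrightarrow> l) (at_left t)"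
proof -
  have "\<exists>l. ((\<lambda>t. \<xi>s i (\<sigma> + t) \<omega>) \<longlongrightarrow> l) (at_left t)" if "i \<ge> 1" for i
  proof -
    obtain l where "((\<lambda>t. \<xi>s i t \<omega>) \<longlongrightarrow> l) (at_left (\<sigma> + t))"
      using levy_cadlag[OF copy_levy[OF \<open>i \<ge> 1\<close>] w] t unfolding cadlag_halfline_def by blast
    moreover have "filterlim (\<lambda>u. \<sigma> + u) (at_left (\<sigma> + t)) (at_left t)"
      unfolding filterlim_at by (auto intro!: tendsto_eq_intros eventually_at_leftI[of "t - 1" t])
    ultimately show ?thesis using filterlim_compose by blast
  qed
  then obtain L where L: "\<And>i. i \<ge> 1 \<Longrightarrow> ((\<lambda>t. \<xi>s i (\<sigma> + t) \<omega>) \<longlongrightarrow> L i) (at_left t)" by metis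
  have "((\<lambda>t. W \<sigma> N t \<omega>) \<longlongrightarrow> (\<Sum>i\<in>{1..N}. exp (- \<kappa> * \<sigma>) * (exp (L i - \<psi> 1 * (\<sigma> + t)) - 1)) * inverse (sqrt (real N))) (at_left t)"
    unfolding W_def pert_def expo_def divide_inverse using L
    by (intro tendsto_mult tendsto_sum tendsto_const tendsto_diff tendsto_exp tendsto_add tendsto_ident_at) auto
  then show ?thesis by blast
qed

text \<open>An increment of \<open>W\<close> is a multiple of a sum over particles, and each summand
  is orthogonal to the common history; on every dyadic grid this is the martingale hypothesis of the
  discrete inequality.\<close>

lemma W_maximal_inequality:
  assumes uv: "u < v" and \<sigma>: "\<sigma> + u > 0" and e: "\<epsilon> > 0"
  shows "\<exists>A\<in>sets M. prob A \<le> expectation (\<lambda>\<omega>. max 0 (\<bar>W \<sigma> N v \<omega> - W \<sigma> N u \<omega>\<bar> - \<epsilon>)) / \<epsilon> \<and>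
    (\<forall>\<omega>\<in>space M - A. \<forall>t\<in>{u..v}. \<bar>W \<sigma> N t \<omega> - W \<sigma> N u \<omega>\<bar> \<le> 2 * \<epsilon>)"
proof (rule right_continuous_maximal_inequality[OF uv e])
  show "W \<sigma> N t \<in> borel_measurable M" if "t \<in> {u..v}" for t using that \<sigma> by (intro W_measurable) auto
  show "((\<lambda>t. W \<sigma> N t \<omega>) \<longlongrightarrow> W \<sigma> N t \<omega>) (at_right t)" if "\<omega> \<in> space M" "t \<in> {u..<v}" for \<omega> t
    using that \<sigma> by (intro W_right_continuous) auto
  fix q :: nat
  define \<tau> where "\<tau> = (\<lambda>j::nat. u + (v - u) * real j / 2 ^ q)"
  have \<tau>0: "\<tau> 0 = u" and \<tau>n: "\<tau> (2 ^ q) = v" by (simp_all add: \<tau>_def)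
  have \<tau>inc: "\<tau> i < \<tau> j" if "i < j" for i j
    using that uv by (simp add: \<tau>_def divide_strict_right_mono)
  have \<tau>u: "u \<le> \<tau> j" for j using uv by (simp add: \<tau>_def)
  define c where "c = exp (- \<kappa> * \<sigma>) / sqrt (real N)"
  define Y where "Y = (\<lambda>j \<omega>. W \<sigma> N (\<tau> j) \<omega> - W \<sigma> N u \<omega>)"
  have Ye: "Y j \<omega> = c * (\<Sum>i\<in>{1..N}. expo i (\<sigma> + \<tau> j) \<omega> - expo i (\<sigma> + \<tau> 0) \<omega>)" for j \<omega>
    unfolding Y_def W_diff c_def \<tau>0 ..
  have "prob {\<omega> \<in> space M. \<exists>j\<le>2 ^ q. 2 * \<epsilon> < \<bar>Y j \<omega>\<bar>} \<le> expectation (\<lambda>\<omega>. max 0 (\<bar>Y (2 ^ q) \<omega>\<bar> - \<epsilon>)) / \<epsilon>"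
  proof (rule martingale_maximal_inequality[OF _ e])
    show "integrable M (Y j)" if "j \<le> 2 ^ q" for j
    proof -
      have "\<sigma> + \<tau> j \<ge> 0" "\<sigma> + u \<ge> 0" using \<tau>u[of j] \<sigma> by auto
      then show ?thesis unfolding Y_def by (intro Bochner_Integration.integrable_diff W_integrable)
    qed
    fix l :: nat and g :: "(nat \<Rightarrow> real) \<Rightarrow> real"
    assume l: "l \<le> 2 ^ q" and g: "g \<in> borel_measurable borel" and g1: "\<And>x. \<bar>g x\<bar> \<le> 1"
    show "expectation (\<lambda>\<omega>. (Y (2 ^ q) \<omega> - Y l \<omega>) * g (\<lambda>j. if j \<le> l then Y j \<omega> else 0)) = 0"
    proof (cases "l = 2 ^ q")
      case False
      then have lq: "l < 2 ^ q" using l by simp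
      let ?H = "\<lambda>\<omega> j. if j \<le> l then c * (\<Sum>i\<in>{1..N}. expo i (\<sigma> + \<tau> j) \<omega> - expo i (\<sigma> + \<tau> 0) \<omega>) else 0"
      let ?f = "\<lambda>i \<omega>. (expo i (\<sigma> + \<tau> (2 ^ q)) \<omega> - expo i (\<sigma> + \<tau> l) \<omega>) * g (?H \<omega>)"
      have o: "integrable M (?f i)" "expectation (?f i) = 0" if "i \<in> {1..N}" for i
        using expo_orthogonal[where r="\<lambda>j. \<sigma> + \<tau> j" and l=l and R="\<sigma> + \<tau> (2 ^ q)" and g=g and B=1 and c=c, OF that _ _ _ g g1]
          \<sigma> \<tau>0 \<tau>inc lq by auto
      have "(Y (2 ^ q) \<omega> - Y l \<omega>) * g (\<lambda>j. if j \<le> l then Y j \<omega> else 0) = c * (\<Sum>i\<in>{1..N}. ?f i \<omega>)" for \<omega>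
      proof -
        have "Y (2 ^ q) \<omega> - Y l \<omega> = c * (\<Sum>i\<in>{1..N}. expo i (\<sigma> + \<tau> (2 ^ q)) \<omega> - expo i (\<sigma> + \<tau> l) \<omega>)"
          unfolding Y_def c_def W_diff[symmetric] by simp
        then show ?thesis unfolding Ye sum_distrib_right[symmetric] by simp
      qed
      then show ?thesis using o by (simp add: Bochner_Integration.integral_sum)
    qed simp
  qed
  then show "prob {\<omega> \<in> space M. \<exists>j\<le>2 ^ q. 2 * \<epsilon> < \<bar>W \<sigma> N (u + (v - u) * real j / 2 ^ q) \<omega> - W \<sigma> N u \<omega>\<bar>}
      \<le> expectation (\<lambda>\<omega>. max 0 (\<bar>W \<sigma> N v \<omega> - W \<sigma> N u \<omega>\<bar> - \<epsilon>)) / \<epsilon>"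
    unfolding Y_def \<tau>n by (simp add: \<tau>_def)
qed

text \<open>\<open>Zsum\<close> is an affine function of \<open>W\<close> with a deterministic
  slope, positive for \<open>N > 0\<close>; the shift and the slope cancel in the normalisation,
  leaving \<open>W\<close> over its standard deviation.\<close>

lemma Znorm_eq:
  assumes st: "s N + t > 0"
  shows "Znorm M \<xi>s s N t \<omega> = W (s N) N t \<omega> / sqrt (exp (2 * \<kappa> * t) - exp (- 2 * \<kappa> * s N))"
proof (cases "N = 0")
  case True
  have "Zsum \<xi>s s 0 t = (\<lambda>_. 0)" by (simp add: Zsum_def fun_eq_iff)
  then show ?thesis using True by (simp add: Znorm_def W_def)
next
  case False
  define r where "r = s N + t"
  have r: "r > 0" using st by (simp add: r_def)
  define a where "a = exp (\<psi> 1 * r + \<kappa> * s N) * sqrt (real N)"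
  have a: "a > 0" using False by (simp add: a_def)
  have Z: "Zsum \<xi>s s N t \<omega> = a * W (s N) N t \<omega> + real N * exp (\<psi> 1 * r)" for \<omega>
  proof -
    have "exp (\<xi>s i r \<omega>) = exp (\<psi> 1 * r + \<kappa> * s N) * pert (s N) i t \<omega> + exp (\<psi> 1 * r)" for i
    proof -
      have "exp (\<psi> 1 * r + \<kappa> * s N) * exp (- \<kappa> * s N) = exp (\<psi> 1 * r)" unfolding exp_add[symmetric] by simp
      moreover have "exp (\<psi> 1 * r) * expo i r \<omega> = exp (\<xi>s i r \<omega>)" unfolding expo_def exp_add[symmetric] by simp
      ultimately show ?thesis unfolding pert_def r_def[symmetric] mult.assoc[symmetric] by (simp add: right_diff_distrib)
    qed
    then have "Zsum \<xi>s s N t \<omega> = exp (\<psi> 1 * r + \<kappa> * s N) * (\<Sum>i\<in>{1..N}. pert (s N) i t \<omega>) + real N * exp (\<psi> 1 * r)"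
      by (simp add: Zsum_def r_def[symmetric] sum.distrib sum_distrib_left)
    then show ?thesis using False by (simp add: a_def W_def)
  qed
  have st0: "s N + t \<ge> 0" using st by simp
  have "expectation (W (s N) N t) = 0"
    unfolding W_def using pert_mean[OF _ st0] by (simp add: Bochner_Integration.integral_sum)
  then have m: "expectation (Zsum \<xi>s s N t) = real N * exp (\<psi> 1 * r)"
    unfolding Z[abs_def] using W_integrable[OF st0, of N] by (simp add: prob_space)
  have d: "Zsum \<xi>s s N t \<omega> - expectation (Zsum \<xi>s s N t) = a * W (s N) N t \<omega>" for \<omega>
    unfolding m Z by simp
  have v: "expectation (\<lambda>\<omega>. (a * W (s N) N t \<omega>)\<^sup>2) = a\<^sup>2 * (exp (2 * \<kappa> * t) - exp (- 2 * \<kappa> * s N))"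
    unfolding power_mult_distrib using W_second_moment(2)[OF st, of N] False by simp
  show ?thesis
    unfolding Znorm_def Let_def d v using a by (simp add: real_sqrt_mult)
qed

lemma cos_tendsto:
  assumes Z: "\<And>N. Z N \<in> borel_measurable M" and P: "prob_space P" and G: "G \<in> borel_measurable P"
    and lim: "(\<lambda>N. CLINT \<omega>|M. iexp (Z N \<omega>)) \<longlonglongrightarrow> (CLINT \<omega>|P. iexp (G \<omega>))"
  shows "(\<lambda>N. expectation (\<lambda>\<omega>. cos (Z N \<omega> + c))) \<longlonglongrightarrow> integral\<^sup>L P (\<lambda>\<omega>. cos (G \<omega> + c))"
  unfolding expectation_cos_eq[OF Z] prob_space.expectation_cos_eq[OF P G]
  by (intro tendsto_Re tendsto_mult lim tendsto_const)

context
  fixes s :: "nat \<Rightarrow> real" and T lam p :: real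
  assumes T: "T > 0" and sT: "\<And>N. T + 1 \<le> s N" and s_lim: "filterlim s at_top sequentially"
    and lam: "eventually (\<lambda>N. lam * s N \<le> ln (real N)) sequentially"
    and p: "2 < p" "p \<le> 3" "\<psi> p - p / 2 * \<psi> 2 < (p / 2 - 1) * lam"
begin

lemma s_pos: "t \<in> {-T..T} \<Longrightarrow> s N + t > 0"
  using sT[of N] by simp

text \<open>The truncated excess converges to an expectation for a centred Gaussian of variance
  \<open>D\<close>, whose fourth moment is \<open>3 * D\<^sup>2\<close>. Truncation and the passage
  to the limit cost \<open>e / 2\<close> each.\<close>

lemma W_excess_limit:
  assumes uv: "u \<in> {-T..T}" "v \<in> {-T..T}" "u \<le> v" and e: "\<epsilon> > 0" "e > 0"
  defines "D \<equiv> exp (2 * \<kappa> * v) - exp (2 * \<kappa> * u)"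
  shows "eventually (\<lambda>N. expectation (\<lambda>\<omega>. max 0 (\<bar>W (s N) N v \<omega> - W (s N) N u \<omega>\<bar> - \<epsilon>)) \<le> 3 * D\<^sup>2 / \<epsilon> ^ 3 + e) sequentially"
proof -
  have D0: "D \<ge> 0" using uv(3) \<kappa>_pos by (simp add: D_def)
  \<comment> \<open>This makes the tail term \<open>D / R\<close> at most \<open>e / 2\<close>; the
    added 1 keeps \<open>R\<close> positive when \<open>D = 0\<close>.\<close>
  define R where "R = 2 * (D + 1) / e"
  have R: "R > 0" using D0 e by (simp add: R_def)
  have DR: "D / R \<le> e / 2" using D0 e by (simp add: R_def field_simps)
  define Z where "Z = (\<lambda>N \<omega>. W (s N) N v \<omega> - W (s N) N u \<omega>)"
  have Zm: "Z N \<in> borel_measurable M" for N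
    unfolding Z_def using s_pos uv by (intro borel_measurable_diff W_measurable less_imp_le) auto
  have Z2: "integrable M (\<lambda>\<omega>. (Z N \<omega>)\<^sup>2) \<and> expectation (\<lambda>\<omega>. (Z N \<omega>)\<^sup>2) \<le> D" for N
    using W_increment_second_moment[OF s_pos[OF uv(1)] uv(3), of N N] D0
    by (cases "N = 0") (auto simp: Z_def D_def W_def)
  define F where "F = (\<lambda>x :: nat \<Rightarrow> real. min (max 0 (\<bar>x 0\<bar> - \<epsilon>)) R)"
  define G where "G = (\<lambda>\<omega> :: nat \<Rightarrow> real. sqrt D * \<omega> 0)"
  have Gm: "G \<in> borel_measurable gauss_seq" unfolding G_def by measurable
  have G2: "integrable gauss_seq (\<lambda>\<omega>. (G \<omega>)\<^sup>2)" "integral\<^sup>L gauss_seq (\<lambda>\<omega>. (G \<omega>)\<^sup>2) \<le> D"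
    using gauss_second_moment[of 0] D0 by (simp_all add: G_def power_mult_distrib)
  have G4: "integrable gauss_seq (\<lambda>\<omega>. (G \<omega>) ^ 4)" "integral\<^sup>L gauss_seq (\<lambda>\<omega>. (G \<omega>) ^ 4) = 3 * D\<^sup>2"
  proof -
    have "sqrt D ^ 4 = (sqrt D ^ 2) ^ 2" by (simp flip: power_mult)
    then have d4: "sqrt D ^ 4 = D\<^sup>2" using D0 by simp
    then show "integrable gauss_seq (\<lambda>\<omega>. (G \<omega>) ^ 4)" "integral\<^sup>L gauss_seq (\<lambda>\<omega>. (G \<omega>) ^ 4) = 3 * D\<^sup>2"
      using gauss_fourth_moment[of 0] by (simp_all add: G_def power_mult_distrib)
  qed
  have conv: "(\<lambda>N. expectation (\<lambda>\<omega>. cos ((\<Sum>i<Suc 0. w i * Z N \<omega>) + c))) \<longlonglongrightarrow> integral\<^sup>L gauss_seq (\<lambda>\<omega>. cos ((\<Sum>i<Suc 0. w i * G \<omega>) + c))" for w :: "nat \<Rightarrow> real" and c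
  proof (rule cos_tendsto[OF _ gauss.prob_space_axioms])
    show "(\<lambda>\<omega>. \<Sum>i<Suc 0. w i * Z N \<omega>) \<in> borel_measurable M" for N using Zm by simp
    show "(\<lambda>\<omega>. \<Sum>i<Suc 0. w i * G \<omega>) \<in> borel_measurable gauss_seq" using Gm by simp
    \<comment> \<open>The increment is a two-point combination, at \<open>v\<close> and
      \<open>u\<close> with opposite weights, and its limiting variance is
      \<open>(w 0)\<^sup>2 * D\<close>.\<close>
    let ?ts = "\<lambda>j::nat. if j = 0 then v else u" and ?w = "\<lambda>j::nat. if j = 0 then w 0 else - w 0"
    have "(\<lambda>N. CLINT \<omega>|M. iexp (\<Sum>j<2. ?w j * W (s N) N (?ts j) \<omega>))
      \<longlonglongrightarrow> exp (- (\<Sum>j<2. \<Sum>l<2. ?w j * ?w l * exp (2 * \<kappa> * min (?ts j) (?ts l))) / 2)"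
      using s_pos uv T sT by (intro W_char_tendsto[OF _ _ s_lim lam p]) (auto intro: order_trans[OF _ sT])
    also have "(\<Sum>j<2. \<Sum>l<2. ?w j * ?w l * exp (2 * \<kappa> * min (?ts j) (?ts l))) = (w 0)\<^sup>2 * D"
      using uv(3) by (simp add: numeral_2_eq_2 min_absorb1 min_absorb2 D_def power2_eq_square algebra_simps)
    also have "complex_of_real (exp (- ((w 0)\<^sup>2 * D) / 2)) = (CLINT \<omega>|gauss_seq. iexp (\<Sum>i<Suc 0. w i * G \<omega>))"
      using gauss_char_component[of "w 0 * sqrt D" 0] D0 by (simp add: G_def power_mult_distrib mult.assoc)
    also have "(\<lambda>N. CLINT \<omega>|M. iexp (\<Sum>j<2. ?w j * W (s N) N (?ts j) \<omega>)) = (\<lambda>N. CLINT \<omega>|M. iexp (\<Sum>i<Suc 0. w i * Z N \<omega>))"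
      by (simp add: numeral_2_eq_2 Z_def algebra_simps)
    finally show "(\<lambda>N. CLINT \<omega>|M. iexp (\<Sum>i<Suc 0. w i * Z N \<omega>)) \<longlonglongrightarrow> (CLINT \<omega>|gauss_seq. iexp (\<Sum>i<Suc 0. w i * G \<omega>))" .
  qed
  have Fc: "isCont F x" for x
    unfolding F_def isCont_def by (intro tendsto_intros tendsto_nat_fun_component)
  have F0: "0 \<le> F x" "F x \<le> R" for x using R by (auto simp: F_def)
  have FR: "\<bar>min (max 0 (\<bar>y\<bar> - \<epsilon>)) R\<bar> \<le> R" for y using R by auto
  have FB: "\<bar>F x\<bar> \<le> R" for x using F0[of x] by simp
  have "(\<lambda>N. expectation (\<lambda>\<omega>. F (\<lambda>i. Z N \<omega>))) \<longlonglongrightarrow> integral\<^sup>L gauss_seq (\<lambda>\<omega>. F (\<lambda>i. G \<omega>))"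
  proof (rule trig_imp_weak_convergence[where m="Suc 0" and C=D and B=R and F=F and X="\<lambda>N i. Z N" and Y="\<lambda>i. G", OF Mprob gauss.prob_space_axioms])
    show "F v = F w" if "\<And>i. i < Suc 0 \<Longrightarrow> v i = w i" for v w using that by (simp add: F_def)
  qed (use Zm Gm Z2 G2 conv Fc FB in auto)
  moreover have "integral\<^sup>L gauss_seq (\<lambda>\<omega>. F (\<lambda>i. G \<omega>)) \<le> 3 * D\<^sup>2 / \<epsilon> ^ 3"
  proof -
    have "integral\<^sup>L gauss_seq (\<lambda>\<omega>. F (\<lambda>i. G \<omega>)) \<le> integral\<^sup>L gauss_seq (\<lambda>\<omega>. (G \<omega>) ^ 4 / \<epsilon> ^ 3)"
    proof (rule integral_mono)
      show "integrable gauss_seq (\<lambda>\<omega>. F (\<lambda>i. G \<omega>))"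
        using FR Gm by (intro gauss.integrable_const_bound[where B=R]) (auto simp: F_def)
      show "F (\<lambda>i. G \<omega>) \<le> (G \<omega>) ^ 4 / \<epsilon> ^ 3" for \<omega> unfolding F_def by (rule excess_le_fourth_power[OF e(1)])
    qed (use G4 in auto)
    then show ?thesis using G4(2) by simp
  qed
  ultimately have "eventually (\<lambda>N. expectation (\<lambda>\<omega>. F (\<lambda>i. Z N \<omega>)) < 3 * D\<^sup>2 / \<epsilon> ^ 3 + e / 2) sequentially"
    using e by (intro order_tendstoD(2)) auto
  then show ?thesis
  proof eventually_elim
    case (elim N)
    have iZ: "integrable M (Z N)" unfolding Z_def using s_pos uv by (intro Bochner_Integration.integrable_diff W_integrable less_imp_le) auto
    have iF: "integrable M (\<lambda>\<omega>. F (\<lambda>i. Z N \<omega>))"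
      using FR Zm by (intro integrable_const_bound[where B=R]) (auto simp: F_def)
    have "expectation (\<lambda>\<omega>. max 0 (\<bar>Z N \<omega>\<bar> - \<epsilon>)) \<le> expectation (\<lambda>\<omega>. F (\<lambda>i. Z N \<omega>) + (Z N \<omega>)\<^sup>2 / R)"
      using iZ iF Z2 excess_le_truncated[OF e(1) R] unfolding F_def by (intro integral_mono) auto
    also have "\<dots> = expectation (\<lambda>\<omega>. F (\<lambda>i. Z N \<omega>)) + expectation (\<lambda>\<omega>. (Z N \<omega>)\<^sup>2) / R"
      using iF Z2 by simp
    also have "\<dots> \<le> 3 * D\<^sup>2 / \<epsilon> ^ 3 + e / 2 + D / R"
      using elim Z2[of N] R by (intro add_mono divide_right_mono) auto
    finally show ?case using DR unfolding Z_def by linarith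
  qed
qed

end

end

section \<open>Tightness\<close>

lemma abs_mult_add_le:
  fixes p q r v :: real
  assumes "0 \<le> q" shows "\<bar>p * q + r * v\<bar> \<le> \<bar>p\<bar> * q + \<bar>r\<bar> * \<bar>v\<bar>"
  using abs_triangle_ineq[of "p * q" "r * v"] assms by (simp add: abs_mult)

lemma inverse_sqrt_lipschitz:
  fixes x y \<delta> :: real
  assumes d: "\<delta> > 0" and x: "\<delta> \<le> x" and y: "\<delta> \<le> y"
  shows "\<bar>1 / sqrt x - 1 / sqrt y\<bar> \<le> \<bar>x - y\<bar> / (\<delta> * sqrt \<delta>)"
proof -
  have p: "sqrt x > 0" "sqrt y > 0" "sqrt \<delta> > 0" using assms by auto
  have sx: "sqrt \<delta> \<le> sqrt x" "sqrt \<delta> \<le> sqrt y" using x y by auto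
  have "\<bar>x - y\<bar> = \<bar>sqrt x - sqrt y\<bar> * (sqrt x + sqrt y)"
  proof -
    have "x - y = (sqrt x - sqrt y) * (sqrt x + sqrt y)" using assms by (simp add: algebra_simps)
    then show ?thesis using p by (simp add: abs_mult)
  qed
  moreover have "\<bar>sqrt x - sqrt y\<bar> * sqrt \<delta> \<le> \<bar>sqrt x - sqrt y\<bar> * (sqrt x + sqrt y)"
  proof (intro mult_left_mono)
    show "sqrt \<delta> \<le> sqrt x + sqrt y" using sx p by linarith
  qed simp
  ultimately have 1: "\<bar>sqrt x - sqrt y\<bar> \<le> \<bar>x - y\<bar> / sqrt \<delta>" using p by (simp add: field_simps)
  have "\<delta> \<le> sqrt x * sqrt y" using mult_mono[OF sx] p d by simp
  have "\<bar>1 / sqrt x - 1 / sqrt y\<bar> = \<bar>sqrt x - sqrt y\<bar> / (sqrt x * sqrt y)"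
    using p by (simp add: divide_simps abs_minus_commute)
  also have "\<dots> \<le> (\<bar>x - y\<bar> / sqrt \<delta>) / \<delta>"
    using 1 \<open>\<delta> \<le> sqrt x * sqrt y\<close> d by (intro frac_le) auto
  finally show ?thesis by (simp add: mult.commute)
qed

lemma exp_diff_le:
  fixes a u t T :: real
  assumes a: "a > 0" and u: "u \<le> t" "t \<le> T"
  shows "exp (a * t) - exp (a * u) \<le> a * exp (a * T) * (t - u)"
proof -
  have "exp (a * t) - exp (a * u) = exp (a * t) * (1 - exp (- (a * (t - u))))"
    by (simp add: right_diff_distrib exp_add[symmetric] algebra_simps)
  also have "\<dots> \<le> exp (a * t) * (a * (t - u))"
    using exp_ge_add_one_self[of "- (a * (t - u))"] by (intro mult_left_mono) auto
  also have "\<dots> \<le> exp (a * T) * (a * (t - u))" using a u by (intro mult_right_mono) auto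
  finally show ?thesis by (simp add: mult_ac)
qed

context levy_particles begin

interpretation prob_space M by (rule Mprob)

context
  fixes s :: "nat \<Rightarrow> real" and T lam p :: real
  assumes T: "T > 0" and sT: "\<And>N. T + 1 \<le> s N" and s_lim: "filterlim s at_top sequentially"
    and lam: "eventually (\<lambda>N. lam * s N \<le> ln (real N)) sequentially"
    and p: "2 < p" "p \<le> 3" "\<psi> p - p / 2 * \<psi> 2 < (p / 2 - 1) * lam"
begin

text \<open>The variance of \<open>W (s N) N t\<close> when \<open>N > 0\<close>.\<close>

definition den :: "nat \<Rightarrow> real \<Rightarrow> real" where
  "den N t = exp (2 * \<kappa> * t) - exp (- 2 * \<kappa> * s N)"

text \<open>A lower bound for these variances on \<open>{-T..T}\<close>, uniform in
  \<open>N\<close>; the margin 1 in \<open>T + 1 \<le> s N\<close> makes it positive.\<close>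

definition \<delta> :: real where "\<delta> = exp (- 2 * \<kappa> * T) - exp (- 2 * \<kappa> * (T + 1))"

lemma \<delta>_pos: "\<delta> > 0" using \<kappa>_pos by (simp add: \<delta>_def)

lemma den_ge: "t \<in> {-T..T} \<Longrightarrow> \<delta> \<le> den N t"
proof -
  assume t: "t \<in> {-T..T}"
  have "exp (- 2 * \<kappa> * T) \<le> exp (2 * \<kappa> * t)" using t \<kappa>_pos mult_left_mono[of "-T" t "2 * \<kappa>"] by simp
  moreover have "exp (- 2 * \<kappa> * s N) \<le> exp (- 2 * \<kappa> * (T + 1))" using sT[of N] \<kappa>_pos by simp
  ultimately show ?thesis unfolding den_def \<delta>_def by linarith
qed

text \<open>The first alternative is for \<open>t = T\<close>: its grid index is \<open>k\<close>,
  no cell starts there, and the step approximation is exact because \<open>T\<close> is a grid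
  point.\<close>

lemma step_index:
  assumes k: "k > 0" and t: "t \<in> {-T..T}"
  shows "step_approx (-T) T k x t = x t \<or> (\<exists>j<k. t \<in> {grid_pt (-T) T k j..grid_pt (-T) T k (Suc j)} \<and> step_approx (-T) T k x t = x (grid_pt (-T) T k j))"
proof -
  have ab: "-T < T" using T by simp
  define y where "y = (t - (-T)) * real k / (T - (-T))"
  define j where "j = nat \<lfloor>y\<rfloor>"
  have y0: "0 \<le> y" using t T by (simp add: y_def)
  have sj: "step_approx (-T) T k x t = x (grid_pt (-T) T k j)"
    by (simp add: step_approx_def step_fn_def j_def y_def)
  have ty: "t = -T + (T - (-T)) / real k * y" using T k by (simp add: y_def field_simps)
  have jy: "real j \<le> y" "y < real (Suc j)" using y0 unfolding j_def by linarith+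
  have "j \<le> k" using grid_floor_index[OF ab k t] by (simp add: j_def y_def)
  then consider "j < k" | "j = k" by linarith
  then show ?thesis
  proof cases
    case 1
    have "grid_pt (-T) T k j \<le> t" "t \<le> grid_pt (-T) T k (Suc j)"
    proof -
      have "(T - (-T)) / real k * real j \<le> (T - (-T)) / real k * y" "(T - (-T)) / real k * y \<le> (T - (-T)) / real k * real (Suc j)"
        using jy T by (intro mult_left_mono; simp)+
      then show "grid_pt (-T) T k j \<le> t" "t \<le> grid_pt (-T) T k (Suc j)"
        unfolding grid_pt_def using ty by linarith+
    qed
    then show ?thesis using sj 1 by auto
  next
    case 2
    then have "real k \<le> y" using jy by simp
    then have "(T - (-T)) / real k * real k \<le> (T - (-T)) / real k * y" using T by (intro mult_left_mono) auto
    then have "t \<ge> T" using ty k by simp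
    then have "t = T" using t by simp
    moreover have "grid_pt (-T) T k k = T" using k by (simp add: grid_pt_def)
    ultimately show ?thesis using sj 2 by simp
  qed
qed

text \<open>Two effects occur in each cell: the oscillation of \<open>W\<close>, controlled by the
  maximal inequality, and the variation of the normalising factor, harmless as long as
  \<open>W\<close> at the left grid point stays below a level \<rho>. Each is allotted
  \<open>\<epsilon> / 2\<close>.\<close>

lemma W_scaled_tight:
  assumes e: "\<epsilon> > 0" and h: "\<eta> > 0"
  shows "eventually (\<lambda>k. eventually (\<lambda>N. \<exists>A\<in>sets M. prob A \<le> \<eta> \<and>
    (\<forall>\<omega>\<in>space M - A. \<forall>t\<in>{-T..T}. \<bar>W (s N) N t \<omega> / sqrt (den N t) - step_approx (-T) T k (\<lambda>t. W (s N) N t \<omega> / sqrt (den N t)) t\<bar> \<le> \<epsilon>)) sequentially) sequentially"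
proof -
  \<comment> \<open>\<open>L\<close> is a Lipschitz constant of the variance on the interval,
    \<open>K\<close> bounds its reciprocal square root and \<open>C\<close> is a Lipschitz constant
    of that reciprocal root; \<open>\<epsilon>'\<close> is chosen to make
    \<open>2 * \<epsilon>' * K = \<epsilon> / 2\<close>.\<close>
  define L where "L = 2 * \<kappa> * exp (2 * \<kappa> * T)"
  define K where "K = 1 / sqrt \<delta>"
  define C where "C = L / (\<delta> * sqrt \<delta>)"
  define \<epsilon>' where "\<epsilon>' = \<epsilon> / (4 * K)"
  \<comment> \<open>\<open>c1 / k\<close> is the total of the probability bounds over
    \<open>k\<close> cells of length \<open>2 * T / k\<close>: the Gaussian limit of the excess, the
    slack \<open>1 / k\<^sup>2\<close> allowed in reaching it, and Chebyshev's bound for the values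
    of \<open>W\<close> at the grid points.\<close>
  define c1 where "c1 = 12 * L\<^sup>2 * T\<^sup>2 / \<epsilon>' ^ 4 + 1 / \<epsilon>' + 16 * exp (2 * \<kappa> * T) * C\<^sup>2 * T\<^sup>2 / \<epsilon>\<^sup>2"
  have pos: "L > 0" "K > 0" "C > 0" "\<epsilon>' > 0" using \<kappa>_pos \<delta>_pos e by (auto simp: L_def K_def C_def \<epsilon>'_def)
  have "(\<lambda>k. c1 * (1 / real k)) \<longlonglongrightarrow> c1 * 0" by (intro tendsto_intros lim_1_over_n)
  then have "eventually (\<lambda>k. c1 * (1 / real k) < \<eta>) sequentially" using h by (intro order_tendstoD(2)) auto
  then show ?thesis using eventually_gt_at_top[of 0]
  proof eventually_elim
    case (elim k)
    define d where "d = 2 * T / real k"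
    have d: "d > 0" using T elim by (simp add: d_def)
    \<comment> \<open>The solution of \<open>\<rho> * (C * d) = \<epsilon> / 2\<close>. It grows
      linearly in \<open>k\<close>, so Chebyshev's bound is of order \<open>1 / k\<^sup>2\<close>
      per cell.\<close>
    define \<rho> where "\<rho> = \<epsilon> / (2 * C * d)"
    have \<rho>: "\<rho> > 0" using e pos d by (simp add: \<rho>_def)
    define x where "x = grid_pt (-T) T k"
    have ab: "-T < T" using T by simp
    have xT: "x j \<in> {-T..T}" if "j \<le> k" for j unfolding x_def by (rule grid_pt_mem[OF ab elim(2) that])
    have xS: "x (Suc j) = x j + d" for j
      unfolding x_def grid_pt_def d_def of_nat_Suc by (simp add: distrib_left)
    have D: "0 \<le> exp (2 * \<kappa> * x (Suc j)) - exp (2 * \<kappa> * x j)" "exp (2 * \<kappa> * x (Suc j)) - exp (2 * \<kappa> * x j) \<le> L * d" if "j < k" for j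
    proof -
      show "0 \<le> exp (2 * \<kappa> * x (Suc j)) - exp (2 * \<kappa> * x j)" using \<kappa>_pos d by (simp add: xS)
      show "exp (2 * \<kappa> * x (Suc j)) - exp (2 * \<kappa> * x j) \<le> L * d"
        using exp_diff_le[of "2 * \<kappa>" "x j" "x (Suc j)" T] \<kappa>_pos d xT[of "Suc j"] that by (simp add: xS L_def)
    qed
    have "eventually (\<lambda>N. expectation (\<lambda>\<omega>. max 0 (\<bar>W (s N) N (x (Suc j)) \<omega> - W (s N) N (x j) \<omega>\<bar> - \<epsilon>'))
        \<le> 3 * (exp (2 * \<kappa> * x (Suc j)) - exp (2 * \<kappa> * x j))\<^sup>2 / \<epsilon>' ^ 3 + 1 / (real k)\<^sup>2) sequentially" if "j \<in> {..<k}" for j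
    proof (rule W_excess_limit[OF T sT s_lim lam p _ _ _ pos(4)])
      show "x j \<in> {-T..T}" "x (Suc j) \<in> {-T..T}" using xT[of j] xT[of "Suc j"] that by auto
      show "x j \<le> x (Suc j)" using xS[of j] d by linarith
      show "0 < 1 / (real k)\<^sup>2" using elim(2) by simp
    qed
    then have "eventually (\<lambda>N. \<forall>j\<in>{..<k}. expectation (\<lambda>\<omega>. max 0 (\<bar>W (s N) N (x (Suc j)) \<omega> - W (s N) N (x j) \<omega>\<bar> - \<epsilon>'))
        \<le> 3 * (exp (2 * \<kappa> * x (Suc j)) - exp (2 * \<kappa> * x j))\<^sup>2 / \<epsilon>' ^ 3 + 1 / (real k)\<^sup>2) sequentially"
      by (intro eventually_ball_finite) auto
    then show ?case using eventually_gt_at_top[of 0]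
    proof eventually_elim
      case (elim N)
      note N = elim
      let ?W = "W (s N) N"
      have ex: "expectation (\<lambda>\<omega>. max 0 (\<bar>?W (x (Suc j)) \<omega> - ?W (x j) \<omega>\<bar> - \<epsilon>')) \<le> 3 * (L * d)\<^sup>2 / \<epsilon>' ^ 3 + 1 / (real k)\<^sup>2" if j: "j < k" for j
      proof -
        have "(exp (2 * \<kappa> * x (Suc j)) - exp (2 * \<kappa> * x j))\<^sup>2 \<le> (L * d)\<^sup>2" using D[OF j] by (intro power_mono)
        then have "3 * (exp (2 * \<kappa> * x (Suc j)) - exp (2 * \<kappa> * x j))\<^sup>2 / \<epsilon>' ^ 3 \<le> 3 * (L * d)\<^sup>2 / \<epsilon>' ^ 3"
          using pos by (intro divide_right_mono mult_left_mono) auto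
        moreover have "expectation (\<lambda>\<omega>. max 0 (\<bar>?W (x (Suc j)) \<omega> - ?W (x j) \<omega>\<bar> - \<epsilon>'))
          \<le> 3 * (exp (2 * \<kappa> * x (Suc j)) - exp (2 * \<kappa> * x j))\<^sup>2 / \<epsilon>' ^ 3 + 1 / (real k)\<^sup>2"
          using bspec[OF N(1), of j] j by (simp only: lessThan_iff)
        ultimately show ?thesis by linarith
      qed
      define Q where "Q = (\<lambda>j A. A \<in> sets M \<and> prob A \<le> expectation (\<lambda>\<omega>. max 0 (\<bar>?W (x (Suc j)) \<omega> - ?W (x j) \<omega>\<bar> - \<epsilon>')) / \<epsilon>' \<and>
          (\<forall>\<omega>\<in>space M - A. \<forall>t\<in>{x j..x (Suc j)}. \<bar>?W t \<omega> - ?W (x j) \<omega>\<bar> \<le> 2 * \<epsilon>'))"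
      have sx: "s N + x j > 0" if "j < k" for j using s_pos[OF T sT s_lim lam p, of "x j" N] xT[of j] that by simp
      have "\<forall>j\<in>{..<k}. \<exists>A. Q j A"
      proof
        fix j assume "j \<in> {..<k}"
        then have "s N + x j > 0" using sx by simp
        moreover have "x j < x (Suc j)" using xS[of j] d by linarith
        ultimately show "\<exists>A. Q j A" using W_maximal_inequality[OF _ _ pos(4), of "x j" "x (Suc j)" "s N" N] unfolding Q_def Bex_def by (simp only:)
      qed
      from bchoice[OF this] obtain A where AQ: "\<forall>j\<in>{..<k}. Q j (A j)" ..
      have A: "A j \<in> sets M" "prob (A j) \<le> expectation (\<lambda>\<omega>. max 0 (\<bar>?W (x (Suc j)) \<omega> - ?W (x j) \<omega>\<bar> - \<epsilon>')) / \<epsilon>'"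
        "\<And>\<omega> t. \<omega> \<in> space M - A j \<Longrightarrow> t \<in> {x j..x (Suc j)} \<Longrightarrow> \<bar>?W t \<omega> - ?W (x j) \<omega>\<bar> \<le> 2 * \<epsilon>'" if "j < k" for j
      proof -
        have q: "Q j (A j)" using AQ that by simp
        show "A j \<in> sets M" "prob (A j) \<le> expectation (\<lambda>\<omega>. max 0 (\<bar>?W (x (Suc j)) \<omega> - ?W (x j) \<omega>\<bar> - \<epsilon>')) / \<epsilon>'"
          using q by (simp_all only: Q_def)
        show "\<bar>?W t \<omega> - ?W (x j) \<omega>\<bar> \<le> 2 * \<epsilon>'" if "\<omega> \<in> space M - A j" "t \<in> {x j..x (Suc j)}" for \<omega> t
          using q that by (simp only: Q_def)
      qed
      define B where "B = (\<lambda>j. {\<omega> \<in> space M. \<rho> \<le> \<bar>?W (x j) \<omega>\<bar>})"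
      have Wm: "?W (x j) \<in> borel_measurable M" if "j < k" for j using sx[OF that] by (intro W_measurable) simp
      have B: "B j \<in> sets M" "prob (B j) \<le> exp (2 * \<kappa> * T) / \<rho>\<^sup>2" if j: "j < k" for j
      proof -
        have [measurable]: "?W (x j) \<in> borel_measurable M" by (rule Wm[OF j])
        show "B j \<in> sets M" unfolding B_def by measurable
        have "prob (B j) \<le> expectation (\<lambda>\<omega>. (?W (x j) \<omega>)\<^sup>2) / \<rho>\<^sup>2"
          unfolding B_def by (rule second_moment_method[OF Wm[OF j] W_second_moment(1)[OF sx[OF j]] \<rho>])
        also have "\<dots> \<le> exp (2 * \<kappa> * T) / \<rho>\<^sup>2"
        proof (rule divide_right_mono)
          have "exp (2 * \<kappa> * x j) \<le> exp (2 * \<kappa> * T)" using xT[of j] j \<kappa>_pos by simp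
          moreover have "0 < exp (- 2 * \<kappa> * s N)" by simp
          ultimately show "expectation (\<lambda>\<omega>. (?W (x j) \<omega>)\<^sup>2) \<le> exp (2 * \<kappa> * T)"
            unfolding W_second_moment(2)[OF sx[OF j] N(2)] by linarith
        qed simp
        finally show "prob (B j) \<le> exp (2 * \<kappa> * T) / \<rho>\<^sup>2" .
      qed
      define E where "E = (\<Union>j<k. A j \<union> B j)"
      have Es: "E \<in> sets M" unfolding E_def using A(1) B(1) by auto
      have "prob E \<le> (\<Sum>j<k. prob (A j \<union> B j))" unfolding E_def using A(1) B(1) by (intro measure_UNION_le) auto
      also have "\<dots> \<le> (\<Sum>j<k. (3 * (L * d)\<^sup>2 / \<epsilon>' ^ 3 + 1 / (real k)\<^sup>2) / \<epsilon>' + exp (2 * \<kappa> * T) / \<rho>\<^sup>2)"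
      proof (rule sum_mono)
        fix j assume "j \<in> {..<k}"
        then have j: "j < k" by simp
        have "prob (A j \<union> B j) \<le> prob (A j) + prob (B j)" using A(1)[OF j] B(1)[OF j] by (rule measure_Un_le)
        also have "\<dots> \<le> (3 * (L * d)\<^sup>2 / \<epsilon>' ^ 3 + 1 / (real k)\<^sup>2) / \<epsilon>' + exp (2 * \<kappa> * T) / \<rho>\<^sup>2"
          using order_trans[OF A(2)[OF j] divide_right_mono[OF ex[OF j]]] B(2)[OF j] pos(4) by (intro add_mono) auto
        finally show "prob (A j \<union> B j) \<le> (3 * (L * d)\<^sup>2 / \<epsilon>' ^ 3 + 1 / (real k)\<^sup>2) / \<epsilon>' + exp (2 * \<kappa> * T) / \<rho>\<^sup>2" .
      qed
      also have "\<dots> = c1 * (1 / real k)"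
      proof -
        have k0: "real k \<noteq> 0" using \<open>0 < k\<close> by simp
        have "real k * ((3 * (L * d)\<^sup>2 / \<epsilon>' ^ 3 + 1 / (real k)\<^sup>2) / \<epsilon>') = (12 * L\<^sup>2 * T\<^sup>2 / \<epsilon>' ^ 4 + 1 / \<epsilon>') / real k"
        proof -
          have "3 * (L * d)\<^sup>2 / \<epsilon>' ^ 3 + 1 / (real k)\<^sup>2 = (12 * L\<^sup>2 * T\<^sup>2 / \<epsilon>' ^ 3 + 1) / (real k)\<^sup>2"
            by (simp add: d_def power_mult_distrib power_divide add_divide_distrib mult_ac)
          moreover have "real k * (Y / (real k)\<^sup>2 / \<epsilon>') = (Y / \<epsilon>') / real k" for Y
            using k0 by (simp add: power2_eq_square)
          moreover have "(Y / \<epsilon>' ^ 3 + 1) / \<epsilon>' = Y / \<epsilon>' ^ 4 + 1 / \<epsilon>'" for Y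
            by (simp add: add_divide_distrib power3_eq_cube power4_eq_xxxx mult.assoc)
          ultimately show ?thesis by (simp only:)
        qed
        moreover have "real k * (exp (2 * \<kappa> * T) / \<rho>\<^sup>2) = (16 * exp (2 * \<kappa> * T) * C\<^sup>2 * T\<^sup>2 / \<epsilon>\<^sup>2) / real k"
        proof -
          have "exp (2 * \<kappa> * T) / \<rho>\<^sup>2 = exp (2 * \<kappa> * T) * (2 * C * d)\<^sup>2 / \<epsilon>\<^sup>2"
            by (simp add: \<rho>_def power_divide)
          moreover have "(2 * C * d)\<^sup>2 = 16 * C\<^sup>2 * T\<^sup>2 / (real k)\<^sup>2"
            by (simp add: d_def power_mult_distrib power_divide)
          moreover have "real k * (Y * (Z / (real k)\<^sup>2) / V) = (Y * Z / V) / real k" for Y Z V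
            using k0 by (simp add: power2_eq_square)
          ultimately have "real k * (exp (2 * \<kappa> * T) / \<rho>\<^sup>2) = (exp (2 * \<kappa> * T) * (16 * C\<^sup>2 * T\<^sup>2) / \<epsilon>\<^sup>2) / real k"
            by (simp only:)
          then show ?thesis by (simp add: mult_ac)
        qed
        ultimately show ?thesis by (simp add: c1_def distrib_left add_divide_distrib)
      qed
      finally have PE: "prob E \<le> \<eta>" using \<open>c1 * (1 / real k) < \<eta>\<close> by simp
      have close: "\<bar>?W t \<omega> / sqrt (den N t) - step_approx (-T) T k (\<lambda>t. ?W t \<omega> / sqrt (den N t)) t\<bar> \<le> \<epsilon>"
        if w: "\<omega> \<in> space M - E" and t: "t \<in> {-T..T}" for \<omega> t
      proof -
        have "\<bar>?W t \<omega> / sqrt (den N t) - ?W (x j) \<omega> / sqrt (den N (x j))\<bar> \<le> \<epsilon>" if j: "j < k" and tj: "t \<in> {x j..x (Suc j)}" for j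
        proof -
          have "\<omega> \<in> space M" "\<omega> \<notin> A j" "\<omega> \<notin> B j" using w j unfolding E_def by blast+
          then have wA: "\<omega> \<in> space M - A j" and wB: "\<bar>?W (x j) \<omega>\<bar> < \<rho>" by (auto simp: B_def)
          have a: "\<bar>?W t \<omega> - ?W (x j) \<omega>\<bar> \<le> 2 * \<epsilon>'" by (rule A(3)[OF j wA tj])
          have xj: "x j \<in> {-T..T}" using xT j by simp
          have dt: "\<delta> \<le> den N t" "\<delta> \<le> den N (x j)" using den_ge t xj by auto
          have i1: "1 / sqrt (den N t) \<le> K" unfolding K_def using dt \<delta>_pos by (intro frac_le) auto
          have "\<bar>den N t - den N (x j)\<bar> = exp (2 * \<kappa> * t) - exp (2 * \<kappa> * x j)"
            using tj \<kappa>_pos by (simp add: den_def)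
          also have "\<dots> \<le> L * (t - x j)" using exp_diff_le[of "2 * \<kappa>" "x j" t T] tj t \<kappa>_pos by (simp add: L_def)
          also have "\<dots> \<le> L * d" using tj xS[of j] pos(1) by (intro mult_left_mono) auto
          finally have dd: "\<bar>den N t - den N (x j)\<bar> \<le> L * d" .
          have i2: "\<bar>1 / sqrt (den N t) - 1 / sqrt (den N (x j))\<bar> \<le> C * d"
          proof -
            have "\<bar>1 / sqrt (den N t) - 1 / sqrt (den N (x j))\<bar> \<le> \<bar>den N t - den N (x j)\<bar> / (\<delta> * sqrt \<delta>)"
              by (rule inverse_sqrt_lipschitz[OF \<delta>_pos dt])
            also have "\<dots> \<le> L * d / (\<delta> * sqrt \<delta>)" using dd \<delta>_pos by (intro divide_right_mono) auto
            finally show ?thesis by (simp add: C_def)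
          qed
          have eq: "?W t \<omega> / sqrt (den N t) - ?W (x j) \<omega> / sqrt (den N (x j))
            = (?W t \<omega> - ?W (x j) \<omega>) * (1 / sqrt (den N t)) + ?W (x j) \<omega> * (1 / sqrt (den N t) - 1 / sqrt (den N (x j)))"
            by (simp add: algebra_simps)
          have "\<bar>?W t \<omega> / sqrt (den N t) - ?W (x j) \<omega> / sqrt (den N (x j))\<bar>
            \<le> \<bar>?W t \<omega> - ?W (x j) \<omega>\<bar> * (1 / sqrt (den N t)) + \<bar>?W (x j) \<omega>\<bar> * \<bar>1 / sqrt (den N t) - 1 / sqrt (den N (x j))\<bar>"
            unfolding eq using dt \<delta>_pos by (intro abs_mult_add_le) simp
          moreover have "\<bar>?W t \<omega> - ?W (x j) \<omega>\<bar> * (1 / sqrt (den N t)) \<le> 2 * \<epsilon>' * K"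
            using a i1 dt \<delta>_pos pos by (intro mult_mono) auto
          moreover have "\<bar>?W (x j) \<omega>\<bar> * \<bar>1 / sqrt (den N t) - 1 / sqrt (den N (x j))\<bar> \<le> \<rho> * (C * d)"
            using i2 wB \<rho> by (intro mult_mono) auto
          moreover have "2 * \<epsilon>' * K = \<epsilon> / 2" using pos(2) by (simp add: \<epsilon>'_def)
          moreover have "\<rho> * (C * d) = \<epsilon> / 2" using pos(3) d by (simp add: \<rho>_def)
          ultimately show ?thesis by linarith
        qed
        then show ?thesis
          using step_index[OF \<open>0 < k\<close> t, of "\<lambda>t. ?W t \<omega> / sqrt (den N t)"] e unfolding x_def by auto
      qed
      show ?case using Es PE close by blast
    qed
  qed
qed

end

end

section \<open>The limit theorem\<close>

lemma cadlag_on_cong: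
  assumes ab: "a < b" and eq: "\<And>t. t \<in> {a..b} \<Longrightarrow> x t = y t" and x: "cadlag_on a b x"
  shows "cadlag_on a b y"
  unfolding cadlag_on_def
proof (intro conjI ballI)
  fix t assume t: "t \<in> {a..<b}"
  then have "(x \<longlongrightarrow> y t) (at_right t)" using x eq[of t] unfolding cadlag_on_def by fastforce
  moreover have "eventually (\<lambda>u. x u = y u) (at_right t)"
    using eventually_at_right_real[of t b] t by (auto elim!: eventually_mono intro!: eq)
  ultimately show "(y \<longlongrightarrow> y t) (at_right t)" by (rule Lim_transform_eventually)
next
  fix t assume t: "t \<in> {a<..b}"
  then obtain l where "(x \<longlongrightarrow> l) (at_left t)" using x unfolding cadlag_on_def by blast
  moreover have "eventually (\<lambda>u. x u = y u) (at_left t)"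
    using eventually_at_left_real[of a t] t by (auto elim!: eventually_mono intro!: eq)
  ultimately show "\<exists>l. (y \<longlongrightarrow> l) (at_left t)" using Lim_transform_eventually by blast
qed

text \<open>A stationary Ornstein-Uhlenbeck process as time-changed Brownian motion. The shift by
  \<open>T\<close> keeps the Brownian time in \<open>{0..1}\<close> for \<open>t \<le> T\<close>,
  where the covariance of \<open>brownian\<close> has been computed.\<close>

definition ou :: "real \<Rightarrow> real \<Rightarrow> real \<Rightarrow> (nat \<Rightarrow> real) \<Rightarrow> real" where
  "ou \<kappa> T t \<omega> = exp (\<kappa> * (T - t)) * brownian (exp (2 * \<kappa> * (t - T))) \<omega>"

lemma ou_measurable[measurable]: "ou \<kappa> T t \<in> borel_measurable gauss_seq"
  unfolding ou_def by measurable

lemma ou_continuous: "continuous_on UNIV (\<lambda>t. ou \<kappa> T t \<omega>)"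
  unfolding ou_def
  by (intro continuous_intros continuous_on_compose2[OF brownian_continuous]) auto

lemma ou_char:
  assumes \<kappa>: "\<kappa> > 0" and ts: "\<And>j. j < m \<Longrightarrow> ts j \<le> T"
  shows "(CLINT \<omega>|gauss_seq. iexp (\<Sum>j<m. a j * ou \<kappa> T (ts j) \<omega>))
    = exp (- ((\<Sum>i<m. \<Sum>j<m. a i * a j * exp (- \<kappa> * \<bar>ts j - ts i\<bar>)) / 2))"
proof -
  \<comment> \<open>The minimum selects the earlier time; then the exponents in \<open>T\<close>
    cancel and only the distance of the two times remains.\<close>
  have e: "exp (\<kappa> * (T - t)) * exp (\<kappa> * (T - t')) * min (exp (2 * \<kappa> * (t - T))) (exp (2 * \<kappa> * (t' - T))) = exp (- \<kappa> * \<bar>t' - t\<bar>)" for t t'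
  proof (cases "t \<le> t'")
    case True
    then have "min (exp (2 * \<kappa> * (t - T))) (exp (2 * \<kappa> * (t' - T))) = exp (2 * \<kappa> * (t - T))" using \<kappa> by (simp add: min_def)
    then show ?thesis using True by (simp only: exp_add[symmetric]) (simp add: algebra_simps)
  next
    case False
    then have "min (exp (2 * \<kappa> * (t - T))) (exp (2 * \<kappa> * (t' - T))) = exp (2 * \<kappa> * (t' - T))" using \<kappa> by (simp add: min_def)
    then show ?thesis using False by (simp only: exp_add[symmetric]) (simp add: algebra_simps)
  qed
  have "(CLINT \<omega>|gauss_seq. iexp (\<Sum>j<m. a j * ou \<kappa> T (ts j) \<omega>))
     = (CLINT \<omega>|gauss_seq. iexp (\<Sum>j<m. (a j * exp (\<kappa> * (T - ts j))) * brownian (exp (2 * \<kappa> * (ts j - T))) \<omega>))"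
    by (simp only: ou_def mult.assoc)
  also have "\<dots> = exp (- ((\<Sum>i<m. \<Sum>j<m. (a i * exp (\<kappa> * (T - ts i))) * (a j * exp (\<kappa> * (T - ts j))) * min (exp (2 * \<kappa> * (ts i - T))) (exp (2 * \<kappa> * (ts j - T)))) / 2))"
  proof (rule brownian_char)
    fix j assume "j < m"
    then have "2 * \<kappa> * (ts j - T) \<le> 0" using \<kappa> ts by (simp add: mult_nonneg_nonpos)
    then show "exp (2 * \<kappa> * (ts j - T)) \<in> {0..1}" by simp
  qed
  also have "(\<Sum>i<m. \<Sum>j<m. (a i * exp (\<kappa> * (T - ts i))) * (a j * exp (\<kappa> * (T - ts j))) * min (exp (2 * \<kappa> * (ts i - T))) (exp (2 * \<kappa> * (ts j - T))))
     = (\<Sum>i<m. \<Sum>j<m. a i * a j * exp (- \<kappa> * \<bar>ts j - ts i\<bar>))"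
    unfolding e[symmetric] by (simp only: mult_ac)
  finally show ?thesis .
qed

context levy_particles begin

interpretation prob_space M by (rule Mprob)

theorem Znorm_weak_convergence:
  fixes s :: "nat \<Rightarrow> real" and T lam p :: real
  assumes T: "T > 0" and sT: "\<And>N. T + 1 \<le> s N" and s_lim: "filterlim s at_top sequentially"
    and lam: "eventually (\<lambda>N. lam * s N \<le> ln (real N)) sequentially"
    and p: "2 < p" "p \<le> 3" "\<psi> p - p / 2 * \<psi> 2 < (p / 2 - 1) * lam"
    and f: "skorokhod_bcont (-T) T f"
  shows "(\<lambda>N. expectation (\<lambda>\<omega>. f (\<lambda>t. Znorm M \<xi>s s N t \<omega>))) \<longlonglongrightarrow> integral\<^sup>L gauss_seq (\<lambda>\<omega>. f (\<lambda>t. ou \<kappa> T t \<omega>))"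
proof -
  define X where "X = (\<lambda>N t \<omega>. W (s N) N t \<omega> / sqrt (den s N t))"
  have ab: "-T < T" using T by simp
  have sp: "s N + t > 0" if "t \<in> {-T..T}" for N t using sT[of N] that by simp
  have dpos: "den s N t > 0" if "t \<in> {-T..T}" for N t
    using den_ge[OF T sT s_lim lam p that, of N] \<delta>_pos[OF T sT s_lim lam p] by linarith
  have ZX: "Znorm M \<xi>s s N t \<omega> = X N t \<omega>" if "t \<in> {-T..T}" for N t \<omega>
    unfolding X_def den_def[OF T sT s_lim lam p] by (rule Znorm_eq[OF sp[OF that]])
  have Xm: "X N t \<in> borel_measurable M" if "t \<in> {-T..T}" for N t
    unfolding X_def using sp[OF that, of N] by (intro borel_measurable_divide W_measurable) auto
  have Xc: "cadlag_on (-T) T (\<lambda>t. X N t \<omega>)" if w: "\<omega> \<in> space M" for N \<omega>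
    unfolding cadlag_on_def
  proof (intro conjI ballI)
    have cont: "((\<lambda>t. sqrt (den s N t)) \<longlongrightarrow> sqrt (den s N t)) (at t within S)" for t S
      unfolding den_def[OF T sT s_lim lam p] by (intro tendsto_intros)
    fix t assume t: "t \<in> {-T..<T}"
    then show "((\<lambda>t. X N t \<omega>) \<longlongrightarrow> X N t \<omega>) (at_right t)"
      unfolding X_def using sp[of t N] dpos[of t N] by (intro tendsto_divide cont W_right_continuous[OF w]) auto
  next
    have cont: "((\<lambda>t. sqrt (den s N t)) \<longlongrightarrow> sqrt (den s N t)) (at t within S)" for t S
      unfolding den_def[OF T sT s_lim lam p] by (intro tendsto_intros)
    fix t assume t: "t \<in> {-T<..T}"
    then obtain l where "((\<lambda>t. W (s N) N t \<omega>) \<longlongrightarrow> l) (at_left t)" using W_left_limit[OF w, of "s N" t N] sp[of t N] by auto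
    then have "((\<lambda>t. X N t \<omega>) \<longlongrightarrow> l / sqrt (den s N t)) (at_left t)"
      unfolding X_def using dpos[of t N] t by (intro tendsto_divide cont) auto
    then show "\<exists>l. ((\<lambda>t. X N t \<omega>) \<longlongrightarrow> l) (at_left t)" by blast
  qed
  \<comment> \<open>\<open>Znorm\<close> is identified with \<open>X\<close> only on
    \<open>{-T..T}\<close>, which is all that \<open>f\<close> can see.\<close>
  have fZX: "f (\<lambda>t. Znorm M \<xi>s s N t \<omega>) = f (\<lambda>t. X N t \<omega>)" if w: "\<omega> \<in> space M" for N \<omega>
  proof (rule skorokhod_bcont_cong[OF f ab _ Xc[OF w]])
    show "cadlag_on (-T) T (\<lambda>t. Znorm M \<xi>s s N t \<omega>)"
      by (rule cadlag_on_cong[OF ab _ Xc[OF w]]) (simp add: ZX)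
  qed (rule ZX)
  have "(\<lambda>N. expectation (\<lambda>\<omega>. f (\<lambda>t. X N t \<omega>))) \<longlonglongrightarrow> integral\<^sup>L gauss_seq (\<lambda>\<omega>. f (\<lambda>t. ou \<kappa> T t \<omega>))"
  proof (rule skorokhod_weak_convergence[where C=1, OF Mprob gauss.prob_space_axioms ab Xm ou_measurable Xc _ _ _ _ _ _ _ f])
    show "continuous_on {-T..T} (\<lambda>t. ou \<kappa> T t \<omega>)" for \<omega> using ou_continuous by (rule continuous_on_subset) simp
    show "(\<lambda>N. expectation (\<lambda>\<omega>. cos ((\<Sum>i<m. u i * X N (ts i) \<omega>) + c))) \<longlonglongrightarrow> integral\<^sup>L gauss_seq (\<lambda>\<omega>. cos ((\<Sum>i<m. u i * ou \<kappa> T (ts i) \<omega>) + c))"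
      if ts: "\<And>i. i < m \<Longrightarrow> ts i \<in> {-T..T}" for m :: nat and ts u c
    proof (rule cos_tendsto[OF _ gauss.prob_space_axioms])
      show "(\<lambda>\<omega>. \<Sum>i<m. u i * X N (ts i) \<omega>) \<in> borel_measurable M" for N
        using Xm ts by (intro borel_measurable_sum borel_measurable_times) auto
      show "(\<lambda>\<omega>. \<Sum>i<m. u i * ou \<kappa> T (ts i) \<omega>) \<in> borel_measurable gauss_seq" by measurable
      have "(\<lambda>N. exp (- (2 * \<kappa> * s N))) \<longlonglongrightarrow> 0" using \<kappa>_pos
        by (intro filterlim_compose[OF exp_at_bot] filterlim_uminus_at_bot_at_top[THEN filterlim_compose] filterlim_tendsto_pos_mult_at_top[OF tendsto_const _ s_lim]) auto
      \<comment> \<open>The normalising variances converge, so combinations of \<open>X\<close> are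
        combinations of \<open>W\<close> with convergent coefficients.\<close>
      then have dl: "(\<lambda>N. den s N t) \<longlonglongrightarrow> exp (2 * \<kappa> * t) - 0" for t
        unfolding den_def[OF T sT s_lim lam p] by (intro tendsto_diff tendsto_const) simp
      have L1: "(\<lambda>N. CLINT \<omega>|M. iexp (\<Sum>j<m. (u j / sqrt (den s N (ts j))) * W (s N) N (ts j) \<omega>))
        \<longlonglongrightarrow> exp (- (\<Sum>j<m. \<Sum>l<m. (u j / sqrt (exp (2 * \<kappa> * ts j))) * (u l / sqrt (exp (2 * \<kappa> * ts l))) * exp (2 * \<kappa> * min (ts j) (ts l))) / 2)"
      proof (rule W_char_tendsto[OF _ _ s_lim lam p])
        show "s N + ts j > 0" if "j < m" for N j by (rule sp[OF ts[OF that]])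
        show "0 \<le> s N" for N using sT[of N] T by simp
        show "(\<lambda>N. u j / sqrt (den s N (ts j))) \<longlonglongrightarrow> u j / sqrt (exp (2 * \<kappa> * ts j))" for j
          using tendsto_divide[OF tendsto_const tendsto_real_sqrt[OF dl[of "ts j"]], of "u j"] by simp
      qed
      \<comment> \<open>Division by the limiting standard deviations turns the Brownian covariance
        \<open>exp (2 * \<kappa> * min t t')\<close> into a stationary one.\<close>
      have V: "(u j / sqrt (exp (2 * \<kappa> * t))) * (u l / sqrt (exp (2 * \<kappa> * t'))) * exp (2 * \<kappa> * min t t') = u j * u l * exp (- \<kappa> * \<bar>t' - t\<bar>)" for j l t t'
      proof -
        have sq: "sqrt (exp (2 * \<kappa> * t)) = exp (\<kappa> * t)" for t
          by (rule real_sqrt_unique) (simp_all add: power2_eq_square exp_add[symmetric])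
        have eq: "exp (2 * \<kappa> * min t t') / (exp (\<kappa> * t) * exp (\<kappa> * t')) = exp (- \<kappa> * \<bar>t' - t\<bar>)"
          unfolding exp_add[symmetric] exp_diff[symmetric] by (simp add: min_def algebra_simps)
        have "(u j / exp (\<kappa> * t)) * (u l / exp (\<kappa> * t')) * exp (2 * \<kappa> * min t t')
          = u j * u l * (exp (2 * \<kappa> * min t t') / (exp (\<kappa> * t) * exp (\<kappa> * t')))" by simp
        then show ?thesis unfolding sq eq .
      qed
      have S: "(\<Sum>j<m. (u j / sqrt (den s N (ts j))) * W (s N) N (ts j) \<omega>) = (\<Sum>i<m. u i * X N (ts i) \<omega>)" for N \<omega>
        by (simp add: X_def)
      have oc: "(CLINT \<omega>|gauss_seq. iexp (\<Sum>i<m. u i * ou \<kappa> T (ts i) \<omega>)) = exp (- ((\<Sum>i<m. \<Sum>j<m. u i * u j * exp (- \<kappa> * \<bar>ts j - ts i\<bar>)) / 2))"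
        using ts by (intro ou_char[OF \<kappa>_pos]) auto
      show "(\<lambda>N. CLINT \<omega>|M. iexp (\<Sum>i<m. u i * X N (ts i) \<omega>)) \<longlonglongrightarrow> (CLINT \<omega>|gauss_seq. iexp (\<Sum>i<m. u i * ou \<kappa> T (ts i) \<omega>))"
        using L1[unfolded S V] unfolding oc minus_divide_left .
    qed
    show "integrable M (\<lambda>\<omega>. (X N t \<omega>)\<^sup>2)" if "t \<in> {-T..T}" for N t
      unfolding X_def power_divide using W_second_moment(1)[OF sp[OF that]] by simp
    show "expectation (\<lambda>\<omega>. (X N t \<omega>)\<^sup>2) \<le> 1" if t: "t \<in> {-T..T}" for N t
    proof (cases "N = 0")
      case False
      then have "expectation (\<lambda>\<omega>. (W (s N) N t \<omega>)\<^sup>2) = den s N t"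
        unfolding den_def[OF T sT s_lim lam p] by (intro W_second_moment(2)[OF sp[OF t]]) simp
      then show ?thesis unfolding X_def power_divide using dpos[OF t, of N] by simp
    qed (simp add: X_def W_def)
    have ch: "(CLINT \<omega>|gauss_seq. iexp (u * ou \<kappa> T t \<omega>)) = exp (- (u\<^sup>2 * 1 / 2))" if "t \<in> {-T..T}" for u t
      using ou_char[OF \<kappa>_pos, of "Suc 0" "\<lambda>_. t" T "\<lambda>_. u"] that by (simp add: power2_eq_square)
    show "integrable gauss_seq (\<lambda>\<omega>. (ou \<kappa> T t \<omega>)\<^sup>2)" "integral\<^sup>L gauss_seq (\<lambda>\<omega>. (ou \<kappa> T t \<omega>)\<^sup>2) \<le> 1" if t: "t \<in> {-T..T}" for t
      using gauss.gaussian_char_moments(1,2)[OF ou_measurable _ ch[OF t]] by simp_all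
    show "\<forall>\<^sub>F k in sequentially. \<forall>\<^sub>F N in sequentially. \<exists>A\<in>sets M. prob A \<le> \<eta> \<and>
        (\<forall>\<omega>\<in>space M - A. \<forall>t\<in>{-T..T}. \<bar>X N t \<omega> - step_approx (-T) T k (\<lambda>t. X N t \<omega>) t\<bar> \<le> \<epsilon>)" if "\<epsilon> > 0" "\<eta> > 0" for \<epsilon> \<eta>
      unfolding X_def by (rule W_scaled_tight[OF T sT s_lim lam p that])
  qed
  then show ?thesis using fZX by (simp cong: Bochner_Integration.integral_cong)
qed

end

theorem theorem1p2:
  fixes M0 :: "'b measure" and \<xi> :: "real \<Rightarrow> 'b \<Rightarrow> real"
    and M :: "'a measure" and \<xi>s :: "nat \<Rightarrow> real \<Rightarrow> 'a \<Rightarrow> real"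
    and s :: "nat \<Rightarrow> real" and T :: real
  assumes levy: "levy_process M0 \<xi>"
    and mgf: "\<And>u. integrable M0 (\<lambda>\<omega>. exp (u * \<xi> 1 \<omega>))"
    and nonconst: "\<not> (\<exists>c. AE \<omega> in M0. \<xi> 1 \<omega> = c)"
    and Mprob: "prob_space M"
    and copies: "\<And>i. i \<ge> 1 \<Longrightarrow> levy_process M (\<xi>s i) \<and> path_law M (\<xi>s i) = path_law M0 \<xi>"
    and indep: "prob_space.indep_vars M (\<lambda>_. Pi\<^sub>M {0..} (\<lambda>_. borel))
                  (\<lambda>i \<omega>. restrict (\<lambda>t. \<xi>s i t \<omega>) {0..}) {1..}"
    and s_nonneg: "\<And>N. s N \<ge> 0"
    and s_lim: "filterlim s at_top sequentially"
    and s_liminf: "Liminf sequentially (\<lambda>N. ereal (ln (real N) / s N))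
                     > ereal (2 * deriv (cumulant M0 \<xi>) 2 - cumulant M0 \<xi> 2)"
    and T_pos: "T > 0"
  shows "\<exists>Q :: (real \<Rightarrow> real) measure.
           prob_space Q \<and>
           (\<forall>t. (\<lambda>\<omega>. \<omega> t) \<in> borel_measurable Q) \<and>
           (\<forall>\<omega>\<in>space Q. cadlag_on (-T) T \<omega>) \<and>
           centred_gaussian_process_on Q {-T..T}
             (\<lambda>t1 t2. exp ((cumulant M0 \<xi> 1 - cumulant M0 \<xi> 2 / 2) * \<bar>t2 - t1\<bar>)) \<and>
           (\<forall>f. skorokhod_bcont (-T) T f \<longrightarrow>
              (\<lambda>N. integral\<^sup>L M (\<lambda>\<omega>. f (\<lambda>t. Znorm M \<xi>s s N t \<omega>)))
                \<longlonglongrightarrow> integral\<^sup>L Q f)"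
proof -
  interpret levy_particles M0 \<xi> M \<xi>s
    by (rule levy_particles.intro) (fact levy, fact mgf, fact nonconst, fact Mprob, fact copies, fact indep)
  let ?X = "\<lambda>\<omega> t. ou \<kappa> T t \<omega>"
  obtain D where D: "(cumulant M0 \<xi> has_real_derivative D) (at 2)"
    using cumulant_DERIV_2[where \<xi>=\<xi>, OF levy_prob_space[OF levy] mgf levy_measurable[OF levy zero_le_one]] by blast
  have "ereal (2 * D - cumulant M0 \<xi> 2) < Liminf sequentially (\<lambda>N. ereal (ln (real N) / s N))"
    using s_liminf by (simp add: DERIV_imp_deriv[OF D])
  \<comment> \<open>A real number strictly between the threshold and the liminf leaves room on both
    sides: \<open>lam * s N \<le> ln N\<close> holds eventually, and an admissible exponent
    \<open>p > 2\<close> exists.\<close>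
  from ereal_dense2[OF this] obtain lam where "ereal (2 * D - cumulant M0 \<xi> 2) < ereal lam"
    and lam2: "ereal lam < Liminf sequentially (\<lambda>N. ereal (ln (real N) / s N))" by blast
  then have lam1: "2 * D - cumulant M0 \<xi> 2 < lam" by simp
  obtain p where p: "2 < p" "p \<le> 3" "cumulant M0 \<xi> p - p / 2 * cumulant M0 \<xi> 2 < (p / 2 - 1) * lam"
    using lyapunov_exponent_exists[OF D lam1] .
  \<comment> \<open>Only finitely many indices change, so limits are unaffected, while the estimates
    on \<open>{-T..T}\<close> now hold for every \<open>N\<close> with a margin.\<close>
  define s' where "s' = (\<lambda>N. max (s N) (T + 1))"
  have "eventually (\<lambda>N. T + 1 \<le> s N) sequentially" using s_lim by (simp add: filterlim_at_top)
  then have ev: "eventually (\<lambda>N. s' N = s N \<and> T + 1 \<le> s N) sequentially"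
    by eventually_elim (simp add: s'_def)
  have s'_lim: "filterlim s' at_top sequentially"
    by (rule filterlim_at_top_mono[OF s_lim]) (simp add: s'_def)
  have s'_lam: "eventually (\<lambda>N. lam * s' N \<le> ln (real N)) sequentially"
    using less_LiminfD[OF lam2] ev
  proof eventually_elim
    case (elim N)
    then have "0 < s N" "lam < ln (real N) / s N" using T_pos by auto
    then show ?case using elim by (simp add: less_divide_eq less_imp_le)
  qed
  \<comment> \<open>The law is placed on continuous paths so that every point of its space is
    cadlag. The trace of the product sigma-algebra is taken because the continuous functions do not
    form an event of the uncountable product.\<close>
  define C where "C = {x :: real \<Rightarrow> real. continuous_on UNIV x}"
  define B where "B = restrict_space (Pi\<^sub>M UNIV (\<lambda>_::real. borel :: real measure)) C"
  define Q where "Q = distr gauss_seq B ?X"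
  have XB: "?X \<in> gauss_seq \<rightarrow>\<^sub>M B"
    unfolding B_def
  proof (rule measurable_restrict_space2)
    show "?X \<in> space gauss_seq \<rightarrow> C" using ou_continuous by (auto simp: C_def)
    show "?X \<in> gauss_seq \<rightarrow>\<^sub>M Pi\<^sub>M UNIV (\<lambda>_. borel)"
      by (rule measurable_PiM_single') (auto intro: ou_measurable)
  qed
  have spB: "space B = C" by (simp add: B_def space_restrict_space space_PiM)
  have coB: "(\<lambda>x. x t) \<in> borel_measurable B" for t
    unfolding B_def by (intro measurable_restrict_space1 measurable_component_singleton) simp
  have cadB: "cadlag_on (-T) T x" if "x \<in> space B" for x
    using that T_pos unfolding spB C_def by (intro continuous_imp_cadlag_on) (auto intro: continuous_on_subset)
  interpret Q: prob_space Q unfolding Q_def by (rule gauss.prob_space_distr[OF XB])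
  have coQ: "(\<lambda>x. x t) \<in> borel_measurable Q" for t using coB unfolding Q_def by simp
  have gp: "centred_gaussian_process_on Q {-T..T}
      (\<lambda>t1 t2. exp ((cumulant M0 \<xi> 1 - cumulant M0 \<xi> 2 / 2) * \<bar>t2 - t1\<bar>))"
    unfolding centred_gaussian_process_on_def
  proof (intro allI impI)
    fix ts a :: "real list" assume len: "length a = length ts" and ts: "set ts \<subseteq> {-T..T}"
    let ?Z = "\<lambda>x. \<Sum>i<length ts. a ! i * x (ts ! i)"
    define v where "v = (\<Sum>i<length ts. \<Sum>j<length ts. a ! i * a ! j * exp ((cumulant M0 \<xi> 1 - cumulant M0 \<xi> 2 / 2) * \<bar>ts ! j - ts ! i\<bar>))"
    have Zm: "?Z \<in> borel_measurable B" using coB by (intro borel_measurable_sum borel_measurable_times) auto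
    have ch: "(CLINT x|Q. iexp (u * ?Z x)) = exp (- (u\<^sup>2 * v / 2))" for u
    proof -
      have em: "(\<lambda>x. iexp (u * ?Z x)) \<in> borel_measurable B" using Zm by measurable
      have "(CLINT x|Q. iexp (u * ?Z x)) = (CLINT \<omega>|gauss_seq. iexp (u * ?Z (?X \<omega>)))"
        unfolding Q_def by (rule integral_distr[OF XB em])
      also have "\<dots> = (CLINT \<omega>|gauss_seq. iexp (\<Sum>i<length ts. (u * a ! i) * ou \<kappa> T (ts ! i) \<omega>))"
        by (simp add: sum_distrib_left mult.assoc)
      also have "\<dots> = exp (- ((\<Sum>i<length ts. \<Sum>j<length ts. (u * a ! i) * (u * a ! j) * exp (- \<kappa> * \<bar>ts ! j - ts ! i\<bar>)) / 2))"
        using ts by (intro ou_char[OF \<kappa>_pos]) (auto dest: nth_mem)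
      also have "(\<Sum>i<length ts. \<Sum>j<length ts. (u * a ! i) * (u * a ! j) * exp (- \<kappa> * \<bar>ts ! j - ts ! i\<bar>)) = u\<^sup>2 * v"
        by (simp add: v_def \<kappa>_def sum_distrib_left power2_eq_square mult_ac)
      finally show ?thesis .
    qed
    \<comment> \<open>That the quadratic form \<open>v\<close> is nonnegative is read off from the
      bound 1 on the modulus of a characteristic function, at argument 1.\<close>
    have "cmod (CLINT x|Q. iexp (1 * ?Z x)) \<le> (LINT x|Q. 1)"
      by (rule order_trans[OF integral_norm_bound]) simp
    then have "exp (- (v / 2)) \<le> 1" unfolding ch by (simp add: Q.prob_space)
    then have "v \<ge> 0" by simp
    then show "gaussian_rv Q ?Z 0 (\<Sum>i<length ts. \<Sum>j<length ts. a ! i * a ! j * exp ((cumulant M0 \<xi> 1 - cumulant M0 \<xi> 2 / 2) * \<bar>ts ! j - ts ! i\<bar>))"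
      unfolding v_def[symmetric] using Zm by (intro Q.gaussian_char_imp_gaussian_rv ch) (simp_all add: Q_def)
  qed
  have lim: "(\<lambda>N. integral\<^sup>L M (\<lambda>\<omega>. f (\<lambda>t. Znorm M \<xi>s s N t \<omega>))) \<longlonglongrightarrow> integral\<^sup>L Q f"
    if f: "skorokhod_bcont (-T) T f" for f
  proof -
    \<comment> \<open>The measurability result for functionals is applied to the coordinate process
      on \<open>B\<close>, whose paths are the points of the space themselves.\<close>
    have fm: "f \<in> borel_measurable B"
      using skorokhod_bcont_measurable[OF f, of "\<lambda>t x. x t" B] coB cadB T_pos by simp
    have "(\<lambda>N. integral\<^sup>L M (\<lambda>\<omega>. f (\<lambda>t. Znorm M \<xi>s s' N t \<omega>))) \<longlonglongrightarrow> integral\<^sup>L gauss_seq (\<lambda>\<omega>. f (?X \<omega>))"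
      by (rule Znorm_weak_convergence[OF T_pos _ s'_lim s'_lam p f]) (simp add: s'_def)
    moreover have "eventually (\<lambda>N. integral\<^sup>L M (\<lambda>\<omega>. f (\<lambda>t. Znorm M \<xi>s s' N t \<omega>)) = integral\<^sup>L M (\<lambda>\<omega>. f (\<lambda>t. Znorm M \<xi>s s N t \<omega>))) sequentially"
      using ev
    proof eventually_elim
      case (elim N)
      then have "Zsum \<xi>s s' N = Zsum \<xi>s s N" by (simp add: Zsum_def fun_eq_iff)
      then show ?case by (simp add: Znorm_def)
    qed
    ultimately have "(\<lambda>N. integral\<^sup>L M (\<lambda>\<omega>. f (\<lambda>t. Znorm M \<xi>s s N t \<omega>))) \<longlonglongrightarrow> integral\<^sup>L gauss_seq (\<lambda>\<omega>. f (?X \<omega>))"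
      by (rule Lim_transform_eventually)
    then show ?thesis unfolding Q_def by (simp add: integral_distr[OF XB fm])
  qed
  have cadQ: "\<forall>x\<in>space Q. cadlag_on (-T) T x" using cadB by (simp add: Q_def)
  have "\<forall>f. skorokhod_bcont (-T) T f \<longrightarrow>
      (\<lambda>N. integral\<^sup>L M (\<lambda>\<omega>. f (\<lambda>t. Znorm M \<xi>s s N t \<omega>))) \<longlonglongrightarrow> integral\<^sup>L Q f"
    using lim by (intro allI impI)
  moreover have "\<forall>t. (\<lambda>x. x t) \<in> borel_measurable Q" using coQ by (rule allI)
  ultimately show ?thesis
    using Q.prob_space_axioms cadQ gp by (intro exI[of _ Q] conjI)
qed

end
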